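(* Let $C$ be a commutative ring with identity, $\lambda\in C$, and $A$ a $C$-algebra with identity. Assume that $\lambda$ is not a zero divisor in $\overline A$. Then the morphism of Baxter $C$-algebras (of weight $\lambda$) $$\Phi:\mathrm{Sh}_C(A)\to\mathfrak S(A)$$ induced by sending $a\in A$ to $t^{(a)}=(t^{(a)}_1,\dots,t^{(a)}_n,\dots)$ is an isomorphism.
   Context: All rings and algebras are associative, commutative, with identity; $\otimes=\otimes_C$; $\mathbb N=\{0,1,2,\dots\}$. A Baxter $C$-algebra (of weight $\lambda$) is a pair $(R,P)$ with $R$ a $C$-algebra and $P:R\to R$ a $C$-linear map satisfying $P(x)P(y)=P(xP(y))+P(yP(x))+\lambda P(xy)$. A homomorphism $f:(R,P)\to(S,Q)$ is a $C$-algebra homomorphism with $f\circ P=Q\circ f$. Shuffle Baxter algebra. For $m,n\ge1$ let $S(m,n)$ be the set of $\sigma\in S_{m+n}$ with $\sigma^{-1}(1)<\dots<\sigma^{-1}(m)$ and $\sigma^{-1}(m+1)<\dots<\sigma^{-1}(m+n)$. A pair $(k,k+1)$, $1\le k<m+n$, is admissible for $\sigma$ if $\sigma(k)\le m<\sigma(k+1)$; $\mathcal T^\sigma$ is the set of admissible pairs; $\bar S(m,n)=\{(\sigma,T):\sigma\in S(m,n),\,T\subseteq\mathcal T^\sigma\}$. For $x=x_1\otimes\dots\otimes x_m$, $y=y_1\otimes\dots\otimes y_n$, put $u_k=x_k$ for $k\le m$, $u_k=y_{k-m}$ for $k>m$, and let $\sigma(x\otimes y;T)$ be obtained from $u_{\sigma(1)}\otimes\dots\otimes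 u_{\sigma(m+n)}$ by replacing, for each $(k,k+1)\in T$, the tensor symbol between $u_{\sigma(k)}$ and $u_{\sigma(k+1)}$ by the product in $A$. Let $\mathrm{Sh}_C(A)=\bigoplus_{k\in\mathbb N}A^{\otimes(k+1)}$ with $C$-bilinear product determined by $$(x_0\otimes x)\diamond(y_0\otimes y)=\sum_{(\sigma,T)\in\bar S(m,n)}\lambda^{|T|}\,x_0y_0\otimes\sigma(x\otimes y;T)$$ for $m,n\ge1$ and $x_0\diamond(y_0\otimes\dots\otimes y_n)=(y_0\otimes\dots\otimes y_n)\diamond x_0=x_0y_0\otimes y_1\otimes\dots\otimes y_n$ for $x_0\in A$. With $P_A(x_0\otimes\dots\otimes x_n)=1_A\otimes x_0\otimes\dots\otimes x_n$ and the inclusion of $A$ as the $k=0$ summand, $(\mathrm{Sh}_C(A),P_A)$ is a free Baxter $C$-algebra of weight $\lambda$ on $A$: every $C$-algebra homomorphism from $A$ to a Baxter $C$-algebra $R$ of weight $\lambda$ extends uniquely to a Baxter homomorphism $\mathrm{Sh}_C(A)\to R$. Standard Baxter algebra. $\overline A=\varinjlim A^{\otimes n}$ is the direct limit of the tensor power $C$-algebras along $A^{\otimes n}\to A^{\otimes(n+1)}$, $x\mapsto x\otimes1_A$. $\mathfrak A(A)$ is the algebra of sequences $(a_1,a_2,\dots)$ with entries in $\overline A$, with componentwise operations, and $P'_A(a_1,a_2,a_3,\dots)=\lambda(0,a_1,a_1+a_2,a_1+a_2+a_3,\dots)$; $(\mathfrak A(A),P'_A)$ is a Baxter $C$-algebra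 of weight $\lambda$. For $a\in A$, $t^{(a)}=(t^{(a)}_k)_{k\ge1}\in\mathfrak A(A)$ is given by $t^{(a)}_k=1\otimes\dots\otimes1\otimes a$ ($k$ factors, $a$ in position $k$); $a\mapsto t^{(a)}$ is a $C$-algebra homomorphism. $\mathfrak S(A)$ is the (unital) Baxter subalgebra of $\mathfrak A(A)$ generated by the $t^{(a)}$, $a\in A$. *)

theory Defs
  imports "HOL-Combinatorics.Permutations" "HOL-Algebra.QuotRing" "HOL-Algebra.Subrings" "HOL-Algebra.Module"
begin

section \<open>Baxter algebras\<close>

locale baxter_algebra = algebra C R
  for C (structure) and lam and R (structure) and P +
  assumes weight_closed: "lam \<in> carrier C"
    and P_closed: "x \<in> carrier R \<Longrightarrow> P x \<in> carrier R"
    and P_add: "\<lbrakk>x \<in> carrier R; y \<in> carrier R\<rbrakk> \<Longrightarrow> P (x \<oplus>\<^bsub>R\<^esub> y) = P x \<oplus>\<^bsub>R\<^esub> P y"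
    and P_smult: "\<lbrakk>c \<in> carrier C; x \<in> carrier R\<rbrakk> \<Longrightarrow> P (c \<odot>\<^bsub>R\<^esub> x) = c \<odot>\<^bsub>R\<^esub> P x"
    and baxter_identity: "\<lbrakk>x \<in> carrier R; y \<in> carrier R\<rbrakk> \<Longrightarrow>
      P x \<otimes>\<^bsub>R\<^esub> P y =
        P (x \<otimes>\<^bsub>R\<^esub> P y) \<oplus>\<^bsub>R\<^esub> P (y \<otimes>\<^bsub>R\<^esub> P x) \<oplus>\<^bsub>R\<^esub> lam \<odot>\<^bsub>R\<^esub> P (x \<otimes>\<^bsub>R\<^esub> y)"

definition algebra_hom ::
  "('c, 'k) ring_scheme \<Rightarrow> ('c, 'r, 'm) module_scheme \<Rightarrow> ('c, 's, 'n) module_scheme \<Rightarrow> ('r \<Rightarrow> 's) set"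
  where "algebra_hom C R S =
    {f \<in> ring_hom R S. \<forall>c\<in>carrier C. \<forall>x\<in>carrier R. f (c \<odot>\<^bsub>R\<^esub> x) = c \<odot>\<^bsub>S\<^esub> f x}"

definition baxter_hom ::
  "('c, 'k) ring_scheme \<Rightarrow> ('c, 'r, 'm) module_scheme \<Rightarrow> ('r \<Rightarrow> 'r)
    \<Rightarrow> ('c, 's, 'n) module_scheme \<Rightarrow> ('s \<Rightarrow> 's) \<Rightarrow> ('r \<Rightarrow> 's) set"
  where "baxter_hom C R P S Q =
    {f \<in> algebra_hom C R S. \<forall>x\<in>carrier R. f (P x) = Q (f x)}"

definition baxter_iso ::
  "('c, 'k) ring_scheme \<Rightarrow> ('c, 'r, 'm) module_scheme \<Rightarrow> ('r \<Rightarrow> 'r)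
    \<Rightarrow> ('c, 's, 'n) module_scheme \<Rightarrow> ('s \<Rightarrow> 's) \<Rightarrow> ('r \<Rightarrow> 's) set"
  where "baxter_iso C R P S Q =
    {f \<in> baxter_hom C R P S Q. bij_betw f (carrier R) (carrier S)}"

definition baxter_subalgebra ::
  "('c, 'k) ring_scheme \<Rightarrow> ('c, 'r, 'm) module_scheme \<Rightarrow> ('r \<Rightarrow> 'r) \<Rightarrow> 'r set \<Rightarrow> bool"
  where "baxter_subalgebra C R P H \<longleftrightarrow>
    subring H R \<and> submodule H C R \<and> (\<forall>x\<in>H. P x \<in> H)"

definition baxter_generated ::
  "('c, 'k) ring_scheme \<Rightarrow> ('c, 'r, 'm) module_scheme \<Rightarrow> ('r \<Rightarrow> 'r) \<Rightarrow> 'r set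
    \<Rightarrow> ('c, 'r, 'm) module_scheme"
  where "baxter_generated C R P X =
    R\<lparr>carrier := \<Inter>{H. baxter_subalgebra C R P H \<and> X \<subseteq> H}\<rparr>"


section \<open>Tensor powers of an algebra\<close>

text \<open>
  The records below that describe mere modules leave \<open>mult\<close> and \<open>one\<close> unspecified;
  the locale \<open>module\<close> does not refer to these fields.
\<close>

definition free_module :: "('c, 'k) ring_scheme \<Rightarrow> 'b set \<Rightarrow> ('c, 'b \<Rightarrow> 'c) module"
  where "free_module C S =
    \<lparr>carrier = {f. (\<forall>x. f x \<in> carrier C) \<and> finite {x. f x \<noteq> \<zero>\<^bsub>C\<^esub>} \<and> (\<forall>x. x \<notin> S \<longrightarrow> f x = \<zero>\<^bsub>C\<^esub>)},
     mult = undefined, one = undefined,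
     zero = (\<lambda>x. \<zero>\<^bsub>C\<^esub>), add = (\<lambda>f g x. f x \<oplus>\<^bsub>C\<^esub> g x),
     smult = (\<lambda>c f x. c \<otimes>\<^bsub>C\<^esub> f x)\<rparr>"

definition free_gen :: "('c, 'k) ring_scheme \<Rightarrow> 'b \<Rightarrow> 'b \<Rightarrow> 'c"
  where "free_gen C b = (\<lambda>x. if x = b then \<one>\<^bsub>C\<^esub> else \<zero>\<^bsub>C\<^esub>)"

definition module_span ::
  "('c, 'k) ring_scheme \<Rightarrow> ('c, 'r, 'm) module_scheme \<Rightarrow> 'r set \<Rightarrow> 'r set"
  where "module_span C M X = \<Inter>{H. submodule H C M \<and> X \<subseteq> H}"

definition quot_module :: "('c, 'r, 'm) module_scheme \<Rightarrow> 'r set \<Rightarrow> ('c, 'r set) module"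
  where "quot_module M N =
    \<lparr>carrier = a_rcosets\<^bsub>M\<^esub> N, mult = undefined, one = undefined,
     zero = N, add = set_add M,
     smult = (\<lambda>c X. \<Union>x\<in>X. N +>\<^bsub>M\<^esub> (c \<odot>\<^bsub>M\<^esub> x))\<rparr>"

definition tuples :: "('a, 'm) ring_scheme \<Rightarrow> nat \<Rightarrow> 'a list set"
  where "tuples A n = {us. length us = n \<and> set us \<subseteq> carrier A}"

definition multilinear_relations ::
  "('c, 'k) ring_scheme \<Rightarrow> ('c, 'a, 'm) module_scheme \<Rightarrow> nat \<Rightarrow> ('a list \<Rightarrow> 'c) set"
  where "multilinear_relations C A n =
    (let F = free_module C (tuples A n); e = free_gen C in
      {e (us[i := a \<oplus>\<^bsub>A\<^esub> b]) \<ominus>\<^bsub>F\<^esub> (e (us[i := a]) \<oplus>\<^bsub>F\<^esub> e (us[i := b])) | us i a b.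
        us \<in> tuples A n \<and> i < n \<and> a \<in> carrier A \<and> b \<in> carrier A}
      \<union> {e (us[i := c \<odot>\<^bsub>A\<^esub> a]) \<ominus>\<^bsub>F\<^esub> (c \<odot>\<^bsub>F\<^esub> e (us[i := a])) | us i c a.
        us \<in> tuples A n \<and> i < n \<and> c \<in> carrier C \<and> a \<in> carrier A})"

type_synonym ('a, 'c) tensor = "('a list \<Rightarrow> 'c) set"

definition tensor_module ::
  "('c, 'k) ring_scheme \<Rightarrow> ('c, 'a, 'm) module_scheme \<Rightarrow> nat \<Rightarrow> ('c, ('a, 'c) tensor) module"
  where "tensor_module C A n =
    (let F = free_module C (tuples A n)
     in quot_module F (module_span C F (multilinear_relations C A n)))"

text \<open>The pure tensor \<open>u\<^sub>1 \<otimes> \<dots> \<otimes> u\<^sub>n\<close> of a list \<open>[u\<^sub>1, \<dots>, u\<^sub>n]\<close>.\<close>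

definition pure_tensor ::
  "('c, 'k) ring_scheme \<Rightarrow> ('c, 'a, 'm) module_scheme \<Rightarrow> 'a list \<Rightarrow> ('a, 'c) tensor"
  where "pure_tensor C A us =
    (let F = free_module C (tuples A (length us))
     in module_span C F (multilinear_relations C A (length us)) +>\<^bsub>F\<^esub> free_gen C us)"

text \<open>
  The linear map on a tensor power that sends every pure tensor \<open>u\<^sub>1 \<otimes> \<dots> \<otimes> u\<^sub>n\<close> to
  \<open>h [u\<^sub>1, \<dots>, u\<^sub>n]\<close>, for multilinear \<open>h\<close>.  A tensor is a coset of representatives \<open>f\<close>; multilinearity
  of \<open>h\<close> makes the sum independent of \<open>f\<close>.
\<close>

definition tensor_lift ::
  "('c, 'k) ring_scheme \<Rightarrow> ('c, 'r, 'n) module_scheme \<Rightarrow> ('a list \<Rightarrow> 'r) \<Rightarrow> ('a, 'c) tensor \<Rightarrow> 'r"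
  where "tensor_lift C M h X =
    the_elem ((\<lambda>f. \<Oplus>\<^bsub>M\<^esub>us\<in>{us. f us \<noteq> \<zero>\<^bsub>C\<^esub>}. f us \<odot>\<^bsub>M\<^esub> h us) ` X)"

definition tensor_power ::
  "('c, 'k) ring_scheme \<Rightarrow> ('c, 'a, 'm) module_scheme \<Rightarrow> nat \<Rightarrow> ('c, ('a, 'c) tensor) module"
  where "tensor_power C A n =
    (tensor_module C A n)
      \<lparr>mult := (\<lambda>X Y.
         tensor_lift C (tensor_module C A n) (\<lambda>us.
           tensor_lift C (tensor_module C A n) (\<lambda>vs.
             pure_tensor C A (map2 (mult A) us vs)) Y) X),
       one := pure_tensor C A (replicate n \<one>\<^bsub>A\<^esub>)\<rparr>"


section \<open>The shuffle Baxter algebra\<close>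

definition direct_sum :: "(nat \<Rightarrow> ('c, 'r, 'm) module_scheme) \<Rightarrow> ('c, nat \<Rightarrow> 'r) module"
  where "direct_sum M =
    \<lparr>carrier = {X. (\<forall>k. X k \<in> carrier (M k)) \<and> finite {k. X k \<noteq> \<zero>\<^bsub>M k\<^esub>}},
     mult = undefined, one = undefined,
     zero = (\<lambda>k. \<zero>\<^bsub>M k\<^esub>), add = (\<lambda>X Y k. X k \<oplus>\<^bsub>M k\<^esub> Y k),
     smult = (\<lambda>c X k. c \<odot>\<^bsub>M k\<^esub> X k)\<rparr>"

definition shuffle_perms :: "nat \<Rightarrow> nat \<Rightarrow> (nat \<Rightarrow> nat) set"
  where "shuffle_perms m n =
    {\<sigma>. \<sigma> permutes {1..m + n}
       \<and> strict_mono_on {1..m} (inv_into UNIV \<sigma>)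
       \<and> strict_mono_on {m + 1..m + n} (inv_into UNIV \<sigma>)}"

definition admissible_pairs :: "nat \<Rightarrow> nat \<Rightarrow> (nat \<Rightarrow> nat) \<Rightarrow> (nat \<times> nat) set"
  where "admissible_pairs m n \<sigma> =
    {(k, k + 1) | k. 1 \<le> k \<and> k < m + n \<and> \<sigma> k \<le> m \<and> m < \<sigma> (k + 1)}"

definition mixable_shuffles :: "nat \<Rightarrow> nat \<Rightarrow> ((nat \<Rightarrow> nat) \<times> (nat \<times> nat) set) set"
  where "mixable_shuffles m n = {(\<sigma>, T). \<sigma> \<in> shuffle_perms m n \<and> T \<subseteq> admissible_pairs m n \<sigma>}"

text \<open>
  In \<open>merge_at A T k us\<close> the head of \<open>us\<close> ends at position \<open>k\<close> of the original word; the tensor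
  symbol between positions \<open>k\<close> and \<open>k + 1\<close> is replaced by the product of \<open>A\<close> whenever
  \<open>(k, k + 1) \<in> T\<close>.
\<close>

fun merge_at :: "('a, 'm) ring_scheme \<Rightarrow> (nat \<times> nat) set \<Rightarrow> nat \<Rightarrow> 'a list \<Rightarrow> 'a list"
  where
    "merge_at A T k [] = []"
  | "merge_at A T k [u] = [u]"
  | "merge_at A T k (u # v # us) =
      (if (k, k + 1) \<in> T then merge_at A T (k + 1) ((u \<otimes>\<^bsub>A\<^esub> v) # us)
       else u # merge_at A T (k + 1) (v # us))"

text \<open>The word \<open>\<sigma>(x \<otimes> y; T)\<close>; permutations are 1-based, list indices 0-based.\<close>

definition mixed_word ::
  "('a, 'm) ring_scheme \<Rightarrow> 'a list \<Rightarrow> 'a list \<Rightarrow> (nat \<Rightarrow> nat) \<Rightarrow> (nat \<times> nat) set \<Rightarrow> 'a list"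
  where "mixed_word A x y \<sigma> T =
    merge_at A T 1 (map (\<lambda>k. (x @ y) ! (\<sigma> k - 1)) [1..<length x + length y + 1])"

type_synonym ('a, 'c) shuffle_elem = "nat \<Rightarrow> ('a, 'c) tensor"

definition sh_module ::
  "('c, 'k) ring_scheme \<Rightarrow> ('c, 'a, 'm) module_scheme \<Rightarrow> ('c, ('a, 'c) shuffle_elem) module"
  where "sh_module C A = direct_sum (\<lambda>k. tensor_power C A (k + 1))"

definition sh_pure ::
  "('c, 'k) ring_scheme \<Rightarrow> ('c, 'a, 'm) module_scheme \<Rightarrow> 'a list \<Rightarrow> ('a, 'c) shuffle_elem"
  where "sh_pure C A us =
    (\<lambda>k. if length us = k + 1 then pure_tensor C A us else \<zero>\<^bsub>tensor_power C A (k + 1)\<^esub>)"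

text \<open>The linear map on the direct sum that sends every pure tensor \<open>us\<close> to \<open>h us\<close>.\<close>

definition sh_lift ::
  "('c, 'k) ring_scheme \<Rightarrow> ('c, 'a, 'm) module_scheme \<Rightarrow> ('c, 'r, 'n) module_scheme
    \<Rightarrow> ('a list \<Rightarrow> 'r) \<Rightarrow> ('a, 'c) shuffle_elem \<Rightarrow> 'r"
  where "sh_lift C A M h X =
    (\<Oplus>\<^bsub>M\<^esub>k\<in>{k. X k \<noteq> \<zero>\<^bsub>tensor_power C A (k + 1)\<^esub>}. tensor_lift C M h (X k))"

definition sh_mult_pure ::
  "('c, 'k) ring_scheme \<Rightarrow> 'c \<Rightarrow> ('c, 'a, 'm) module_scheme \<Rightarrow> 'a list \<Rightarrow> 'a list
    \<Rightarrow> ('a, 'c) shuffle_elem"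
  where "sh_mult_pure C lam A us vs =
    (let z = hd us \<otimes>\<^bsub>A\<^esub> hd vs; x = tl us; y = tl vs in
      if x = [] then sh_pure C A (z # y)
      else if y = [] then sh_pure C A (z # x)
      else (\<Oplus>\<^bsub>sh_module C A\<^esub>p\<in>mixable_shuffles (length x) (length y).
        (lam [^]\<^bsub>C\<^esub> card (snd p)) \<odot>\<^bsub>sh_module C A\<^esub>
          sh_pure C A (z # mixed_word A x y (fst p) (snd p))))"

definition Sh ::
  "('c, 'k) ring_scheme \<Rightarrow> 'c \<Rightarrow> ('c, 'a, 'm) module_scheme \<Rightarrow> ('c, ('a, 'c) shuffle_elem) module"
  where "Sh C lam A =
    (sh_module C A)
      \<lparr>mult := (\<lambda>X Y.
         sh_lift C A (sh_module C A) (\<lambda>us.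
           sh_lift C A (sh_module C A) (\<lambda>vs. sh_mult_pure C lam A us vs) Y) X),
       one := sh_pure C A [\<one>\<^bsub>A\<^esub>]\<rparr>"

definition sh_incl ::
  "('c, 'k) ring_scheme \<Rightarrow> ('c, 'a, 'm) module_scheme \<Rightarrow> 'a \<Rightarrow> ('a, 'c) shuffle_elem"
  where "sh_incl C A a = sh_pure C A [a]"

definition sh_P ::
  "('c, 'k) ring_scheme \<Rightarrow> ('c, 'a, 'm) module_scheme \<Rightarrow> ('a, 'c) shuffle_elem \<Rightarrow> ('a, 'c) shuffle_elem"
  where "sh_P C A = sh_lift C A (sh_module C A) (\<lambda>us. sh_pure C A (\<one>\<^bsub>A\<^esub> # us))"


section \<open>The standard Baxter algebra\<close>

text \<open>
  Direct limit of a sequence of algebras \<open>M 1 \<rightarrow> M 2 \<rightarrow> \<dots>\<close> with transition maps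
  \<open>h n : M n \<rightarrow> M (n + 1)\<close>; the index starts at 1.  An element is a class of pairs
  \<open>(n, x)\<close>, \<open>x \<in> M n\<close>, two pairs being identified when they become equal at a later stage.
\<close>

definition dl_trans :: "(nat \<Rightarrow> 'r \<Rightarrow> 'r) \<Rightarrow> nat \<Rightarrow> nat \<Rightarrow> 'r \<Rightarrow> 'r"
  where "dl_trans h m n = fold h [m..<n]"

definition dl_elems :: "(nat \<Rightarrow> ('c, 'r, 'm) module_scheme) \<Rightarrow> (nat \<times> 'r) set"
  where "dl_elems M = {(n, x). 1 \<le> n \<and> x \<in> carrier (M n)}"

definition dl_rel ::
  "(nat \<Rightarrow> ('c, 'r, 'm) module_scheme) \<Rightarrow> (nat \<Rightarrow> 'r \<Rightarrow> 'r) \<Rightarrow> ((nat \<times> 'r) \<times> (nat \<times> 'r)) set"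
  where "dl_rel M h =
    {((m, x), (n, y)). (m, x) \<in> dl_elems M \<and> (n, y) \<in> dl_elems M
       \<and> (\<exists>k \<ge> max m n. dl_trans h m k x = dl_trans h n k y)}"

definition dl_class ::
  "(nat \<Rightarrow> ('c, 'r, 'm) module_scheme) \<Rightarrow> (nat \<Rightarrow> 'r \<Rightarrow> 'r) \<Rightarrow> nat \<Rightarrow> 'r \<Rightarrow> (nat \<times> 'r) set"
  where "dl_class M h n x = dl_rel M h `` {(n, x)}"

definition direct_limit ::
  "(nat \<Rightarrow> ('c, 'r, 'm) module_scheme) \<Rightarrow> (nat \<Rightarrow> 'r \<Rightarrow> 'r) \<Rightarrow> ('c, (nat \<times> 'r) set) module"
  where "direct_limit M h =
    \<lparr>carrier = dl_elems M // dl_rel M h,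
     mult = (\<lambda>X Y. \<Union>(m, x)\<in>X. \<Union>(n, y)\<in>Y. dl_class M h (max m n)
       (dl_trans h m (max m n) x \<otimes>\<^bsub>M (max m n)\<^esub> dl_trans h n (max m n) y)),
     one = dl_class M h 1 \<one>\<^bsub>M 1\<^esub>,
     zero = dl_class M h 1 \<zero>\<^bsub>M 1\<^esub>,
     add = (\<lambda>X Y. \<Union>(m, x)\<in>X. \<Union>(n, y)\<in>Y. dl_class M h (max m n)
       (dl_trans h m (max m n) x \<oplus>\<^bsub>M (max m n)\<^esub> dl_trans h n (max m n) y)),
     smult = (\<lambda>c X. \<Union>(m, x)\<in>X. dl_class M h m (c \<odot>\<^bsub>M m\<^esub> x))\<rparr>"

text \<open>The map \<open>x \<mapsto> x \<otimes> 1\<close> from the \<open>n\<close>-th to the \<open>(n + 1)\<close>-st tensor power.\<close>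

definition tensor_one ::
  "('c, 'k) ring_scheme \<Rightarrow> ('c, 'a, 'm) module_scheme \<Rightarrow> nat \<Rightarrow> ('a, 'c) tensor \<Rightarrow> ('a, 'c) tensor"
  where "tensor_one C A n =
    tensor_lift C (tensor_power C A (n + 1)) (\<lambda>us. pure_tensor C A (us @ [\<one>\<^bsub>A\<^esub>]))"

type_synonym ('a, 'c) tensor_limit = "(nat \<times> ('a, 'c) tensor) set"

definition Abar ::
  "('c, 'k) ring_scheme \<Rightarrow> ('c, 'a, 'm) module_scheme \<Rightarrow> ('c, ('a, 'c) tensor_limit) module"
  where "Abar C A = direct_limit (tensor_power C A) (tensor_one C A)"

text \<open>Sequences are indexed by the positive integers and extensional outside them.\<close>

definition sequence_algebra :: "('c, 'r, 'm) module_scheme \<Rightarrow> ('c, nat \<Rightarrow> 'r) module"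
  where "sequence_algebra M =
    \<lparr>carrier = {1..} \<rightarrow>\<^sub>E carrier M,
     mult = (\<lambda>s t. \<lambda>k\<in>{1..}. s k \<otimes>\<^bsub>M\<^esub> t k), one = (\<lambda>k\<in>{1..}. \<one>\<^bsub>M\<^esub>),
     zero = (\<lambda>k\<in>{1..}. \<zero>\<^bsub>M\<^esub>), add = (\<lambda>s t. \<lambda>k\<in>{1..}. s k \<oplus>\<^bsub>M\<^esub> t k),
     smult = (\<lambda>c s. \<lambda>k\<in>{1..}. c \<odot>\<^bsub>M\<^esub> s k)\<rparr>"

definition partial_sum_operator ::
  "'c \<Rightarrow> ('c, 'r, 'm) module_scheme \<Rightarrow> (nat \<Rightarrow> 'r) \<Rightarrow> (nat \<Rightarrow> 'r)"
  where "partial_sum_operator lam M s =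
    (\<lambda>k\<in>{1..}. lam \<odot>\<^bsub>M\<^esub> (\<Oplus>\<^bsub>M\<^esub>i\<in>{1..<k}. s i))"

definition big_algebra ::
  "('c, 'k) ring_scheme \<Rightarrow> ('c, 'a, 'm) module_scheme \<Rightarrow> ('c, nat \<Rightarrow> ('a, 'c) tensor_limit) module"
  where "big_algebra C A = sequence_algebra (Abar C A)"

definition std_P ::
  "('c, 'k) ring_scheme \<Rightarrow> 'c \<Rightarrow> ('c, 'a, 'm) module_scheme
    \<Rightarrow> (nat \<Rightarrow> ('a, 'c) tensor_limit) \<Rightarrow> (nat \<Rightarrow> ('a, 'c) tensor_limit)"
  where "std_P C lam A = partial_sum_operator lam (Abar C A)"

definition t_seq ::
  "('c, 'k) ring_scheme \<Rightarrow> ('c, 'a, 'm) module_scheme \<Rightarrow> 'a \<Rightarrow> nat \<Rightarrow> ('a, 'c) tensor_limit"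
  where "t_seq C A a =
    (\<lambda>k\<in>{1..}. dl_class (tensor_power C A) (tensor_one C A) k
      (pure_tensor C A (replicate (k - 1) \<one>\<^bsub>A\<^esub> @ [a])))"

definition std_baxter ::
  "('c, 'k) ring_scheme \<Rightarrow> 'c \<Rightarrow> ('c, 'a, 'm) module_scheme
    \<Rightarrow> ('c, nat \<Rightarrow> ('a, 'c) tensor_limit) module"
  where "std_baxter C lam A =
    baxter_generated C (big_algebra C A) (std_P C lam A) (t_seq C A ` carrier A)"

end

theory Submission
  imports Defs
begin

text \<open>
  Write \<open>\<Phi>\<close> for the linear map that sends \<open>x\<^sub>0 \<otimes> \<dots> \<otimes> x\<^sub>n\<close> to
  \<open>t(x\<^sub>0) P'(t(x\<^sub>1) P'(\<dots> P'(t(x\<^sub>n))))\<close>.  The theorem rests on two properties of \<open>\<Phi>\<close>.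

  \<open>\<Phi>\<close> is injective.  Component \<open>k\<close> of the value above is \<open>\<lambda>\<^sup>n\<close> times the sum over all chains
  \<open>k > i\<^sub>1 > \<dots> > i\<^sub>n \<ge> 1\<close> of the tensor with \<open>x\<^sub>0\<close> in place \<open>k\<close> and \<open>x\<^sub>j\<close> in place \<open>i\<^sub>j\<close>.  There is
  no chain for \<open>k \<le> n\<close>, and only one for \<open>k = n + 1\<close>, which contributes
  \<open>\<lambda>\<^sup>n x\<^sub>n \<otimes> \<dots> \<otimes> x\<^sub>0\<close> (\<open>val_lowest\<close>).  So if \<open>n\<close> is the least degree in which \<open>X\<close> is nonzero,
  component \<open>n + 1\<close> of \<open>\<Phi> X\<close> is \<open>\<lambda>\<^sup>n\<close> times the reversal of \<open>X\<^sub>n\<close> (\<open>Phi_lowest\<close>).  As \<open>\<lambda>\<close> is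
  regular on the direct limit, and as \<open>A\<^sup>\<otimes>\<^sup>n\<close> embeds into the limit (multiplying the last two
  factors is a left inverse of \<open>x \<mapsto> x \<otimes> 1\<close>), \<open>\<Phi> X = 0\<close> is impossible (\<open>Phi_inj\<close>).

  \<open>\<Phi>\<close> is multiplicative.  A mixable shuffle of two nonempty words starts with the first letter of
  the one word, with that of the other, or with their product; this gives a recursion for the
  shuffle product (\<open>quasi_shuffles\<close>, \<open>mixable_shuffles_quasi\<close>).  The Baxter identity for
  \<open>P(u) P(v)\<close> has the same three terms, so the recursion computes products in every Baxter algebra
  (\<open>tval_mult\<close>, \<open>Phi_sh_mult_pure\<close>).

  An injective multiplicative map carries laws back to its source.  The multilinearity of the
  shuffle formula, without which the product of tensors would not be determined by it, the
  associativity and commutativity of that product, and the Baxter identity in the shuffle algebra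
  are all obtained in this way from the algebra of sequences (\<open>multilinear_reflect\<close>,
  \<open>algebra_by_injection\<close>, \<open>baxter_algebra_by_injection\<close>, \<open>Sh_baxter\<close>), with no further shuffle
  combinatorics.  The image of \<open>\<Phi>\<close> is a Baxter subalgebra, and every Baxter subalgebra that
  contains all \<open>t(a)\<close> contains it, so it is the standard Baxter algebra (\<open>std_baxter_eq\<close>).
  Uniqueness follows from \<open>x\<^sub>0 \<otimes> x = x\<^sub>0 \<diamond> P(x)\<close> (\<open>sh_pure_Cons\<close>, \<open>Phi_unique\<close>).
\<close>

section \<open>Linear maps and finitely supported sums\<close>

definition linear_maps ::
  "('c, 'k) ring_scheme \<Rightarrow> ('c, 'r, 'm) module_scheme \<Rightarrow> ('c, 's, 'n) module_scheme \<Rightarrow> ('r \<Rightarrow> 's) set"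
  where "linear_maps C M N =
    {f \<in> carrier M \<rightarrow> carrier N.
       (\<forall>x\<in>carrier M. \<forall>y\<in>carrier M. f (x \<oplus>\<^bsub>M\<^esub> y) = f x \<oplus>\<^bsub>N\<^esub> f y)
     \<and> (\<forall>c\<in>carrier C. \<forall>x\<in>carrier M. f (c \<odot>\<^bsub>M\<^esub> x) = c \<odot>\<^bsub>N\<^esub> f x)}"

lemma linear_mapsI:
  assumes "\<And>x. x \<in> carrier M \<Longrightarrow> f x \<in> carrier N"
    and "\<And>x y. x \<in> carrier M \<Longrightarrow> y \<in> carrier M \<Longrightarrow> f (x \<oplus>\<^bsub>M\<^esub> y) = f x \<oplus>\<^bsub>N\<^esub> f y"
    and "\<And>c x. c \<in> carrier C \<Longrightarrow> x \<in> carrier M \<Longrightarrow> f (c \<odot>\<^bsub>M\<^esub> x) = c \<odot>\<^bsub>N\<^esub> f x"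
  shows "f \<in> linear_maps C M N"
  using assms by (auto simp: linear_maps_def)

lemma linear_closed: "f \<in> linear_maps C M N \<Longrightarrow> x \<in> carrier M \<Longrightarrow> f x \<in> carrier N"
  and linear_add: "f \<in> linear_maps C M N \<Longrightarrow> x \<in> carrier M \<Longrightarrow> y \<in> carrier M \<Longrightarrow>
    f (x \<oplus>\<^bsub>M\<^esub> y) = f x \<oplus>\<^bsub>N\<^esub> f y"
  and linear_smult: "f \<in> linear_maps C M N \<Longrightarrow> c \<in> carrier C \<Longrightarrow> x \<in> carrier M \<Longrightarrow>
    f (c \<odot>\<^bsub>M\<^esub> x) = c \<odot>\<^bsub>N\<^esub> f x"
  by (auto simp: linear_maps_def)

lemma linear_comp:
  "f \<in> linear_maps C M N \<Longrightarrow> g \<in> linear_maps C N L \<Longrightarrow> (\<lambda>x. g (f x)) \<in> linear_maps C M L"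
  by (rule linear_mapsI) (simp_all add: linear_closed linear_add linear_smult)

lemma linear_cong:
  assumes "f \<in> linear_maps C M N" "module C M" "\<And>x. x \<in> carrier M \<Longrightarrow> f x = g x"
  shows "g \<in> linear_maps C M N"
proof -
  interpret M: module C M by fact
  show ?thesis
    by (rule linear_mapsI)
      (use assms(3)[symmetric] in \<open>simp_all add: linear_closed[OF assms(1)] linear_add[OF assms(1)] linear_smult[OF assms(1)]\<close>)
qed

lemma linear_zero:
  assumes "f \<in> linear_maps C M N" "module C M" "module C N"
  shows "f \<zero>\<^bsub>M\<^esub> = \<zero>\<^bsub>N\<^esub>"
proof -
  interpret M: module C M by fact
  interpret N: module C N by fact
  have "f (\<zero>\<^bsub>C\<^esub> \<odot>\<^bsub>M\<^esub> \<zero>\<^bsub>M\<^esub>) = \<zero>\<^bsub>C\<^esub> \<odot>\<^bsub>N\<^esub> f \<zero>\<^bsub>M\<^esub>"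
    by (rule linear_smult[OF assms(1)]) simp_all
  thus ?thesis by (simp add: linear_closed[OF assms(1)])
qed

lemma linear_minus:
  assumes "f \<in> linear_maps C M N" "module C M" "module C N" "x \<in> carrier M"
  shows "f (\<ominus>\<^bsub>M\<^esub> x) = \<ominus>\<^bsub>N\<^esub> f x"
proof -
  interpret M: module C M by fact
  interpret N: module C N by fact
  have "f (\<ominus>\<^bsub>M\<^esub> x \<oplus>\<^bsub>M\<^esub> x) = f (\<ominus>\<^bsub>M\<^esub> x) \<oplus>\<^bsub>N\<^esub> f x"
    using assms(4) by (intro linear_add[OF assms(1)]) simp_all
  hence "f (\<ominus>\<^bsub>M\<^esub> x) \<oplus>\<^bsub>N\<^esub> f x = \<zero>\<^bsub>N\<^esub>"
    using assms(4) linear_zero[OF assms(1-3)] by (simp add: M.l_neg)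
  thus ?thesis
    using assms(4) by (intro N.minus_equality[symmetric]) (simp_all add: linear_closed[OF assms(1)])
qed

lemma (in abelian_group) eq_of_minus_eq_zero:
  assumes "x \<in> carrier G" "y \<in> carrier G" "x \<oplus> \<ominus> y = \<zero>" shows "x = y"
proof -
  have "(x \<oplus> \<ominus> y) \<oplus> y = y" using assms by simp
  thus ?thesis using assms(1,2) by (simp only: a_assoc a_inv_closed l_neg r_zero)
qed

lemma linear_inj_onI:
  assumes "f \<in> linear_maps C M N" "module C M" "module C N"
    and "\<And>x. x \<in> carrier M \<Longrightarrow> f x = \<zero>\<^bsub>N\<^esub> \<Longrightarrow> x = \<zero>\<^bsub>M\<^esub>"
  shows "inj_on f (carrier M)"
proof (rule inj_onI)
  interpret M: module C M by fact
  interpret N: module C N by fact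
  fix x y assume xy: "x \<in> carrier M" "y \<in> carrier M" "f x = f y"
  have "f (x \<oplus>\<^bsub>M\<^esub> \<ominus>\<^bsub>M\<^esub> y) = f x \<oplus>\<^bsub>N\<^esub> \<ominus>\<^bsub>N\<^esub> f y"
    using xy assms(1-3) by (simp add: linear_add[OF assms(1)] linear_minus)
  also have "\<dots> = \<zero>\<^bsub>N\<^esub>" using xy by (simp add: N.r_neg linear_closed[OF assms(1)])
  finally have "x \<oplus>\<^bsub>M\<^esub> \<ominus>\<^bsub>M\<^esub> y = \<zero>\<^bsub>M\<^esub>" using xy assms(4) by simp
  thus "x = y" using xy(1,2) by (rule M.M.eq_of_minus_eq_zero[rotated 2])
qed

lemma linear_finsum:
  assumes "f \<in> linear_maps C M N" "module C M" "module C N"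
    and "finite K" "g \<in> K \<rightarrow> carrier M"
  shows "f (\<Oplus>\<^bsub>M\<^esub>k\<in>K. g k) = (\<Oplus>\<^bsub>N\<^esub>k\<in>K. f (g k))"
proof -
  interpret M: module C M by fact
  interpret N: module C N by fact
  show ?thesis using assms(4,5)
  proof (induction K rule: finite_induct)
    case empty thus ?case by (simp add: linear_zero[OF assms(1-3)])
  next
    case (insert k K)
    hence "f (\<Oplus>\<^bsub>M\<^esub>k\<in>insert k K. g k) = f (g k \<oplus>\<^bsub>M\<^esub> (\<Oplus>\<^bsub>M\<^esub>k\<in>K. g k))"
      by (subst M.finsum_insert) auto
    also have "\<dots> = f (g k) \<oplus>\<^bsub>N\<^esub> f (\<Oplus>\<^bsub>M\<^esub>k\<in>K. g k)"
      using insert.prems by (intro linear_add[OF assms(1)]) auto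
    also have "f (\<Oplus>\<^bsub>M\<^esub>k\<in>K. g k) = (\<Oplus>\<^bsub>N\<^esub>k\<in>K. f (g k))"
      using insert by auto
    also have "f (g k) \<oplus>\<^bsub>N\<^esub> (\<Oplus>\<^bsub>N\<^esub>k\<in>K. f (g k)) = (\<Oplus>\<^bsub>N\<^esub>k\<in>insert k K. f (g k))"
      using insert by (subst N.finsum_insert) (auto intro: linear_closed[OF assms(1)])
    finally show ?case .
  qed
qed

lemma (in module) smult_linear:
  assumes "c \<in> carrier R" shows "(\<lambda>x. c \<odot>\<^bsub>M\<^esub> x) \<in> linear_maps R M M"
proof (rule linear_mapsI)
  fix d x assume "d \<in> carrier R" "x \<in> carrier M"
  thus "c \<odot>\<^bsub>M\<^esub> (d \<odot>\<^bsub>M\<^esub> x) = d \<odot>\<^bsub>M\<^esub> (c \<odot>\<^bsub>M\<^esub> x)"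
    using assms by (metis smult_assoc1 R.m_comm)
qed (use assms in \<open>simp_all add: smult_r_distr\<close>)

lemma linear_id: "(\<lambda>x. x) \<in> linear_maps C M M"
  by (simp add: linear_maps_def)

lemma linear_sum:
  assumes "f \<in> linear_maps C M N" "g \<in> linear_maps C M N" "module C N"
  shows "(\<lambda>x. f x \<oplus>\<^bsub>N\<^esub> g x) \<in> linear_maps C M N"
proof -
  interpret N: module C N by fact
  note f = linear_closed[OF assms(1)] linear_add[OF assms(1)] linear_smult[OF assms(1)]
  note g = linear_closed[OF assms(2)] linear_add[OF assms(2)] linear_smult[OF assms(2)]
  show ?thesis
    by (rule linear_mapsI) (simp_all add: f g N.M.a_ac N.smult_r_distr)
qed

lemma linear_scale:
  assumes "f \<in> linear_maps C M N" "module C N" "c \<in> carrier C"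
  shows "(\<lambda>x. c \<odot>\<^bsub>N\<^esub> f x) \<in> linear_maps C M N"
  using linear_comp[OF assms(1) module.smult_linear[OF assms(2,3)]] .

lemma (in algebra) smult_assoc2_right:
  "a \<in> carrier R \<Longrightarrow> x \<in> carrier M \<Longrightarrow> y \<in> carrier M \<Longrightarrow>
    x \<otimes>\<^bsub>M\<^esub> (a \<odot>\<^bsub>M\<^esub> y) = a \<odot>\<^bsub>M\<^esub> (x \<otimes>\<^bsub>M\<^esub> y)"
  using smult_assoc2[of a y x] m_comm[of x y] m_comm[of x "a \<odot>\<^bsub>M\<^esub> y"] by simp

lemma (in algebra) mult_left_linear:
  assumes "x \<in> carrier M" shows "(\<lambda>y. x \<otimes>\<^bsub>M\<^esub> y) \<in> linear_maps R M M"
  using assms by (intro linear_mapsI) (simp_all add: r_distr smult_assoc2_right)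

lemma (in algebra) mult_right_linear:
  assumes "x \<in> carrier M" shows "(\<lambda>y. y \<otimes>\<^bsub>M\<^esub> x) \<in> linear_maps R M M"
  using assms by (intro linear_mapsI) (simp_all add: l_distr smult_assoc2)

text \<open>
  The module laws are equations, so they pass to the image of any map that respects the operations.
  This serves quotients, and also records that differ from a given module only in their
  multiplication.
\<close>

lemma module_by_surjection:
  assumes "module C M"
    and "p ` carrier M = carrier Q" and "\<zero>\<^bsub>Q\<^esub> = p \<zero>\<^bsub>M\<^esub>"
    and "\<And>x y. x \<in> carrier M \<Longrightarrow> y \<in> carrier M \<Longrightarrow> p (x \<oplus>\<^bsub>M\<^esub> y) = p x \<oplus>\<^bsub>Q\<^esub> p y"
    and "\<And>c x. c \<in> carrier C \<Longrightarrow> x \<in> carrier M \<Longrightarrow> p (c \<odot>\<^bsub>M\<^esub> x) = c \<odot>\<^bsub>Q\<^esub> p x"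
  shows "module C Q"
proof -
  interpret M: module C M by fact
  have car: "p x \<in> carrier Q" if "x \<in> carrier M" for x using that assms(2) by blast
  have ex: "\<exists>x\<in>carrier M. X = p x" if "X \<in> carrier Q" for X using that assms(2) by auto
  note hom = assms(4,5)[symmetric]
  show ?thesis
  proof (rule moduleI)
    show "abelian_group Q"
    proof (rule abelian_groupI)
      fix X Y assume "X \<in> carrier Q" "Y \<in> carrier Q"
      then obtain x y where xy: "x \<in> carrier M" "y \<in> carrier M" and e: "X = p x" "Y = p y" using ex by metis
      show "X \<oplus>\<^bsub>Q\<^esub> Y \<in> carrier Q" using xy by (simp add: e hom car)
      show "X \<oplus>\<^bsub>Q\<^esub> Y = Y \<oplus>\<^bsub>Q\<^esub> X" using xy by (simp add: e hom M.M.a_comm)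
      show "\<zero>\<^bsub>Q\<^esub> \<oplus>\<^bsub>Q\<^esub> X = X" using xy by (simp add: e hom assms(3))
      have "p (\<ominus>\<^bsub>M\<^esub> x) \<oplus>\<^bsub>Q\<^esub> X = \<zero>\<^bsub>Q\<^esub>" using xy by (simp add: e hom assms(3) M.l_neg)
      thus "\<exists>Y\<in>carrier Q. Y \<oplus>\<^bsub>Q\<^esub> X = \<zero>\<^bsub>Q\<^esub>" using xy car by (meson M.a_inv_closed)
      fix Z assume "Z \<in> carrier Q"
      then obtain z where z: "z \<in> carrier M" "Z = p z" using ex by metis
      show "X \<oplus>\<^bsub>Q\<^esub> Y \<oplus>\<^bsub>Q\<^esub> Z = X \<oplus>\<^bsub>Q\<^esub> (Y \<oplus>\<^bsub>Q\<^esub> Z)" using xy z by (simp add: e hom M.M.a_assoc)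
    qed (simp add: assms(3) car)
    fix a b X Y assume ab: "a \<in> carrier C" "b \<in> carrier C" and "X \<in> carrier Q" "Y \<in> carrier Q"
    then obtain x y where xy: "x \<in> carrier M" "y \<in> carrier M" and e: "X = p x" "Y = p y" using ex by metis
    show "a \<odot>\<^bsub>Q\<^esub> X \<in> carrier Q" using ab xy by (simp add: e hom car)
    show "(a \<oplus>\<^bsub>C\<^esub> b) \<odot>\<^bsub>Q\<^esub> X = a \<odot>\<^bsub>Q\<^esub> X \<oplus>\<^bsub>Q\<^esub> b \<odot>\<^bsub>Q\<^esub> X" using ab xy by (simp add: e hom M.smult_l_distr)
    show "a \<odot>\<^bsub>Q\<^esub> (X \<oplus>\<^bsub>Q\<^esub> Y) = a \<odot>\<^bsub>Q\<^esub> X \<oplus>\<^bsub>Q\<^esub> a \<odot>\<^bsub>Q\<^esub> Y" using ab xy by (simp add: e hom M.smult_r_distr)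
    show "a \<otimes>\<^bsub>C\<^esub> b \<odot>\<^bsub>Q\<^esub> X = a \<odot>\<^bsub>Q\<^esub> (b \<odot>\<^bsub>Q\<^esub> X)" using ab xy by (simp add: e hom M.smult_assoc1)
  next
    fix X assume "X \<in> carrier Q"
    then obtain x where x: "x \<in> carrier M" "X = p x" using ex by metis
    thus "\<one>\<^bsub>C\<^esub> \<odot>\<^bsub>Q\<^esub> X = X" by (simp add: hom)
  qed (rule M.R.is_cring)
qed

text \<open>
  Maps out of free modules and direct sums are sums over the support of their argument.  Supports of
  different arguments differ; the next three lemmas pass to a common finite index set.
\<close>

lemma (in abelian_monoid) support_sum_superset:
  assumes "finite K" "{k. X k \<noteq> z k} \<subseteq> K"
    and "\<And>k. k \<in> K \<Longrightarrow> g k (X k) \<in> carrier G" "\<And>k. k \<in> K \<Longrightarrow> g k (z k) = \<zero>"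
  shows "(\<Oplus>k\<in>{k. X k \<noteq> z k}. g k (X k)) = (\<Oplus>k\<in>K. g k (X k))"
proof (rule add.finprod_mono_neutral_cong_left)
  fix k assume "k \<in> K - {k. X k \<noteq> z k}"
  hence "k \<in> K" "X k = z k" by auto
  thus "g k (X k) = \<zero>" using assms(4) by metis
qed (use assms in auto)

lemma (in abelian_monoid) support_sum_add:
  assumes "finite {k. X k \<noteq> z k}" "finite {k. Y k \<noteq> z k}"
    and "\<And>k. X k = z k \<Longrightarrow> Y k = z k \<Longrightarrow> Z k = z k"
    and "\<And>k. X k \<noteq> z k \<or> Y k \<noteq> z k \<Longrightarrow> g k (z k) = \<zero> \<and> g k (X k) \<in> carrier G
       \<and> g k (Y k) \<in> carrier G \<and> g k (Z k) = g k (X k) \<oplus> g k (Y k)"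
  shows "(\<Oplus>k\<in>{k. Z k \<noteq> z k}. g k (Z k))
    = (\<Oplus>k\<in>{k. X k \<noteq> z k}. g k (X k)) \<oplus> (\<Oplus>k\<in>{k. Y k \<noteq> z k}. g k (Y k))"
proof -
  let ?K = "{k. X k \<noteq> z k} \<union> {k. Y k \<noteq> z k}"
  have fin: "finite ?K" using assms(1,2) by simp
  have "(\<Oplus>k\<in>{k. Z k \<noteq> z k}. g k (Z k)) = (\<Oplus>k\<in>?K. g k (Z k))"
    using assms(3,4) by (intro support_sum_superset fin) auto
  also have "\<dots> = (\<Oplus>k\<in>?K. g k (X k) \<oplus> g k (Y k))"
    using assms(4) by (intro finsum_cong') auto
  also have "\<dots> = (\<Oplus>k\<in>?K. g k (X k)) \<oplus> (\<Oplus>k\<in>?K. g k (Y k))"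
    using assms(4) by (intro finsum_addf) auto
  also have "(\<Oplus>k\<in>?K. g k (X k)) = (\<Oplus>k\<in>{k. X k \<noteq> z k}. g k (X k))"
    using assms(4) by (intro support_sum_superset[symmetric] fin) auto
  also have "(\<Oplus>k\<in>?K. g k (Y k)) = (\<Oplus>k\<in>{k. Y k \<noteq> z k}. g k (Y k))"
    using assms(4) by (intro support_sum_superset[symmetric] fin) auto
  finally show ?thesis .
qed

lemma (in module) support_sum_smult:
  assumes "finite {k. X k \<noteq> z k}" "c \<in> carrier R"
    and "\<And>k. X k = z k \<Longrightarrow> Z k = z k"
    and "\<And>k. X k \<noteq> z k \<Longrightarrow> g k (z k) = \<zero>\<^bsub>M\<^esub> \<and> g k (X k) \<in> carrier M
       \<and> g k (Z k) = c \<odot>\<^bsub>M\<^esub> g k (X k)"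
  shows "(\<Oplus>\<^bsub>M\<^esub>k\<in>{k. Z k \<noteq> z k}. g k (Z k)) = c \<odot>\<^bsub>M\<^esub> (\<Oplus>\<^bsub>M\<^esub>k\<in>{k. X k \<noteq> z k}. g k (X k))"
proof -
  let ?K = "{k. X k \<noteq> z k}"
  have "(\<Oplus>\<^bsub>M\<^esub>k\<in>{k. Z k \<noteq> z k}. g k (Z k)) = (\<Oplus>\<^bsub>M\<^esub>k\<in>?K. g k (Z k))"
    using assms by (intro M.support_sum_superset assms(1)) auto
  also have "\<dots> = (\<Oplus>\<^bsub>M\<^esub>k\<in>?K. c \<odot>\<^bsub>M\<^esub> g k (X k))"
    using assms by (intro M.finsum_cong') auto
  also have "\<dots> = c \<odot>\<^bsub>M\<^esub> (\<Oplus>\<^bsub>M\<^esub>k\<in>?K. g k (X k))"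
    using assms by (intro finsum_smult_ldistr[symmetric]) auto
  finally show ?thesis .
qed


section \<open>Free modules and quotient modules\<close>

lemma free_module_simps [simp]:
  "zero (free_module C S) = (\<lambda>x. \<zero>\<^bsub>C\<^esub>)"
  "add (free_module C S) = (\<lambda>f g x. f x \<oplus>\<^bsub>C\<^esub> g x)"
  "smult (free_module C S) = (\<lambda>c f x. c \<otimes>\<^bsub>C\<^esub> f x)"
  by (simp_all add: free_module_def)

lemma free_module_carrier:
  "f \<in> carrier (free_module C S) \<longleftrightarrow>
    (\<forall>x. f x \<in> carrier C) \<and> finite {x. f x \<noteq> \<zero>\<^bsub>C\<^esub>} \<and> (\<forall>x. x \<notin> S \<longrightarrow> f x = \<zero>\<^bsub>C\<^esub>)"
  by (simp add: free_module_def)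

lemma (in cring) free_module_module: "module R (free_module R S)"
proof -
  have fin_add: "finite {x. f x \<oplus> g x \<noteq> \<zero>}"
    if "finite {x. f x \<noteq> \<zero>}" "finite {x. g x \<noteq> \<zero>}" for f g :: "_ \<Rightarrow> 'a"
    by (rule finite_subset[of _ "{x. f x \<noteq> \<zero>} \<union> {x. g x \<noteq> \<zero>}"]) (use that in auto)
  have fin_mult: "finite {x. c \<otimes> f x \<noteq> \<zero>}" if "finite {x. f x \<noteq> \<zero>}" "c \<in> carrier R" for f :: "_ \<Rightarrow> 'a" and c
    by (rule finite_subset[of _ "{x. f x \<noteq> \<zero>}"]) (use that in auto)
  have fin_minus: "finite {x. \<ominus> f x \<noteq> \<zero>}" if "finite {x. f x \<noteq> \<zero>}" for f :: "_ \<Rightarrow> 'a"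
    by (rule finite_subset[of _ "{x. f x \<noteq> \<zero>}"]) (use that in auto)
  show ?thesis
  proof (rule moduleI)
    show "abelian_group (free_module R S)"
    proof (rule abelian_groupI)
      fix f assume "f \<in> carrier (free_module R S)"
      hence "(\<lambda>x. \<ominus> f x) \<in> carrier (free_module R S)"
        and "(\<lambda>x. \<ominus> f x) \<oplus>\<^bsub>free_module R S\<^esub> f = \<zero>\<^bsub>free_module R S\<^esub>"
        by (auto simp: free_module_carrier fin_minus l_neg)
      thus "\<exists>y\<in>carrier (free_module R S). y \<oplus>\<^bsub>free_module R S\<^esub> f = \<zero>\<^bsub>free_module R S\<^esub>" by blast
    qed (auto simp: free_module_carrier fin_add a_ac)
  qed (auto simp: free_module_carrier fin_mult l_distr r_distr m_assoc intro: is_cring)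
qed

lemma (in cring) free_gen_closed: "b \<in> S \<Longrightarrow> free_gen R b \<in> carrier (free_module R S)"
proof -
  assume "b \<in> S"
  moreover have "finite {x. free_gen R b x \<noteq> \<zero>}"
    by (rule finite_subset[of _ "{b}"]) (auto simp: free_gen_def)
  ultimately show ?thesis by (auto simp: free_module_carrier free_gen_def)
qed

definition free_lift ::
  "('c, 'k) ring_scheme \<Rightarrow> ('c, 'r, 'n) module_scheme \<Rightarrow> ('b \<Rightarrow> 'r) \<Rightarrow> ('b \<Rightarrow> 'c) \<Rightarrow> 'r"
  where "free_lift C M h f = (\<Oplus>\<^bsub>M\<^esub>b\<in>{b. f b \<noteq> \<zero>\<^bsub>C\<^esub>}. f b \<odot>\<^bsub>M\<^esub> h b)"

lemma (in module) free_lift_linear: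
  assumes "h \<in> S \<rightarrow> carrier M"
  shows "free_lift R M h \<in> linear_maps R (free_module R S) M"
proof (rule linear_mapsI)
  have inS: "b \<in> S" if "f \<in> carrier (free_module R S)" "f b \<noteq> \<zero>\<^bsub>R\<^esub>" for f b
    using that by (auto simp: free_module_carrier)
  have hS: "h b \<in> carrier M" if "f \<in> carrier (free_module R S)" "f b \<noteq> \<zero>\<^bsub>R\<^esub>" for f b
    using inS[OF that] assms by auto
  fix f assume f: "f \<in> carrier (free_module R S)"
  note f' = f[unfolded free_module_carrier]
  show "free_lift R M h f \<in> carrier M" unfolding free_lift_def
    by (rule finsum_closed) (use f' hS[OF f] in auto)
  show "free_lift R M h (c \<odot>\<^bsub>free_module R S\<^esub> f) = c \<odot>\<^bsub>M\<^esub> free_lift R M h f" if "c \<in> carrier R" for c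
    unfolding free_lift_def free_module_simps
    by (rule support_sum_smult[where g = "\<lambda>b r. r \<odot>\<^bsub>M\<^esub> h b" and X = f and z = "\<lambda>x. \<zero>\<^bsub>R\<^esub>"])
      (use f' that in \<open>simp_all add: hS[OF f] smult_assoc1\<close>)
  fix g assume g: "g \<in> carrier (free_module R S)"
  note g' = g[unfolded free_module_carrier]
  show "free_lift R M h (f \<oplus>\<^bsub>free_module R S\<^esub> g) = free_lift R M h f \<oplus>\<^bsub>M\<^esub> free_lift R M h g"
    unfolding free_lift_def free_module_simps
  proof (rule M.support_sum_add[where g = "\<lambda>b r. r \<odot>\<^bsub>M\<^esub> h b" and X = f and Y = g and z = "\<lambda>x. \<zero>\<^bsub>R\<^esub>"])
    fix b assume "f b \<noteq> \<zero>\<^bsub>R\<^esub> \<or> g b \<noteq> \<zero>\<^bsub>R\<^esub>"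
    hence "h b \<in> carrier M" using hS f g by blast
    moreover have "f b \<in> carrier R" "g b \<in> carrier R" using f' g' by simp_all
    ultimately show "\<zero>\<^bsub>R\<^esub> \<odot>\<^bsub>M\<^esub> h b = \<zero>\<^bsub>M\<^esub> \<and> f b \<odot>\<^bsub>M\<^esub> h b \<in> carrier M \<and> g b \<odot>\<^bsub>M\<^esub> h b \<in> carrier M \<and>
        (f b \<oplus>\<^bsub>R\<^esub> g b) \<odot>\<^bsub>M\<^esub> h b = f b \<odot>\<^bsub>M\<^esub> h b \<oplus>\<^bsub>M\<^esub> g b \<odot>\<^bsub>M\<^esub> h b"
      by (simp add: smult_l_distr)
  qed (use f' g' in simp_all)
qed

lemma (in module) free_lift_gen:
  assumes "h b \<in> carrier M" shows "free_lift R M h (free_gen R b) = h b"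
proof -
  have "free_lift R M h (free_gen R b) = (\<Oplus>\<^bsub>M\<^esub>x\<in>{b}. free_gen R b x \<odot>\<^bsub>M\<^esub> h x)"
    unfolding free_lift_def
    by (rule M.support_sum_superset[where g = "\<lambda>b r. r \<odot>\<^bsub>M\<^esub> h b" and X = "free_gen R b" and z = "\<lambda>x. \<zero>\<^bsub>R\<^esub>"])
       (use assms in \<open>auto simp: free_gen_def\<close>)
  also have "\<dots> = h b" using assms by (subst M.finsum_insert) (auto simp: free_gen_def)
  finally show ?thesis .
qed

lemma (in cring) free_module_induct [consumes 1, case_names zero gen add smult]:
  assumes "f \<in> carrier (free_module R S)"
    and zero: "P (\<lambda>x. \<zero>)"
    and gen: "\<And>b. b \<in> S \<Longrightarrow> P (free_gen R b)"
    and add: "\<And>f g. f \<in> carrier (free_module R S) \<Longrightarrow> g \<in> carrier (free_module R S) \<Longrightarrow>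
      P f \<Longrightarrow> P g \<Longrightarrow> P (f \<oplus>\<^bsub>free_module R S\<^esub> g)"
    and smult: "\<And>c f. c \<in> carrier R \<Longrightarrow> f \<in> carrier (free_module R S) \<Longrightarrow> P f \<Longrightarrow>
      P (c \<odot>\<^bsub>free_module R S\<^esub> f)"
  shows "P f"
proof -
  interpret F: module R "free_module R S" by (rule free_module_module)
  have "P f" if "finite K" "f \<in> carrier (free_module R S)" "{x. f x \<noteq> \<zero>} \<subseteq> K" for K f
    using that
  proof (induction K arbitrary: f rule: finite_induct)
    case empty
    hence "f = (\<lambda>x. \<zero>)" by auto
    thus ?case using zero by simp
  next
    case (insert b K f)
    note f = insert.prems(1)[unfolded free_module_carrier]
    have f': "f(b := \<zero>) \<in> carrier (free_module R S)"
      using f by (auto simp: free_module_carrier intro: finite_subset[of _ "{x. f x \<noteq> \<zero>}"])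
    moreover have "{x. (f(b := \<zero>)) x \<noteq> \<zero>} \<subseteq> K" using insert.prems(2) by auto
    ultimately have P1: "P (f(b := \<zero>))" by (rule insert.IH)
    show ?case
    proof (cases "b \<in> S")
      case True
      have e: "f = f(b := \<zero>) \<oplus>\<^bsub>free_module R S\<^esub> f b \<odot>\<^bsub>free_module R S\<^esub> free_gen R b"
        using f by (auto simp: free_gen_def fun_eq_iff)
      show ?thesis
        by (subst e, intro add smult gen P1 f' True free_gen_closed F.smult_closed) (use f in auto)
    next
      case False
      hence "f(b := \<zero>) = f" using f by (auto simp: fun_eq_iff)
      thus ?thesis using P1 by simp
    qed
  qed
  from this[of "{x. f x \<noteq> \<zero>}" f] show ?thesis using assms(1) by (auto simp: free_module_carrier)
qed

lemma (in module) module_span_submodule: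
  assumes "X \<subseteq> carrier M" shows "submodule (module_span R M X) R M"
proof (rule submoduleI)
  let ?HH = "{H. submodule H R M \<and> X \<subseteq> H}"
  have car: "carrier M \<in> ?HH" using assms carrier_is_submodule by auto
  show "module_span R M X \<subseteq> carrier M" using car by (auto simp: module_span_def)
  have "\<zero>\<^bsub>M\<^esub> \<in> H" if "submodule H R M" for H
    using subgroup.one_closed[OF submodule.axioms(1)[OF that]] by simp
  thus "\<zero>\<^bsub>M\<^esub> \<in> module_span R M X"
    by (auto simp: module_span_def)
qed (auto simp: module_span_def dest: submoduleE)

lemma module_span_superset: "X \<subseteq> module_span R M X"
  and module_span_least: "submodule H R M \<Longrightarrow> X \<subseteq> H \<Longrightarrow> module_span R M X \<subseteq> H"
  by (auto simp: module_span_def)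

lemma linear_kernel_submodule:
  assumes "f \<in> linear_maps C M N" "module C M" "module C N"
  shows "submodule {x \<in> carrier M. f x = \<zero>\<^bsub>N\<^esub>} C M"
proof -
  interpret M: module C M by fact
  interpret N: module C N by fact
  show ?thesis
    by (rule M.submoduleI)
      (auto simp: linear_zero[OF assms] linear_minus[OF assms] linear_add[OF assms(1)] linear_smult[OF assms(1)])
qed

lemma (in module) submodule_abelian_subgroup:
  assumes "submodule N R M" shows "abelian_subgroup N M"
  using assms submodule.axioms(1)
  by (intro abelian_subgroupI3 additive_subgroupI is_abelian_group M.abelian_group_axioms) auto

context module
begin

context
  fixes N assumes N: "submodule N R M"
begin

interpretation N: abelian_subgroup N M by (rule submodule_abelian_subgroup[OF N])

lemma coset_eq_iff:
  assumes "x \<in> carrier M" "y \<in> carrier M"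
  shows "N +>\<^bsub>M\<^esub> x = N +>\<^bsub>M\<^esub> y \<longleftrightarrow> x \<ominus>\<^bsub>M\<^esub> y \<in> N"
proof -
  have "N +>\<^bsub>M\<^esub> x = N +>\<^bsub>M\<^esub> y \<longleftrightarrow> x \<in> N +>\<^bsub>M\<^esub> y"
    using assms N.a_rcos_self N.a_repr_independence' by blast
  also have "\<dots> \<longleftrightarrow> x \<ominus>\<^bsub>M\<^esub> y \<in> N"
    using N.a_rcos_module[OF assms(2,1)] by (simp add: M.minus_eq)
  finally show ?thesis .
qed

lemma coset_eq_of_mem: "x \<in> carrier M \<Longrightarrow> y \<in> N +>\<^bsub>M\<^esub> x \<Longrightarrow> N +>\<^bsub>M\<^esub> y = N +>\<^bsub>M\<^esub> x"
  using N.a_repr_independence' by blast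

lemma coset_mem_carrier: "x \<in> carrier M \<Longrightarrow> y \<in> N +>\<^bsub>M\<^esub> x \<Longrightarrow> y \<in> carrier M"
  using N.a_elemrcos_carrier by blast

lemma coset_self: "x \<in> carrier M \<Longrightarrow> x \<in> N +>\<^bsub>M\<^esub> x"
  by (rule N.a_rcos_self)

lemma quot_module_simps [simp]:
  "zero (quot_module M N) = N"
  "add (quot_module M N) = set_add M"
  "carrier (quot_module M N) = (\<lambda>x. N +>\<^bsub>M\<^esub> x) ` carrier M"
  by (auto simp: quot_module_def A_RCOSETS_def')

lemma coset_smult:
  assumes "c \<in> carrier R" "x \<in> carrier M"
  shows "c \<odot>\<^bsub>quot_module M N\<^esub> (N +>\<^bsub>M\<^esub> x) = N +>\<^bsub>M\<^esub> (c \<odot>\<^bsub>M\<^esub> x)"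
proof -
  have "N +>\<^bsub>M\<^esub> (c \<odot>\<^bsub>M\<^esub> y) = N +>\<^bsub>M\<^esub> (c \<odot>\<^bsub>M\<^esub> x)" if "y \<in> N +>\<^bsub>M\<^esub> x" for y
  proof -
    have y: "y \<in> carrier M" using coset_mem_carrier[OF assms(2) that] .
    have "y \<ominus>\<^bsub>M\<^esub> x \<in> N" using coset_eq_of_mem[OF assms(2) that] coset_eq_iff y assms by simp
    hence "c \<odot>\<^bsub>M\<^esub> (y \<ominus>\<^bsub>M\<^esub> x) \<in> N" using submoduleE(4)[OF N] assms by simp
    moreover have "c \<odot>\<^bsub>M\<^esub> (y \<ominus>\<^bsub>M\<^esub> x) = c \<odot>\<^bsub>M\<^esub> y \<ominus>\<^bsub>M\<^esub> c \<odot>\<^bsub>M\<^esub> x"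
      using assms y by (simp add: M.minus_eq smult_r_distr smult_r_minus)
    ultimately show ?thesis using coset_eq_iff y assms by simp
  qed
  hence "(\<Union>y\<in>N +>\<^bsub>M\<^esub> x. N +>\<^bsub>M\<^esub> (c \<odot>\<^bsub>M\<^esub> y)) = (\<Union>y\<in>N +>\<^bsub>M\<^esub> x. N +>\<^bsub>M\<^esub> (c \<odot>\<^bsub>M\<^esub> x))"
    by (rule SUP_cong[OF refl])
  also have "\<dots> = N +>\<^bsub>M\<^esub> (c \<odot>\<^bsub>M\<^esub> x)" using coset_self[OF assms(2)] by blast
  finally show ?thesis by (simp add: quot_module_def)
qed

lemma quot_module_module: "module R (quot_module M N)"
  and coset_linear: "(\<lambda>x. N +>\<^bsub>M\<^esub> x) \<in> linear_maps R M (quot_module M N)"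
proof -
  show "module R (quot_module M N)"
    by (rule module_by_surjection[where p = "\<lambda>x. N +>\<^bsub>M\<^esub> x", OF module_axioms])
      (simp_all add: N.a_rcos_sum coset_smult N.a_subset)
  show "(\<lambda>x. N +>\<^bsub>M\<^esub> x) \<in> linear_maps R M (quot_module M N)"
    by (rule linear_mapsI) (simp_all add: N.a_rcos_sum coset_smult)
qed

end

end

section \<open>Multilinear maps and tensor powers\<close>

definition multilinear ::
  "('c, 'k) ring_scheme \<Rightarrow> ('c, 'a, 'm) module_scheme \<Rightarrow> nat \<Rightarrow> ('c, 'r, 'n) module_scheme
    \<Rightarrow> ('a list \<Rightarrow> 'r) \<Rightarrow> bool"
  where "multilinear C A n M h \<longleftrightarrow> h \<in> tuples A n \<rightarrow> carrier M
    \<and> (\<forall>p q. length p + length q + 1 = n \<longrightarrow> set p \<subseteq> carrier A \<longrightarrow> set q \<subseteq> carrier A \<longrightarrow>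
         (\<lambda>a. h (p @ a # q)) \<in> linear_maps C A M)"

lemma multilinear_closed: "multilinear C A n M h \<Longrightarrow> us \<in> tuples A n \<Longrightarrow> h us \<in> carrier M"
  by (auto simp: multilinear_def)

lemma multilinear_slot:
  "multilinear C A n M h \<Longrightarrow> length p + length q + 1 = n \<Longrightarrow> set p \<subseteq> carrier A \<Longrightarrow> set q \<subseteq> carrier A \<Longrightarrow>
    (\<lambda>a. h (p @ a # q)) \<in> linear_maps C A M"
  by (auto simp: multilinear_def)

lemma multilinearI:
  assumes "\<And>us. us \<in> tuples A n \<Longrightarrow> h us \<in> carrier M"
    and "\<And>p q. length p + length q + 1 = n \<Longrightarrow> set p \<subseteq> carrier A \<Longrightarrow> set q \<subseteq> carrier A \<Longrightarrow>
         (\<lambda>a. h (p @ a # q)) \<in> linear_maps C A M"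
  shows "multilinear C A n M h"
  using assms by (auto simp: multilinear_def)

lemma multilinear_comp:
  "multilinear C A n M h \<Longrightarrow> f \<in> linear_maps C M N \<Longrightarrow> multilinear C A n N (\<lambda>us. f (h us))"
  by (rule multilinearI)
    (blast intro: linear_closed multilinear_closed, rule linear_comp[OF multilinear_slot])

lemma multilinear_cong:
  assumes "multilinear C A n M h" "module C A" "\<And>us. us \<in> tuples A n \<Longrightarrow> g us = h us"
  shows "multilinear C A n M g"
proof (rule multilinearI)
  fix p q assume pq: "length p + length q + 1 = n" "set p \<subseteq> carrier A" "set q \<subseteq> carrier A"
  show "(\<lambda>a. g (p @ a # q)) \<in> linear_maps C A M"
    by (rule linear_cong[OF multilinear_slot[OF assms(1) pq] assms(2)], rule assms(3)[symmetric])
       (use pq in \<open>auto simp: tuples_def\<close>)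
qed (use assms multilinear_closed[OF assms(1)] in simp)

locale tensor_setting =
  fixes C :: "('c, 'k) ring_scheme" and A :: "('c, 'a, 'm) module_scheme"
  assumes algebra_A: "algebra C A"
begin

sublocale C: cring C by (rule algebra.R_cring[OF algebra_A])
sublocale A: algebra C A by (rule algebra_A)

abbreviation "F n \<equiv> free_module C (tuples A n)"
abbreviation "N n \<equiv> module_span C (F n) (multilinear_relations C A n)"
abbreviation "T n \<equiv> tensor_power C A n"
abbreviation "pure \<equiv> pure_tensor C A"
abbreviation "e \<equiv> free_gen C"

sublocale F: module C "F n" for n by (rule C.free_module_module)

lemma tuple_split:
  assumes "us \<in> tuples A n" "i < n"
  obtains p q where "\<forall>a. us[i := a] = p @ a # q" "length p + length q + 1 = n"
    "set p \<subseteq> carrier A" "set q \<subseteq> carrier A"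
proof
  show "\<forall>a. us[i := a] = take i us @ a # drop (Suc i) us"
    using assms by (simp add: tuples_def upd_conv_take_nth_drop)
qed (use assms in \<open>auto simp: tuples_def dest: in_set_takeD in_set_dropD\<close>)

lemma slot_tuple:
  "length p + length q + 1 = n \<Longrightarrow> set p \<subseteq> carrier A \<Longrightarrow> set q \<subseteq> carrier A \<Longrightarrow> a \<in> carrier A \<Longrightarrow>
    p @ a # q \<in> tuples A n"
  by (auto simp: tuples_def)

text \<open>
  The relations are stated for an updated list.  Cutting the list at the updated place turns them
  into statements about the slot between a prefix and a suffix, the form in which multilinearity is
  used here.
\<close>

lemma relation_cases [consumes 1, case_names add smult]:
  assumes "x \<in> multilinear_relations C A n"
  obtains p q a b where "length p + length q + 1 = n" "set p \<subseteq> carrier A" "set q \<subseteq> carrier A"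
      "a \<in> carrier A" "b \<in> carrier A"
      "x = e (p @ (a \<oplus>\<^bsub>A\<^esub> b) # q) \<ominus>\<^bsub>F n\<^esub> (e (p @ a # q) \<oplus>\<^bsub>F n\<^esub> e (p @ b # q))"
    | p q c a where "length p + length q + 1 = n" "set p \<subseteq> carrier A" "set q \<subseteq> carrier A"
      "c \<in> carrier C" "a \<in> carrier A"
      "x = e (p @ (c \<odot>\<^bsub>A\<^esub> a) # q) \<ominus>\<^bsub>F n\<^esub> (c \<odot>\<^bsub>F n\<^esub> e (p @ a # q))"
proof -
  from assms consider us i a b where
      "x = e (us[i := a \<oplus>\<^bsub>A\<^esub> b]) \<ominus>\<^bsub>F n\<^esub> (e (us[i := a]) \<oplus>\<^bsub>F n\<^esub> e (us[i := b]))"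
      "us \<in> tuples A n" "i < n" "a \<in> carrier A" "b \<in> carrier A"
    | us i c a where
      "x = e (us[i := c \<odot>\<^bsub>A\<^esub> a]) \<ominus>\<^bsub>F n\<^esub> (c \<odot>\<^bsub>F n\<^esub> e (us[i := a]))"
      "us \<in> tuples A n" "i < n" "c \<in> carrier C" "a \<in> carrier A"
    unfolding multilinear_relations_def Let_def by blast
  thus thesis
  proof cases
    case (1 us i a b)
    from 1(2,3) obtain p q where "\<forall>a. us[i := a] = p @ a # q" "length p + length q + 1 = n"
      "set p \<subseteq> carrier A" "set q \<subseteq> carrier A" by (rule tuple_split)
    thus thesis by (intro that(1)[OF _ _ _ 1(4,5)]) (simp_all add: 1(1))
  next
    case (2 us i c a)
    from 2(2,3) obtain p q where "\<forall>a. us[i := a] = p @ a # q" "length p + length q + 1 = n"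
      "set p \<subseteq> carrier A" "set q \<subseteq> carrier A" by (rule tuple_split)
    thus thesis by (intro that(2)[OF _ _ _ 2(4,5)]) (simp_all add: 2(1))
  qed
qed

lemma slot_relations:
  assumes pq: "length p + length q + 1 = n" "set p \<subseteq> carrier A" "set q \<subseteq> carrier A" and a: "a \<in> carrier A"
  shows "b \<in> carrier A \<Longrightarrow>
      e (p @ (a \<oplus>\<^bsub>A\<^esub> b) # q) \<ominus>\<^bsub>F n\<^esub> (e (p @ a # q) \<oplus>\<^bsub>F n\<^esub> e (p @ b # q)) \<in> multilinear_relations C A n"
    and "c \<in> carrier C \<Longrightarrow>
      e (p @ (c \<odot>\<^bsub>A\<^esub> a) # q) \<ominus>\<^bsub>F n\<^esub> (c \<odot>\<^bsub>F n\<^esub> e (p @ a # q)) \<in> multilinear_relations C A n"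
proof -
  note us = slot_tuple[OF pq A.zero_closed]
  show "e (p @ (a \<oplus>\<^bsub>A\<^esub> b) # q) \<ominus>\<^bsub>F n\<^esub> (e (p @ a # q) \<oplus>\<^bsub>F n\<^esub> e (p @ b # q)) \<in> multilinear_relations C A n"
    if "b \<in> carrier A"
    unfolding multilinear_relations_def Let_def
    (* The entry in place length p is overwritten; zero only fills the place. *)
    by (intro UnI1 CollectI exI[of _ "p @ \<zero>\<^bsub>A\<^esub> # q"] exI[of _ "length p"] exI[of _ a] exI[of _ b])
      (use pq a that us in simp)
  show "e (p @ (c \<odot>\<^bsub>A\<^esub> a) # q) \<ominus>\<^bsub>F n\<^esub> (c \<odot>\<^bsub>F n\<^esub> e (p @ a # q)) \<in> multilinear_relations C A n"
    if "c \<in> carrier C"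
    unfolding multilinear_relations_def Let_def
    by (intro UnI2 CollectI exI[of _ "p @ \<zero>\<^bsub>A\<^esub> # q"] exI[of _ "length p"] exI[of _ c] exI[of _ a])
      (use pq a that us in simp)
qed

lemma gen_slot:
  "length p + length q + 1 = n \<Longrightarrow> set p \<subseteq> carrier A \<Longrightarrow> set q \<subseteq> carrier A \<Longrightarrow> a \<in> carrier A \<Longrightarrow>
    e (p @ a # q) \<in> carrier (F n)"
  by (rule C.free_gen_closed[OF slot_tuple])

lemma relations_closed: "multilinear_relations C A n \<subseteq> carrier (F n)"
proof
  fix x assume "x \<in> multilinear_relations C A n"
  thus "x \<in> carrier (F n)"
  proof (cases rule: relation_cases)
    case (add p q a b)
    show ?thesis unfolding add(6)
      by (intro F.M.minus_closed F.M.a_closed gen_slot[OF add(1-3)] A.M.a_closed add(4,5))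
  next
    case (smult p q c a)
    show ?thesis unfolding smult(6)
      by (intro F.M.minus_closed F.smult_closed gen_slot[OF smult(1-3)] A.smult_closed smult(4,5))
  qed
qed

lemma N_submodule: "submodule (N n) C (F n)"
  by (rule F.module_span_submodule[OF relations_closed])

lemma tensor_module_module: "module C (tensor_module C A n)"
  unfolding tensor_module_def Let_def by (rule F.quot_module_module[OF N_submodule])

lemma tensor_power_simps [simp]:
  "carrier (T n) = carrier (tensor_module C A n)"
  "zero (T n) = zero (tensor_module C A n)"
  "add (T n) = add (tensor_module C A n)"
  "smult (T n) = smult (tensor_module C A n)"
  by (simp_all add: tensor_power_def)

lemma tensor_power_module: "module C (T n)"
  by (rule module_by_surjection[where p = "\<lambda>x. x", OF tensor_module_module]) simp_all

lemma coset_linear: "(\<lambda>f. N n +>\<^bsub>F n\<^esub> f) \<in> linear_maps C (F n) (T n)"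
  using F.coset_linear[OF N_submodule, of n]
  by (simp add: linear_maps_def tensor_module_def Let_def)

lemma tensor_as_coset:
  assumes "X \<in> carrier (T n)" obtains f where "f \<in> carrier (F n)" "X = N n +>\<^bsub>F n\<^esub> f"
  using assms F.quot_module_simps(3)[OF N_submodule, of n]
  by (auto simp: tensor_module_def Let_def)

lemma pure_as_coset: "us \<in> tuples A n \<Longrightarrow> pure us = N n +>\<^bsub>F n\<^esub> e us"
  by (simp add: pure_tensor_def tuples_def Let_def)

lemma pure_closed: "us \<in> tuples A n \<Longrightarrow> pure us \<in> carrier (T n)"
  by (simp only: pure_as_coset linear_closed[OF coset_linear] C.free_gen_closed)

lemma pure_multilinear: "multilinear C A n (T n) pure"
proof (rule multilinearI)
  fix p q assume pq: "length p + length q + 1 = n" "set p \<subseteq> carrier A" "set q \<subseteq> carrier A"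
  note slot = slot_tuple[OF pq]
  note gen = gen_slot[OF pq]
  have sub: "multilinear_relations C A n \<subseteq> N n" by (rule module_span_superset)
  show "(\<lambda>a. pure (p @ a # q)) \<in> linear_maps C A (T n)"
  proof (rule linear_mapsI)
    fix a assume a: "a \<in> carrier A"
    thus "pure (p @ a # q) \<in> carrier (T n)" by (intro pure_closed slot)
    fix b assume b: "b \<in> carrier A"
    have "e (p @ (a \<oplus>\<^bsub>A\<^esub> b) # q) \<ominus>\<^bsub>F n\<^esub> (e (p @ a # q) \<oplus>\<^bsub>F n\<^esub> e (p @ b # q)) \<in> N n"
      by (rule subsetD[OF sub slot_relations(1)[OF pq a b]])
    hence "N n +>\<^bsub>F n\<^esub> e (p @ (a \<oplus>\<^bsub>A\<^esub> b) # q)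
        = N n +>\<^bsub>F n\<^esub> (e (p @ a # q) \<oplus>\<^bsub>F n\<^esub> e (p @ b # q))"
      using a b by (intro F.coset_eq_iff[OF N_submodule, THEN iffD2] gen F.M.a_closed A.a_closed)
    thus "pure (p @ (a \<oplus>\<^bsub>A\<^esub> b) # q) = pure (p @ a # q) \<oplus>\<^bsub>T n\<^esub> pure (p @ b # q)"
      using linear_add[OF coset_linear gen[OF a] gen[OF b]] a b
      by (simp only: pure_as_coset[OF slot] A.M.a_closed)
  next
    fix c a assume c: "c \<in> carrier C" and a: "a \<in> carrier A"
    have "e (p @ (c \<odot>\<^bsub>A\<^esub> a) # q) \<ominus>\<^bsub>F n\<^esub> (c \<odot>\<^bsub>F n\<^esub> e (p @ a # q)) \<in> N n"
      by (rule subsetD[OF sub slot_relations(2)[OF pq a c]])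
    hence "N n +>\<^bsub>F n\<^esub> e (p @ (c \<odot>\<^bsub>A\<^esub> a) # q)
        = N n +>\<^bsub>F n\<^esub> (c \<odot>\<^bsub>F n\<^esub> e (p @ a # q))"
      using a c by (intro F.coset_eq_iff[OF N_submodule, THEN iffD2] gen F.smult_closed A.smult_closed)
    thus "pure (p @ (c \<odot>\<^bsub>A\<^esub> a) # q) = c \<odot>\<^bsub>T n\<^esub> pure (p @ a # q)"
      using linear_smult[OF coset_linear c gen[OF a]] a c
      by (simp only: pure_as_coset[OF slot] A.smult_closed)
  qed
qed (rule pure_closed)

text \<open>
  The case of the zero tensor is the case of the scalar \<open>0\<close> applied to any pure tensor.
\<close>

lemma tensor_induct [consumes 1, case_names pure add smult]:
  assumes "X \<in> carrier (T n)"
    and pure: "\<And>us. us \<in> tuples A n \<Longrightarrow> P (pure us)"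
    and add: "\<And>X Y. X \<in> carrier (T n) \<Longrightarrow> Y \<in> carrier (T n) \<Longrightarrow> P X \<Longrightarrow> P Y \<Longrightarrow> P (X \<oplus>\<^bsub>T n\<^esub> Y)"
    and smult: "\<And>c X. c \<in> carrier C \<Longrightarrow> X \<in> carrier (T n) \<Longrightarrow> P X \<Longrightarrow> P (c \<odot>\<^bsub>T n\<^esub> X)"
  shows "P X"
proof -
  interpret T: module C "T n" by (rule tensor_power_module)
  note lin = coset_linear[of n]
  obtain f where f: "f \<in> carrier (F n)" "X = N n +>\<^bsub>F n\<^esub> f" using tensor_as_coset[OF assms(1)] .
  have ex: "replicate n \<zero>\<^bsub>A\<^esub> \<in> tuples A n" by (auto simp: tuples_def)
  have "P (N n +>\<^bsub>F n\<^esub> f)" using f(1)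
  proof (induction rule: C.free_module_induct)
    case zero
    have "P (\<zero>\<^bsub>C\<^esub> \<odot>\<^bsub>T n\<^esub> pure (replicate n \<zero>\<^bsub>A\<^esub>))"
      by (intro smult pure pure_closed ex C.zero_closed)
    hence "P \<zero>\<^bsub>T n\<^esub>" by (simp only: T.smult_l_null pure_closed[OF ex])
    thus ?case
      using linear_zero[OF lin F.module_axioms T.module_axioms] by (simp only: free_module_simps)
  next
    case (gen us) thus ?case using pure[OF gen] by (simp only: pure_as_coset[OF gen])
  next
    case (add f g) thus ?case using assms(3) by (simp only: linear_add[OF lin] linear_closed[OF lin])
  next
    case (smult c f) thus ?case using assms(4) by (simp only: linear_smult[OF lin] linear_closed[OF lin])
  qed
  thus ?thesis by (simp only: f(2))
qed

lemma linear_eq_on_pure: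
  assumes "f \<in> linear_maps C (T n) M" "g \<in> linear_maps C (T n) M"
    and "\<And>us. us \<in> tuples A n \<Longrightarrow> f (pure us) = g (pure us)"
    and "X \<in> carrier (T n)"
  shows "f X = g X"
  using assms(4)
  by (induction rule: tensor_induct)
     (simp_all only: assms(3) linear_add[OF assms(1)] linear_add[OF assms(2)]
        linear_smult[OF assms(1)] linear_smult[OF assms(2)])

context
  fixes M :: "('c, 'r, 'n) module_scheme" and h n
  assumes M: "module C M" and h: "multilinear C A n M h"
begin

interpretation M: module C M by (rule M)

lemma free_lift_linear: "free_lift C M h \<in> linear_maps C (F n) M"
  using h by (intro M.free_lift_linear) (simp add: multilinear_def)

text \<open>
  The kernel of a linear map is a submodule, so it contains the span of the relations as soon as it
  contains the relations, and on those multilinearity says exactly that the map vanishes.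
\<close>

lemma free_lift_kernel: "N n \<subseteq> {f \<in> carrier (F n). free_lift C M h f = \<zero>\<^bsub>M\<^esub>}"
proof (rule module_span_least)
  note lin = free_lift_linear
  show "submodule {f \<in> carrier (F n). free_lift C M h f = \<zero>\<^bsub>M\<^esub>} C (F n)"
    by (rule linear_kernel_submodule[OF lin F.module_axioms M])
  have hc: "h us \<in> carrier M" if "us \<in> tuples A n" for us using multilinear_closed[OF h that] .
  have diff: "free_lift C M h (f \<ominus>\<^bsub>F n\<^esub> g) = \<zero>\<^bsub>M\<^esub>"
    if "f \<in> carrier (F n)" "g \<in> carrier (F n)" "free_lift C M h f = free_lift C M h g" for f g
    using that linear_closed[OF lin that(1)]
    by (simp only: F.M.minus_eq linear_add[OF lin] linear_minus[OF lin F.module_axioms M] F.M.a_inv_closed M.M.r_neg)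
  have gen: "free_lift C M h (e us) = h us" "e us \<in> carrier (F n)" if "us \<in> tuples A n" for us
    by (rule M.free_lift_gen, rule hc, rule that, rule C.free_gen_closed, rule that)
  have "x \<in> carrier (F n) \<and> free_lift C M h x = \<zero>\<^bsub>M\<^esub>" if "x \<in> multilinear_relations C A n" for x
    using that
  proof (cases rule: relation_cases)
    case (add p q a b)
    note t = slot_tuple[OF add(1-3)]
    show ?thesis unfolding add(6)
      by (intro conjI F.M.minus_closed F.M.a_closed diff gen t A.M.a_closed add(4,5))
         (simp only: linear_add[OF lin] gen t add(4,5) A.M.a_closed linear_add[OF multilinear_slot[OF h add(1-3)]])
  next
    case (smult p q c a)
    note t = slot_tuple[OF smult(1-3)]
    show ?thesis unfolding smult(6)
      by (intro conjI F.M.minus_closed F.smult_closed diff gen t A.smult_closed smult(4,5))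
         (simp only: linear_smult[OF lin] gen t smult(4,5) A.smult_closed linear_smult[OF multilinear_slot[OF h smult(1-3)]])
  qed
  thus "multilinear_relations C A n \<subseteq> {f \<in> carrier (F n). free_lift C M h f = \<zero>\<^bsub>M\<^esub>}" by blast
qed

lemma tensor_lift_coset:
  assumes f: "f \<in> carrier (F n)"
  shows "tensor_lift C M h (N n +>\<^bsub>F n\<^esub> f) = free_lift C M h f"
proof -
  note lin = free_lift_linear
  have "free_lift C M h g = free_lift C M h f" if g: "g \<in> N n +>\<^bsub>F n\<^esub> f" for g
  proof -
    have gF: "g \<in> carrier (F n)" using F.coset_mem_carrier[OF N_submodule f g] .
    have "g \<ominus>\<^bsub>F n\<^esub> f \<in> N n"
      using F.coset_eq_of_mem[OF N_submodule f g] F.coset_eq_iff[OF N_submodule gF f] by simp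
    hence "free_lift C M h (g \<oplus>\<^bsub>F n\<^esub> \<ominus>\<^bsub>F n\<^esub> f) = \<zero>\<^bsub>M\<^esub>"
      using free_lift_kernel by (auto simp only: F.M.minus_eq)
    hence "free_lift C M h g \<oplus>\<^bsub>M\<^esub> \<ominus>\<^bsub>M\<^esub> free_lift C M h f = \<zero>\<^bsub>M\<^esub>"
      by (simp only: linear_add[OF lin] linear_minus[OF lin F.module_axioms M] gF f F.M.a_inv_closed)
    moreover have "free_lift C M h g \<in> carrier M" "free_lift C M h f \<in> carrier M"
      by (rule linear_closed[OF lin gF], rule linear_closed[OF lin f])
    ultimately show ?thesis by (rule M.M.eq_of_minus_eq_zero[rotated 2])
  qed
  hence "free_lift C M h ` (N n +>\<^bsub>F n\<^esub> f) = {free_lift C M h f}"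
    using F.coset_self[OF N_submodule f] by blast
  thus ?thesis by (simp add: tensor_lift_def free_lift_def)
qed

lemma tensor_lift_pure: "us \<in> tuples A n \<Longrightarrow> tensor_lift C M h (pure us) = h us"
  by (simp only: pure_as_coset tensor_lift_coset C.free_gen_closed M.free_lift_gen multilinear_closed[OF h])

lemma tensor_lift_linear: "tensor_lift C M h \<in> linear_maps C (T n) M"
proof (rule linear_mapsI)
  note lin = free_lift_linear
  fix X assume "X \<in> carrier (T n)"
  then obtain f where f: "f \<in> carrier (F n)" "X = N n +>\<^bsub>F n\<^esub> f" by (rule tensor_as_coset)
  show "tensor_lift C M h X \<in> carrier M"
    by (simp only: f tensor_lift_coset linear_closed[OF lin])
  show "tensor_lift C M h (c \<odot>\<^bsub>T n\<^esub> X) = c \<odot>\<^bsub>M\<^esub> tensor_lift C M h X" if "c \<in> carrier C" for c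
    using linear_smult[OF coset_linear that f(1)] f(1) that
    by (simp only: f(2) tensor_lift_coset linear_smult[OF lin] F.smult_closed flip: linear_smult[OF coset_linear])
  fix Y assume "Y \<in> carrier (T n)"
  then obtain g where g: "g \<in> carrier (F n)" "Y = N n +>\<^bsub>F n\<^esub> g" by (rule tensor_as_coset)
  show "tensor_lift C M h (X \<oplus>\<^bsub>T n\<^esub> Y) = tensor_lift C M h X \<oplus>\<^bsub>M\<^esub> tensor_lift C M h Y"
    using f(1) g(1)
    by (simp only: f(2) g(2) tensor_lift_coset linear_add[OF lin] F.M.a_closed flip: linear_add[OF coset_linear])
qed

end

end


context tensor_setting
begin

lemma A_module: "module C A"
  by (rule algebra.module[OF algebra_A])

text \<open>
  A map on pairs of words that is multilinear in either word extends to a bilinear map on pairs of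
  tensors, by lifting twice.  That the inner lift is again multilinear in the outer word is shown by
  induction on the inner tensor: for a pure tensor it is the hypothesis, and sums and scalar multiples
  of linear maps are linear.
\<close>

context
  fixes n n' :: nat and M :: "('c, 'r, 'n) module_scheme" and k
  assumes M: "module C M"
    and k1: "\<And>vs. vs \<in> tuples A n' \<Longrightarrow> multilinear C A n M (\<lambda>us. k us vs)"
    and k2: "\<And>us. us \<in> tuples A n \<Longrightarrow> multilinear C A n' M (k us)"
begin

lemma bilinear_lift_outer:
  assumes Y: "Y \<in> carrier (T n')"
  shows "multilinear C A n M (\<lambda>us. tensor_lift C M (k us) Y)"
proof (rule multilinearI)
  fix us assume "us \<in> tuples A n"
  thus "tensor_lift C M (k us) Y \<in> carrier M"
    using Y by (intro linear_closed[OF tensor_lift_linear[OF M k2]])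
next
  fix p q assume pq: "length p + length q + 1 = n" "set p \<subseteq> carrier A" "set q \<subseteq> carrier A"
  note lin = tensor_lift_linear[OF M k2[OF slot_tuple[OF pq]]]
  show "(\<lambda>a. tensor_lift C M (k (p @ a # q)) Y) \<in> linear_maps C A M"
    using Y
  proof (induction rule: tensor_induct)
    case (pure vs)
    show ?case
      by (rule linear_cong[OF multilinear_slot[OF k1[OF pure] pq] A_module],
          rule tensor_lift_pure[symmetric, OF M k2 pure], rule slot_tuple[OF pq])
  next
    case (add X Y)
    show ?case
      by (rule linear_cong[OF linear_sum[OF add(3,4) M] A_module], simp only: linear_add[OF lin] add(1,2))
  next
    case (smult c Y)
    show ?case
      by (rule linear_cong[OF linear_scale[OF smult(3) M smult(1)] A_module], simp only: linear_smult[OF lin] smult(1,2))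
  qed
qed

lemma bilinear_lift_linear1:
  "Y \<in> carrier (T n') \<Longrightarrow>
    (\<lambda>X. tensor_lift C M (\<lambda>us. tensor_lift C M (k us) Y) X) \<in> linear_maps C (T n) M"
  by (rule tensor_lift_linear[OF M bilinear_lift_outer])

lemma bilinear_lift_linear2:
  assumes X: "X \<in> carrier (T n)"
  shows "(\<lambda>Y. tensor_lift C M (\<lambda>us. tensor_lift C M (k us) Y) X) \<in> linear_maps C (T n') M"
  using X
proof (induction rule: tensor_induct)
  case (pure us)
  show ?case
    by (rule linear_cong[OF tensor_lift_linear[OF M k2[OF pure]] tensor_power_module],
        rule tensor_lift_pure[symmetric, OF M bilinear_lift_outer pure])
next
  case (add X X')
  show ?case
    by (rule linear_cong[OF linear_sum[OF add(3,4) M] tensor_power_module],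
        simp only: linear_add[OF bilinear_lift_linear1] add(1,2))
next
  case (smult c X)
  show ?case
    by (rule linear_cong[OF linear_scale[OF smult(3) M smult(1)] tensor_power_module],
        simp only: linear_smult[OF bilinear_lift_linear1] smult(1,2))
qed

lemma bilinear_lift_pure:
  assumes "us \<in> tuples A n" "vs \<in> tuples A n'"
  shows "tensor_lift C M (\<lambda>us. tensor_lift C M (k us) (pure vs)) (pure us) = k us vs"
  using assms by (simp only: tensor_lift_pure[OF M bilinear_lift_outer] pure_closed tensor_lift_pure[OF M k2])

end

section \<open>Tensor powers as algebras\<close>

lemma tuples_split_like:
  assumes "us \<in> tuples A n" "length p + length q + 1 = n"
  obtains p' b q' where "us = p' @ b # q'" "length p' = length p" "length q' = length q"
    "set p' \<subseteq> carrier A" "b \<in> carrier A" "set q' \<subseteq> carrier A"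
proof
  have l: "length p < length us" using assms by (simp add: tuples_def)
  show "us = take (length p) us @ us ! length p # drop (Suc (length p)) us"
    by (rule id_take_nth_drop[OF l])
  show "us ! length p \<in> carrier A" using assms l by (auto simp: tuples_def)
qed (use assms in \<open>auto simp: tuples_def dest: in_set_takeD in_set_dropD\<close>)

lemma map2_mult_tuple:
  "us \<in> tuples A n \<Longrightarrow> vs \<in> tuples A n \<Longrightarrow> map2 (mult A) us vs \<in> tuples A n"
  by (auto simp: tuples_def intro!: A.m_closed dest: set_zip_leftD set_zip_rightD)

lemma map2_mult_comm:
  "us \<in> tuples A n \<Longrightarrow> vs \<in> tuples A n \<Longrightarrow> map2 (mult A) us vs = map2 (mult A) vs us"
  by (rule nth_equalityI) (auto simp: tuples_def subset_iff intro!: A.m_comm)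

lemma map2_mult_assoc:
  "us \<in> tuples A n \<Longrightarrow> vs \<in> tuples A n \<Longrightarrow> ws \<in> tuples A n \<Longrightarrow>
    map2 (mult A) (map2 (mult A) us vs) ws = map2 (mult A) us (map2 (mult A) vs ws)"
  by (rule nth_equalityI) (auto simp: tuples_def subset_iff intro!: A.m_assoc)

lemma map2_mult_one:
  "us \<in> tuples A n \<Longrightarrow> map2 (mult A) (replicate n \<one>\<^bsub>A\<^esub>) us = us"
  by (rule nth_equalityI) (auto simp: tuples_def subset_iff)

lemma ones_tuple: "replicate n \<one>\<^bsub>A\<^esub> \<in> tuples A n"
  by (auto simp: tuples_def)

lemma map2_mult_multilinear:
  assumes "us \<in> tuples A n"
  shows "multilinear C A n (T n) (\<lambda>vs. pure (map2 (mult A) us vs))"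
proof (rule multilinearI)
  fix p q assume pq: "length p + length q + 1 = n" "set p \<subseteq> carrier A" "set q \<subseteq> carrier A"
  from assms pq(1) obtain p' b q' where us: "us = p' @ b # q'" and l: "length p' = length p" "length q' = length q"
    and s: "set p' \<subseteq> carrier A" "b \<in> carrier A" "set q' \<subseteq> carrier A" by (rule tuples_split_like)
  have "map2 (mult A) p' p \<in> tuples A (length p)" "map2 (mult A) q' q \<in> tuples A (length q)"
    using pq s l by (intro map2_mult_tuple; simp add: tuples_def)+
  hence "(\<lambda>a. pure (map2 (mult A) p' p @ a # map2 (mult A) q' q)) \<in> linear_maps C A (T n)"
    using pq(1) by (intro multilinear_slot[OF pure_multilinear]) (simp_all add: tuples_def)
  from linear_comp[OF A.mult_left_linear[OF s(2)] this]
  show "(\<lambda>a. pure (map2 (mult A) us (p @ a # q))) \<in> linear_maps C A (T n)"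
    using l by (simp add: us)
qed (use assms in \<open>blast intro: pure_closed map2_mult_tuple\<close>)

lemma map2_mult_multilinear':
  assumes "vs \<in> tuples A n"
  shows "multilinear C A n (T n) (\<lambda>us. pure (map2 (mult A) us vs))"
proof (rule multilinearI)
  fix p q assume pq: "length p + length q + 1 = n" "set p \<subseteq> carrier A" "set q \<subseteq> carrier A"
  show "(\<lambda>a. pure (map2 (mult A) (p @ a # q) vs)) \<in> linear_maps C A (T n)"
    by (rule linear_cong[OF multilinear_slot[OF map2_mult_multilinear[OF assms] pq] A_module])
       (simp only: map2_mult_comm[OF assms slot_tuple[OF pq]])
qed (use assms in \<open>blast intro: pure_closed map2_mult_tuple\<close>)

text \<open>
  The lift only uses the addition and the scalar action of its target, on which the module and the
  algebra of tensors agree.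
\<close>

lemma tensor_lift_target: "tensor_lift C (tensor_module C A n) = tensor_lift C (T n)"
  by (simp add: tensor_lift_def finsum_def fun_eq_iff)

lemma tensor_mult_lift:
  "X \<otimes>\<^bsub>T n\<^esub> Y = tensor_lift C (T n) (\<lambda>us. tensor_lift C (T n) (\<lambda>vs. pure (map2 (mult A) us vs)) Y) X"
  by (simp only: tensor_lift_target[symmetric]) (simp add: tensor_power_def)

lemma tensor_one_def': "\<one>\<^bsub>T n\<^esub> = pure (replicate n \<one>\<^bsub>A\<^esub>)"
  by (simp add: tensor_power_def)

lemma tensor_mult_pure:
  "us \<in> tuples A n \<Longrightarrow> vs \<in> tuples A n \<Longrightarrow> pure us \<otimes>\<^bsub>T n\<^esub> pure vs = pure (map2 (mult A) us vs)"
  unfolding tensor_mult_lift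
  by (rule bilinear_lift_pure[OF tensor_power_module map2_mult_multilinear' map2_mult_multilinear])

lemma tensor_mult_linear1: "Y \<in> carrier (T n) \<Longrightarrow> (\<lambda>X. X \<otimes>\<^bsub>T n\<^esub> Y) \<in> linear_maps C (T n) (T n)"
  unfolding tensor_mult_lift
  by (rule bilinear_lift_linear1[OF tensor_power_module map2_mult_multilinear' map2_mult_multilinear])

lemma tensor_mult_linear2: "X \<in> carrier (T n) \<Longrightarrow> (\<lambda>Y. X \<otimes>\<^bsub>T n\<^esub> Y) \<in> linear_maps C (T n) (T n)"
  unfolding tensor_mult_lift
  by (rule bilinear_lift_linear2[OF tensor_power_module map2_mult_multilinear' map2_mult_multilinear])

lemma tensor_mult_comm:
  assumes "X \<in> carrier (T n)" "Y \<in> carrier (T n)"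
  shows "X \<otimes>\<^bsub>T n\<^esub> Y = Y \<otimes>\<^bsub>T n\<^esub> X"
proof -
  have "pure us \<otimes>\<^bsub>T n\<^esub> Y = Y \<otimes>\<^bsub>T n\<^esub> pure us" if us: "us \<in> tuples A n" for us
    by (rule linear_eq_on_pure[OF tensor_mult_linear2[OF pure_closed[OF us]] tensor_mult_linear1[OF pure_closed[OF us]] _ assms(2)])
      (simp only: tensor_mult_pure us map2_mult_comm[OF us])
  thus ?thesis
    by (rule linear_eq_on_pure[OF tensor_mult_linear1[OF assms(2)] tensor_mult_linear2[OF assms(2)] _ assms(1)])
qed

text \<open>
  The two sides are linear in each argument, so it suffices to compare them on pure tensors, one
  argument after the other.
\<close>

lemma tensor_mult_assoc:
  assumes "X \<in> carrier (T n)" "Y \<in> carrier (T n)" "Z \<in> carrier (T n)"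
  shows "(X \<otimes>\<^bsub>T n\<^esub> Y) \<otimes>\<^bsub>T n\<^esub> Z = X \<otimes>\<^bsub>T n\<^esub> (Y \<otimes>\<^bsub>T n\<^esub> Z)"
proof -
  note l1 = tensor_mult_linear1 and l2 = tensor_mult_linear2 and p = pure_closed
  note cl = linear_closed[OF l1] 
  have 1: "(pure us \<otimes>\<^bsub>T n\<^esub> pure vs) \<otimes>\<^bsub>T n\<^esub> Z = pure us \<otimes>\<^bsub>T n\<^esub> (pure vs \<otimes>\<^bsub>T n\<^esub> Z)"
    if us: "us \<in> tuples A n" and vs: "vs \<in> tuples A n" for us vs
    by (rule linear_eq_on_pure[OF l2[OF cl[OF p[OF vs] p[OF us]]] linear_comp[OF l2[OF p[OF vs]] l2[OF p[OF us]]] _ assms(3)])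
      (simp only: tensor_mult_pure us vs map2_mult_tuple map2_mult_assoc[OF us vs])
  have 2: "(pure us \<otimes>\<^bsub>T n\<^esub> Y) \<otimes>\<^bsub>T n\<^esub> Z = pure us \<otimes>\<^bsub>T n\<^esub> (Y \<otimes>\<^bsub>T n\<^esub> Z)" if us: "us \<in> tuples A n" for us
    by (rule linear_eq_on_pure[OF linear_comp[OF l2[OF p[OF us]] l1[OF assms(3)]]
          linear_comp[OF l1[OF assms(3)] l2[OF p[OF us]]] 1[OF us] assms(2)])
  show ?thesis
    by (rule linear_eq_on_pure[OF linear_comp[OF l1[OF assms(2)] l1[OF assms(3)]]
          l1[OF cl[OF assms(3,2)]] 2 assms(1)])
qed

lemma tensor_mult_one:
  assumes "X \<in> carrier (T n)" shows "\<one>\<^bsub>T n\<^esub> \<otimes>\<^bsub>T n\<^esub> X = X"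
  unfolding tensor_one_def'
  by (rule linear_eq_on_pure[OF tensor_mult_linear2[OF pure_closed[OF ones_tuple]] linear_id _ assms])
     (simp only: tensor_mult_pure ones_tuple map2_mult_one)

lemma tensor_power_algebra: "algebra C (T n)"
proof -
  interpret T: module C "T n" by (rule tensor_power_module)
  have one: "\<one>\<^bsub>T n\<^esub> \<in> carrier (T n)" unfolding tensor_one_def' by (rule pure_closed[OF ones_tuple])
  have cl: "X \<otimes>\<^bsub>T n\<^esub> Y \<in> carrier (T n)" if "X \<in> carrier (T n)" "Y \<in> carrier (T n)" for X Y
    using linear_closed[OF tensor_mult_linear1] that by blast
  have "comm_monoid (T n)"
    by (rule comm_monoidI) (fact cl one tensor_mult_assoc tensor_mult_one tensor_mult_comm)+
  hence "cring (T n)"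
    by (rule cringI[OF T.M.abelian_group_axioms]) (rule linear_add[OF tensor_mult_linear1])
  thus ?thesis
    by (rule algebraI[OF C.is_cring])
      ((fact T.smult_closed T.smult_l_distr T.smult_r_distr T.smult_assoc1 T.smult_one)+,
        rule linear_smult[OF tensor_mult_linear1])
qed

sublocale T: algebra C "T n" for n by (rule tensor_power_algebra)

subsection \<open>Maps between tensor powers\<close>

lemma append_one_multilinear: "multilinear C A n (T (n + 1)) (\<lambda>us. pure (us @ [\<one>\<^bsub>A\<^esub>]))"
proof (rule multilinearI)
  fix p q assume pq: "length p + length q + 1 = n" "set p \<subseteq> carrier A" "set q \<subseteq> carrier A"
  have "(\<lambda>a. pure (p @ a # (q @ [\<one>\<^bsub>A\<^esub>]))) \<in> linear_maps C A (T (n + 1))"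
    using pq by (intro multilinear_slot[OF pure_multilinear]) auto
  thus "(\<lambda>a. pure ((p @ a # q) @ [\<one>\<^bsub>A\<^esub>])) \<in> linear_maps C A (T (n + 1))" by simp
qed (auto simp: tuples_def simp del: tensor_power_simps intro!: pure_closed)

lemma append_one_tuple: "us \<in> tuples A n \<Longrightarrow> us @ [\<one>\<^bsub>A\<^esub>] \<in> tuples A (n + 1)"
  by (auto simp: tuples_def)

lemma tensor_one_linear: "tensor_one C A n \<in> linear_maps C (T n) (T (n + 1))"
  unfolding tensor_one_def by (rule tensor_lift_linear[OF T.module append_one_multilinear])

lemma tensor_one_pure: "us \<in> tuples A n \<Longrightarrow> tensor_one C A n (pure us) = pure (us @ [\<one>\<^bsub>A\<^esub>])"
  unfolding tensor_one_def by (rule tensor_lift_pure[OF T.module append_one_multilinear])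

lemma tensor_one_mult:
  assumes "X \<in> carrier (T n)" "Y \<in> carrier (T n)"
  shows "tensor_one C A n (X \<otimes>\<^bsub>T n\<^esub> Y) = tensor_one C A n X \<otimes>\<^bsub>T (n + 1)\<^esub> tensor_one C A n Y"
proof -
  note l1 = T.mult_right_linear and l2 = T.mult_left_linear and t = tensor_one_linear
  have 1: "tensor_one C A n (pure us \<otimes>\<^bsub>T n\<^esub> Y) = tensor_one C A n (pure us) \<otimes>\<^bsub>T (n + 1)\<^esub> tensor_one C A n Y"
    if us: "us \<in> tuples A n" for us
  proof (rule linear_eq_on_pure[OF linear_comp[OF l2[OF pure_closed[OF us]] t]
        linear_comp[OF t l2[OF linear_closed[OF t pure_closed[OF us]]]] _ assms(2)])
    fix vs assume vs: "vs \<in> tuples A n"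
    have "map2 (mult A) us vs @ [\<one>\<^bsub>A\<^esub>] = map2 (mult A) (us @ [\<one>\<^bsub>A\<^esub>]) (vs @ [\<one>\<^bsub>A\<^esub>])"
      using us vs by (simp add: tuples_def)
    thus "tensor_one C A n (pure us \<otimes>\<^bsub>T n\<^esub> pure vs) = tensor_one C A n (pure us) \<otimes>\<^bsub>T (n + 1)\<^esub> tensor_one C A n (pure vs)"
      using us vs by (simp only: tensor_mult_pure tensor_one_pure map2_mult_tuple append_one_tuple)
  qed
  show ?thesis
    by (rule linear_eq_on_pure[OF linear_comp[OF l1[OF assms(2)] t]
        linear_comp[OF t l1[OF linear_closed[OF t assms(2)]]] 1 assms(1)])
qed

lemma tensor_one_one: "tensor_one C A n \<one>\<^bsub>T n\<^esub> = \<one>\<^bsub>T (n + 1)\<^esub>"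
  by (simp only: tensor_one_def' tensor_one_pure ones_tuple)
     (simp add: replicate_append_same)

text \<open>
  On tensors, multiplying the last two letters of a word is a left inverse of appending the factor
  \<open>1\<close>; this is why the tensor powers embed into their direct limit.
\<close>

definition fuse :: "'a list \<Rightarrow> 'a list"
  where "fuse us = butlast (butlast us) @ [last (butlast us) \<otimes>\<^bsub>A\<^esub> last us]"

lemma fuse_multilinear:
  assumes "n \<ge> 1" shows "multilinear C A (n + 1) (T n) (\<lambda>us. pure (fuse us))"
proof (rule multilinearI)
  fix us assume us: "us \<in> tuples A (n + 1)"
  then obtain ys c where "us = ys @ [c]" by (cases us rule: rev_cases) (auto simp: tuples_def)
  moreover from this obtain us' b where "ys = us' @ [b]"
    using assms us by (cases ys rule: rev_cases) (auto simp: tuples_def)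
  ultimately have "us = us' @ [b, c]" by simp
  hence "fuse us \<in> tuples A n" using us by (auto simp: fuse_def tuples_def butlast_append)
  thus "pure (fuse us) \<in> carrier (T n)" by (rule pure_closed)
next
  note slot = multilinear_slot[OF pure_multilinear]
  fix p q assume pq: "length p + length q + 1 = n + 1" "set p \<subseteq> carrier A" "set q \<subseteq> carrier A"
  show "(\<lambda>a. pure (fuse (p @ a # q))) \<in> linear_maps C A (T n)"
  proof (cases q rule: rev_cases)
    case Nil
    then obtain p' b where p: "p = p' @ [b]" using pq assms by (cases p rule: rev_cases) auto
    have "(\<lambda>a. pure (p' @ a # [])) \<in> linear_maps C A (T n)"
      using pq by (intro slot) (auto simp: p Nil)
    from linear_comp[OF A.mult_left_linear[of b] this] show ?thesis
      using pq by (simp add: p Nil fuse_def butlast_append)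
  next
    case (snoc q' c)
    show ?thesis
    proof (cases q' rule: rev_cases)
      case Nil
      have "(\<lambda>a. pure (p @ a # [])) \<in> linear_maps C A (T n)"
        using pq by (intro slot) (auto simp: snoc Nil)
      from linear_comp[OF A.mult_right_linear[of c] this] show ?thesis
        using pq by (simp add: snoc Nil fuse_def butlast_append)
    next
      case (snoc q'' b)
      have "(\<lambda>a. pure (p @ a # q'' @ [b \<otimes>\<^bsub>A\<^esub> c])) \<in> linear_maps C A (T n)"
        using pq by (intro slot) (auto simp: \<open>q = q' @ [c]\<close> snoc)
      thus ?thesis
        by (simp add: \<open>q = q' @ [c]\<close> snoc fuse_def butlast_append)
    qed
  qed
qed

lemma tensor_one_inj:
  assumes "n \<ge> 1" shows "inj_on (tensor_one C A n) (carrier (T n))"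
proof (rule inj_on_inverseI)
  fix X assume X: "X \<in> carrier (T n)"
  let ?r = "tensor_lift C (T n) (\<lambda>us. pure (fuse us))"
  note fm = fuse_multilinear[OF assms]
  have r: "?r \<in> linear_maps C (T (n + 1)) (T n)"
    by (rule tensor_lift_linear[OF T.module fm])
  show "?r (tensor_one C A n X) = X"
  proof (rule linear_eq_on_pure[OF linear_comp[OF tensor_one_linear r] linear_id _ X])
    fix us assume us: "us \<in> tuples A n"
    hence "fuse (us @ [\<one>\<^bsub>A\<^esub>]) = us"
      using assms by (cases us rule: rev_cases) (auto simp: fuse_def tuples_def butlast_append)
    thus "?r (tensor_one C A n (pure us)) = pure us"
      using us by (simp only: tensor_one_pure tensor_lift_pure[OF T.module fm] append_one_tuple)
  qed
qed

text \<open>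
  In the algebra of sequences the lowest component of a tensor shows up with its factors reversed;
  applying the reversal once more recovers the tensor.
\<close>

definition tensor_rev :: "nat \<Rightarrow> ('a, 'c) tensor \<Rightarrow> ('a, 'c) tensor"
  where "tensor_rev n = tensor_lift C (T n) (\<lambda>us. pure (rev us))"

lemma rev_multilinear: "multilinear C A n (T n) (\<lambda>us. pure (rev us))"
proof (rule multilinearI)
  fix p q assume pq: "length p + length q + 1 = n" "set p \<subseteq> carrier A" "set q \<subseteq> carrier A"
  have "(\<lambda>a. pure (rev q @ a # rev p)) \<in> linear_maps C A (T n)"
    using pq by (intro multilinear_slot[OF pure_multilinear]) auto
  thus "(\<lambda>a. pure (rev (p @ a # q))) \<in> linear_maps C A (T n)" by simp
qed (auto simp: tuples_def simp del: tensor_power_simps intro!: pure_closed)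

lemma tensor_rev_linear: "tensor_rev n \<in> linear_maps C (T n) (T n)"
  unfolding tensor_rev_def by (rule tensor_lift_linear[OF T.module rev_multilinear])

lemma tensor_rev_pure: "us \<in> tuples A n \<Longrightarrow> tensor_rev n (pure us) = pure (rev us)"
  unfolding tensor_rev_def by (rule tensor_lift_pure[OF T.module rev_multilinear])

lemma tensor_rev_rev: "X \<in> carrier (T n) \<Longrightarrow> tensor_rev n (tensor_rev n X) = X"
proof (rule linear_eq_on_pure[OF linear_comp[OF tensor_rev_linear tensor_rev_linear] linear_id])
  fix us assume us: "us \<in> tuples A n"
  hence "rev us \<in> tuples A n" by (simp add: tuples_def)
  thus "tensor_rev n (tensor_rev n (pure us)) = pure us" using us by (simp only: tensor_rev_pure rev_rev_ident)
qed

end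


section \<open>The direct limit of a sequence of algebras\<close>

locale direct_system =
  fixes C :: "('c, 'k) ring_scheme" and M :: "nat \<Rightarrow> ('c, 'r, 'm) module_scheme" and h :: "nat \<Rightarrow> 'r \<Rightarrow> 'r"
  assumes system_algebra: "1 \<le> n \<Longrightarrow> algebra C (M n)"
    and step_linear: "1 \<le> n \<Longrightarrow> h n \<in> linear_maps C (M n) (M (Suc n))"
    and step_mult: "1 \<le> n \<Longrightarrow> x \<in> carrier (M n) \<Longrightarrow> y \<in> carrier (M n) \<Longrightarrow>
      h n (x \<otimes>\<^bsub>M n\<^esub> y) = h n x \<otimes>\<^bsub>M (Suc n)\<^esub> h n y"
    and step_one: "1 \<le> n \<Longrightarrow> h n \<one>\<^bsub>M n\<^esub> = \<one>\<^bsub>M (Suc n)\<^esub>"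
begin

abbreviation "tr \<equiv> dl_trans h"
abbreviation "cls \<equiv> dl_class M h"
abbreviation "L \<equiv> direct_limit M h"

lemma tr_self [simp]: "tr n n x = x"
  by (simp add: dl_trans_def)

lemma tr_Suc: "m \<le> n \<Longrightarrow> tr m (Suc n) x = h n (tr m n x)"
  by (simp add: dl_trans_def)

lemma tr_trans: "m \<le> k \<Longrightarrow> k \<le> n \<Longrightarrow> tr k n (tr m k x) = tr m n x"
  using upt_add_eq_append[of m k "n - k"] by (simp add: dl_trans_def)

lemma tr_linear:
  assumes "1 \<le> m" "m \<le> n" shows "tr m n \<in> linear_maps C (M m) (M n)"
  using assms(2)
proof (induction n rule: dec_induct)
  case base thus ?case by (simp add: linear_maps_def)
next
  case (step n)
  from linear_comp[OF step.IH step_linear] assms(1) step(1) show ?case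
    by (simp add: tr_Suc linear_maps_def Pi_iff)
qed

lemma tr_closed: "1 \<le> m \<Longrightarrow> m \<le> n \<Longrightarrow> x \<in> carrier (M m) \<Longrightarrow> tr m n x \<in> carrier (M n)"
  by (rule linear_closed[OF tr_linear])

lemma tr_zero: "1 \<le> m \<Longrightarrow> m \<le> n \<Longrightarrow> tr m n \<zero>\<^bsub>M m\<^esub> = \<zero>\<^bsub>M n\<^esub>"
  by (rule linear_zero[OF tr_linear algebra.module[OF system_algebra] algebra.module[OF system_algebra]]) simp_all

lemma tr_one:
  assumes "1 \<le> m" "m \<le> n" shows "tr m n \<one>\<^bsub>M m\<^esub> = \<one>\<^bsub>M n\<^esub>"
  using assms(2)
proof (induction n rule: dec_induct)
  case (step n) thus ?case using assms(1) by (simp add: tr_Suc step_one)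
qed simp

lemma tr_mult:
  assumes "1 \<le> m" "m \<le> n" "x \<in> carrier (M m)" "y \<in> carrier (M m)"
  shows "tr m n (x \<otimes>\<^bsub>M m\<^esub> y) = tr m n x \<otimes>\<^bsub>M n\<^esub> tr m n y"
  using assms(2)
  by (induction n rule: dec_induct) (use assms in \<open>simp_all add: tr_Suc step_mult tr_closed\<close>)

lemma equiv_dl_rel: "equiv (dl_elems M) (dl_rel M h)"
proof (rule equivI)
  show "dl_rel M h \<subseteq> dl_elems M \<times> dl_elems M" by (auto simp: dl_rel_def)
  show "refl_on (dl_elems M) (dl_rel M h)" by (auto simp: refl_on_def dl_rel_def)
  show "sym (dl_rel M h)" by (rule symI, clarsimp simp: dl_rel_def) metis
  show "trans (dl_rel M h)"
  proof (rule transI, clarify)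
    fix m x n y l z
    assume "((m, x), (n, y)) \<in> dl_rel M h" "((n, y), (l, z)) \<in> dl_rel M h"
    then obtain k k' where k: "max m n \<le> k" "tr m k x = tr n k y" "max n l \<le> k'" "tr n k' y = tr l k' z"
      and e: "(m, x) \<in> dl_elems M" "(l, z) \<in> dl_elems M" by (auto simp: dl_rel_def)
    have "tr m (max k k') x = tr l (max k k') z"
      using k tr_trans[of m k "max k k'" x] tr_trans[of n k "max k k'" y]
        tr_trans[of n k' "max k k'" y] tr_trans[of l k' "max k k'" z] by simp
    moreover have "max m l \<le> max k k'" using k by auto
    ultimately show "((m, x), (l, z)) \<in> dl_rel M h" using e by (auto simp: dl_rel_def)
  qed
qed

lemma cls_mem_iff:
  "1 \<le> n \<Longrightarrow> x \<in> carrier (M n) \<Longrightarrow> (m, y) \<in> cls n x \<longleftrightarrow>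
    1 \<le> m \<and> y \<in> carrier (M m) \<and> (\<exists>k \<ge> max n m. tr n k x = tr m k y)"
  by (auto simp: dl_class_def dl_rel_def dl_elems_def)

lemma cls_eq_iff:
  "1 \<le> n \<Longrightarrow> x \<in> carrier (M n) \<Longrightarrow> 1 \<le> m \<Longrightarrow> y \<in> carrier (M m) \<Longrightarrow>
    cls n x = cls m y \<longleftrightarrow> (\<exists>k \<ge> max n m. tr n k x = tr m k y)"
  unfolding dl_class_def
  by (subst eq_equiv_class_iff[OF equiv_dl_rel]) (auto simp: dl_rel_def dl_elems_def)

lemma cls_tr: "1 \<le> n \<Longrightarrow> n \<le> k \<Longrightarrow> x \<in> carrier (M n) \<Longrightarrow> cls k (tr n k x) = cls n x"
  by (subst cls_eq_iff) (auto intro: tr_closed exI[of _ k])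

lemma L_carrier: "carrier L = {cls n x | n x. 1 \<le> n \<and> x \<in> carrier (M n)}"
  by (auto simp: direct_limit_def quotient_def dl_elems_def dl_class_def)

lemma cls_closed: "1 \<le> n \<Longrightarrow> x \<in> carrier (M n) \<Longrightarrow> cls n x \<in> carrier L"
  by (auto simp: L_carrier)

text \<open>
  The sum and the product of two classes are defined as unions over all representatives.  Any two
  representatives agree with the given ones at a late enough stage, and the operation commutes with
  the transition maps, so all members of the union are the same class.
\<close>

lemma cls_binary:
  assumes closed: "\<And>n x y. 1 \<le> n \<Longrightarrow> x \<in> carrier (M n) \<Longrightarrow> y \<in> carrier (M n) \<Longrightarrow> opr n x y \<in> carrier (M n)"
    and compat: "\<And>m n x y. 1 \<le> m \<Longrightarrow> m \<le> n \<Longrightarrow> x \<in> carrier (M m) \<Longrightarrow> y \<in> carrier (M m) \<Longrightarrow>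
      tr m n (opr m x y) = opr n (tr m n x) (tr m n y)"
    and n: "1 \<le> n" and x: "x \<in> carrier (M n)" and y: "y \<in> carrier (M n)"
  shows "(\<Union>(m, x)\<in>cls n x. \<Union>(n, y)\<in>cls n y. cls (max m n) (opr (max m n) (tr m (max m n) x) (tr n (max m n) y)))
    = cls n (opr n x y)"
proof -
  have "cls (max m m') (opr (max m m') (tr m (max m m') x') (tr m' (max m m') y')) = cls n (opr n x y)"
    if mem: "(m, x') \<in> cls n x" "(m', y') \<in> cls n y" for m x' m' y'
  proof -
    obtain k k' where k: "max n m \<le> k" "tr n k x = tr m k x'" "max n m' \<le> k'" "tr n k' y = tr m' k' y'"
      and m: "1 \<le> m" "x' \<in> carrier (M m)" "1 \<le> m'" "y' \<in> carrier (M m')"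
      using mem unfolding cls_mem_iff[OF n x] cls_mem_iff[OF n y] by blast
    define K where "K = max k k'"
    have K: "n \<le> K" "m \<le> K" "m' \<le> K" "max m m' \<le> K" "k \<le> K" "k' \<le> K" using k by (auto simp: K_def)
    have e: "tr n K x = tr m K x'" "tr n K y = tr m' K y'"
      using k K tr_trans[of n k K x] tr_trans[of m k K x'] tr_trans[of n k' K y] tr_trans[of m' k' K y'] by simp_all
    let ?l = "max m m'"
    have l: "tr m ?l x' \<in> carrier (M ?l)" "tr m' ?l y' \<in> carrier (M ?l)" "1 \<le> ?l"
      using m by (auto intro: tr_closed)
    have "cls ?l (opr ?l (tr m ?l x') (tr m' ?l y')) = cls K (tr ?l K (opr ?l (tr m ?l x') (tr m' ?l y')))"
      using K l by (intro cls_tr[symmetric] closed)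
    also have "tr ?l K (opr ?l (tr m ?l x') (tr m' ?l y')) = opr K (tr n K x) (tr n K y)"
      by (simp only: compat[OF l(3) K(4) l(1,2)] tr_trans max.cobounded1 max.cobounded2 K e)
    also have "\<dots> = tr n K (opr n x y)" using compat[OF n K(1) x y] by simp
    also have "cls K \<dots> = cls n (opr n x y)" using n x y K by (intro cls_tr closed)
    finally show ?thesis .
  qed
  moreover have "(n, x) \<in> cls n x" "(n, y) \<in> cls n y" using n x y by (auto simp: cls_mem_iff)
  ultimately show ?thesis by fast
qed

lemma cls_add:
  assumes "1 \<le> n" "x \<in> carrier (M n)" "y \<in> carrier (M n)"
  shows "cls n x \<oplus>\<^bsub>L\<^esub> cls n y = cls n (x \<oplus>\<^bsub>M n\<^esub> y)"
proof -
  have "algebra C (M n)" if "1 \<le> n" for n using system_algebra that .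
  hence "abelian_monoid (M n)" if "1 \<le> n" for n
    using that by (meson algebra.module module.axioms(2) abelian_group.axioms(1))
  thus ?thesis
    unfolding direct_limit_def ring.simps module.simps
    by (intro cls_binary assms) (auto intro: abelian_monoid.a_closed linear_add[OF tr_linear])
qed

lemma cls_mult:
  assumes "1 \<le> n" "x \<in> carrier (M n)" "y \<in> carrier (M n)"
  shows "cls n x \<otimes>\<^bsub>L\<^esub> cls n y = cls n (x \<otimes>\<^bsub>M n\<^esub> y)"
proof -
  have "algebra C (M n)" if "1 \<le> n" for n using system_algebra that .
  hence "monoid (M n)" if "1 \<le> n" for n
    using that by (meson algebra.M_cring cring.axioms(1) ring.axioms(2))
  thus ?thesis
    unfolding direct_limit_def monoid.simps
    by (intro cls_binary assms) (auto intro: monoid.m_closed tr_mult)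
qed

lemma cls_smult:
  assumes n: "1 \<le> n" and x: "x \<in> carrier (M n)" and c: "c \<in> carrier C"
  shows "c \<odot>\<^bsub>L\<^esub> cls n x = cls n (c \<odot>\<^bsub>M n\<^esub> x)"
proof -
  have sm: "c \<odot>\<^bsub>M m\<^esub> y \<in> carrier (M m)" if "1 \<le> m" "y \<in> carrier (M m)" for m y
    using module.smult_closed[OF algebra.module[OF system_algebra]] that c by blast
  have "cls m (c \<odot>\<^bsub>M m\<^esub> y) = cls n (c \<odot>\<^bsub>M n\<^esub> x)" if mem: "(m, y) \<in> cls n x" for m y
  proof -
    obtain k where k: "max n m \<le> k" "tr n k x = tr m k y" and m: "1 \<le> m" "y \<in> carrier (M m)"
      using mem unfolding cls_mem_iff[OF n x] by blast
    have "tr m k (c \<odot>\<^bsub>M m\<^esub> y) = tr n k (c \<odot>\<^bsub>M n\<^esub> x)"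
      using k n x m c by (simp add: linear_smult[OF tr_linear])
    thus ?thesis using k n x m sm by (subst cls_eq_iff) (auto intro!: exI[of _ k])
  qed
  moreover have "(n, x) \<in> cls n x" using n x by (auto simp: cls_mem_iff)
  ultimately show ?thesis unfolding direct_limit_def module.simps by fast
qed

lemma cls_zero: "1 \<le> n \<Longrightarrow> \<zero>\<^bsub>L\<^esub> = cls n \<zero>\<^bsub>M n\<^esub>"
proof -
  assume n: "1 \<le> n"
  interpret M1: algebra C "M 1" by (rule system_algebra) simp
  show ?thesis
    using cls_tr[OF order_refl n M1.M.zero_closed] tr_zero[OF order_refl n] by (simp add: direct_limit_def)
qed

lemma cls_one: "1 \<le> n \<Longrightarrow> \<one>\<^bsub>L\<^esub> = cls n \<one>\<^bsub>M n\<^esub>"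
proof -
  assume n: "1 \<le> n"
  interpret M1: algebra C "M 1" by (rule system_algebra) simp
  show ?thesis
    using cls_tr[OF order_refl n M1.one_closed] tr_one[OF order_refl n] by (simp add: direct_limit_def)
qed

text \<open>
  A law involves at most three elements; these live in one of the algebras \<open>M n\<close>, which satisfies the law.
\<close>

lemma common_stage:
  assumes "X \<in> carrier L" "Y \<in> carrier L" "Z \<in> carrier L"
  obtains n x y z where "1 \<le> n" "x \<in> carrier (M n)" "y \<in> carrier (M n)" "z \<in> carrier (M n)"
    "X = cls n x" "Y = cls n y" "Z = cls n z"
proof -
  from assms obtain i x j y k z where *: "1 \<le> i" "x \<in> carrier (M i)" "X = cls i x"
    "1 \<le> j" "y \<in> carrier (M j)" "Y = cls j y" "1 \<le> k" "z \<in> carrier (M k)" "Z = cls k z"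
    by (auto simp: L_carrier)
  define n where "n = max i (max j k)"
  have n: "i \<le> n" "j \<le> n" "k \<le> n" by (auto simp: n_def)
  show ?thesis
    by (rule that[of n "tr i n x" "tr j n y" "tr k n z"])
      (use * n in \<open>auto simp: cls_tr intro: tr_closed\<close>)
qed

context
  fixes n :: nat assumes n: "1 \<le> n"
begin

interpretation Mn: algebra C "M n" by (rule system_algebra[OF n])

lemma stage_closed:
  "\<zero>\<^bsub>M n\<^esub> \<in> carrier (M n)" "\<one>\<^bsub>M n\<^esub> \<in> carrier (M n)"
  "x \<in> carrier (M n) \<Longrightarrow> y \<in> carrier (M n) \<Longrightarrow> x \<oplus>\<^bsub>M n\<^esub> y \<in> carrier (M n)"
  "x \<in> carrier (M n) \<Longrightarrow> y \<in> carrier (M n) \<Longrightarrow> x \<otimes>\<^bsub>M n\<^esub> y \<in> carrier (M n)"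
  "a \<in> carrier C \<Longrightarrow> x \<in> carrier (M n) \<Longrightarrow> a \<odot>\<^bsub>M n\<^esub> x \<in> carrier (M n)"
  "x \<in> carrier (M n) \<Longrightarrow> \<ominus>\<^bsub>M n\<^esub> x \<in> carrier (M n)"
  by simp_all

lemmas stage_laws = Mn.M.a_assoc Mn.m_assoc Mn.l_distr Mn.M.l_zero Mn.l_one Mn.M.l_neg
  Mn.smult_l_distr Mn.smult_r_distr Mn.smult_assoc1 Mn.smult_assoc2 Mn.smult_one

lemmas stage_comm = Mn.M.a_comm Mn.m_comm

end

lemma direct_limit_algebra: "algebra C L"
proof -
  interpret M1: algebra C "M 1" by (rule system_algebra) simp
  note simps = cls_add cls_mult cls_smult cls_closed cls_zero cls_one stage_closed stage_laws
  have zero: "\<zero>\<^bsub>L\<^esub> \<in> carrier L" and one: "\<one>\<^bsub>L\<^esub> \<in> carrier L"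
    by (simp_all only: cls_zero[OF order_refl] cls_one[OF order_refl] cls_closed[OF order_refl] stage_closed)
  have stage: thesis
    if "X \<in> carrier L" "Y \<in> carrier L"
      and "\<And>n x y. 1 \<le> n \<Longrightarrow> x \<in> carrier (M n) \<Longrightarrow> y \<in> carrier (M n) \<Longrightarrow> X = cls n x \<Longrightarrow> Y = cls n y \<Longrightarrow> thesis"
    for X Y thesis using common_stage[OF that(1,2,1)] that(3) by metis
  have comm: "X \<oplus>\<^bsub>L\<^esub> Y = Y \<oplus>\<^bsub>L\<^esub> X" "X \<otimes>\<^bsub>L\<^esub> Y = Y \<otimes>\<^bsub>L\<^esub> X" "X \<oplus>\<^bsub>L\<^esub> Y \<in> carrier L" "X \<otimes>\<^bsub>L\<^esub> Y \<in> carrier L"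
    if "X \<in> carrier L" "Y \<in> carrier L" for X Y
    by (rule stage[OF that], simp add: simps stage_comm)+
  have "abelian_group L"
  proof (rule abelian_groupI)
    fix X Y Z assume "X \<in> carrier L" "Y \<in> carrier L" "Z \<in> carrier L"
    thus "X \<oplus>\<^bsub>L\<^esub> Y \<oplus>\<^bsub>L\<^esub> Z = X \<oplus>\<^bsub>L\<^esub> (Y \<oplus>\<^bsub>L\<^esub> Z)" by (rule common_stage) (simp add: simps)
  next
    fix X assume X: "X \<in> carrier L"
    show "\<zero>\<^bsub>L\<^esub> \<oplus>\<^bsub>L\<^esub> X = X" by (rule stage[OF X X]) (simp add: simps)
    show "\<exists>Y\<in>carrier L. Y \<oplus>\<^bsub>L\<^esub> X = \<zero>\<^bsub>L\<^esub>"
    proof (rule stage[OF X X])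
      fix n x assume "1 \<le> n" "x \<in> carrier (M n)" "X = cls n x"
      thus ?thesis by (intro bexI[of _ "cls n (\<ominus>\<^bsub>M n\<^esub> x)"]) (simp_all add: simps)
    qed
  qed (fact zero comm)+
  moreover have "comm_monoid L"
  proof (rule comm_monoidI)
    fix X Y Z assume "X \<in> carrier L" "Y \<in> carrier L" "Z \<in> carrier L"
    thus "X \<otimes>\<^bsub>L\<^esub> Y \<otimes>\<^bsub>L\<^esub> Z = X \<otimes>\<^bsub>L\<^esub> (Y \<otimes>\<^bsub>L\<^esub> Z)" by (rule common_stage) (simp add: simps)
  next
    fix X assume X: "X \<in> carrier L"
    show "\<one>\<^bsub>L\<^esub> \<otimes>\<^bsub>L\<^esub> X = X" by (rule stage[OF X X]) (simp add: simps)
  qed (fact one comm)+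
  ultimately have "cring L"
  proof (rule cringI)
    fix X Y Z assume "X \<in> carrier L" "Y \<in> carrier L" "Z \<in> carrier L"
    thus "(X \<oplus>\<^bsub>L\<^esub> Y) \<otimes>\<^bsub>L\<^esub> Z = X \<otimes>\<^bsub>L\<^esub> Z \<oplus>\<^bsub>L\<^esub> Y \<otimes>\<^bsub>L\<^esub> Z" by (rule common_stage) (simp add: simps)
  qed
  thus ?thesis
  proof (rule algebraI[OF M1.R_cring])
    fix X assume X: "X \<in> carrier L"
    show "\<one>\<^bsub>C\<^esub> \<odot>\<^bsub>L\<^esub> X = X" by (rule stage[OF X X]) (simp add: simps)
    fix a assume a: "a \<in> carrier C"
    show "a \<odot>\<^bsub>L\<^esub> X \<in> carrier L" by (rule stage[OF X X]) (simp add: simps a)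
    show "a \<odot>\<^bsub>L\<^esub> (X \<oplus>\<^bsub>L\<^esub> Y) = a \<odot>\<^bsub>L\<^esub> X \<oplus>\<^bsub>L\<^esub> a \<odot>\<^bsub>L\<^esub> Y"
      "a \<odot>\<^bsub>L\<^esub> X \<otimes>\<^bsub>L\<^esub> Y = a \<odot>\<^bsub>L\<^esub> (X \<otimes>\<^bsub>L\<^esub> Y)" if Y: "Y \<in> carrier L" for Y
      by (rule stage[OF X Y], simp add: simps a)+
    fix b assume b: "b \<in> carrier C"
    show "(a \<oplus>\<^bsub>C\<^esub> b) \<odot>\<^bsub>L\<^esub> X = a \<odot>\<^bsub>L\<^esub> X \<oplus>\<^bsub>L\<^esub> b \<odot>\<^bsub>L\<^esub> X" "a \<otimes>\<^bsub>C\<^esub> b \<odot>\<^bsub>L\<^esub> X = a \<odot>\<^bsub>L\<^esub> (b \<odot>\<^bsub>L\<^esub> X)"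
      by (rule stage[OF X X], simp add: simps a b)+
  qed
qed

lemma cls_linear: "1 \<le> n \<Longrightarrow> cls n \<in> linear_maps C (M n) L"
  by (rule linear_mapsI) (simp_all add: cls_closed cls_add cls_smult)

lemma cls_inj:
  assumes inj: "\<And>n. 1 \<le> n \<Longrightarrow> inj_on (h n) (carrier (M n))" and n: "1 \<le> n"
  shows "inj_on (cls n) (carrier (M n))"
proof (rule inj_onI)
  fix x y assume xy: "x \<in> carrier (M n)" "y \<in> carrier (M n)" "cls n x = cls n y"
  then obtain k where k: "n \<le> k" "tr n k x = tr n k y" using n by (auto simp: cls_eq_iff)
  have "tr n k x = tr n k y \<Longrightarrow> x = y" using k(1)
  proof (induction k rule: dec_induct)
    case (step k)
    thus ?case using inj_onD[OF inj[of k]] n xy(1,2) by (simp add: tr_Suc tr_closed)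
  qed simp
  thus "x = y" using k(2) .
qed

end


section \<open>Sequences and partial sums\<close>

lemma sequence_algebra_simps [simp]:
  "carrier (sequence_algebra M) = {1..} \<rightarrow>\<^sub>E carrier M"
  "mult (sequence_algebra M) = (\<lambda>s t. \<lambda>k\<in>{1..}. s k \<otimes>\<^bsub>M\<^esub> t k)"
  "one (sequence_algebra M) = (\<lambda>k\<in>{1..}. \<one>\<^bsub>M\<^esub>)"
  "zero (sequence_algebra M) = (\<lambda>k\<in>{1..}. \<zero>\<^bsub>M\<^esub>)"
  "add (sequence_algebra M) = (\<lambda>s t. \<lambda>k\<in>{1..}. s k \<oplus>\<^bsub>M\<^esub> t k)"
  "smult (sequence_algebra M) = (\<lambda>c s. \<lambda>k\<in>{1..}. c \<odot>\<^bsub>M\<^esub> s k)"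
  by (simp_all add: sequence_algebra_def)

context algebra
begin

lemma sequence_algebra_algebra: "algebra R (sequence_algebra M)"
proof -
  let ?S = "sequence_algebra M"
  have eqI: "s = t" if "s \<in> carrier ?S" "t \<in> carrier ?S" "\<And>k. 1 \<le> k \<Longrightarrow> s k = t k" for s t
    using that by (intro PiE_ext[of s "{1..}" "\<lambda>_. carrier M" t]) auto
  have mem: "s k \<in> carrier M" if "s \<in> carrier ?S" "1 \<le> k" for s k
    using that by (auto dest: PiE_mem)
  have "abelian_group ?S"
  proof (rule abelian_groupI)
    fix s assume s: "s \<in> carrier ?S"
    show "\<exists>t\<in>carrier ?S. t \<oplus>\<^bsub>?S\<^esub> s = \<zero>\<^bsub>?S\<^esub>"
      using mem[OF s] by (intro bexI[of _ "\<lambda>k\<in>{1..}. \<ominus>\<^bsub>M\<^esub> s k"]) (auto simp: fun_eq_iff M.l_neg)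
  qed (rule eqI; simp add: mem M.a_ac PiE_mem | force dest: PiE_mem)+
  moreover have "comm_monoid ?S"
    by (rule comm_monoidI) (rule eqI; simp add: mem m_ac PiE_mem | force dest: PiE_mem)+
  ultimately have "cring ?S"
    by (rule cringI) (rule eqI; force dest: PiE_mem simp: l_distr)
  thus ?thesis
  proof (rule algebraI[OF R_cring])
    fix a s assume a: "a \<in> carrier R" and s: "s \<in> carrier ?S"
    show as: "a \<odot>\<^bsub>?S\<^esub> s \<in> carrier ?S" using a mem[OF s] by simp
    fix b assume b: "b \<in> carrier R"
    have bs: "b \<odot>\<^bsub>?S\<^esub> s \<in> carrier ?S" using b mem[OF s] by simp
    show "(a \<oplus>\<^bsub>R\<^esub> b) \<odot>\<^bsub>?S\<^esub> s = a \<odot>\<^bsub>?S\<^esub> s \<oplus>\<^bsub>?S\<^esub> b \<odot>\<^bsub>?S\<^esub> s"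
      using a b mem[OF s] by (simp add: fun_eq_iff smult_l_distr)
    show "a \<otimes>\<^bsub>R\<^esub> b \<odot>\<^bsub>?S\<^esub> s = a \<odot>\<^bsub>?S\<^esub> (b \<odot>\<^bsub>?S\<^esub> s)"
      using a b mem[OF s] by (simp add: fun_eq_iff smult_assoc1)
  next
    fix s assume s: "s \<in> carrier ?S"
    show "\<one>\<^bsub>R\<^esub> \<odot>\<^bsub>?S\<^esub> s = s"
      by (rule eqI) (use s mem[OF s] in simp_all)
  next
    fix a s t assume a: "a \<in> carrier R" and s: "s \<in> carrier ?S" and t: "t \<in> carrier ?S"
    show "a \<odot>\<^bsub>?S\<^esub> (s \<oplus>\<^bsub>?S\<^esub> t) = a \<odot>\<^bsub>?S\<^esub> s \<oplus>\<^bsub>?S\<^esub> a \<odot>\<^bsub>?S\<^esub> t"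
      using a mem[OF s] mem[OF t] by (simp add: fun_eq_iff smult_r_distr)
    show "a \<odot>\<^bsub>?S\<^esub> s \<otimes>\<^bsub>?S\<^esub> t = a \<odot>\<^bsub>?S\<^esub> (s \<otimes>\<^bsub>?S\<^esub> t)"
      using a mem[OF s] mem[OF t] by (simp add: fun_eq_iff smult_assoc2)
  qed
qed

abbreviation psum :: "(nat \<Rightarrow> 'c) \<Rightarrow> nat \<Rightarrow> 'c"
  where "psum s k \<equiv> \<Oplus>\<^bsub>M\<^esub>i\<in>{1..<k}. s i"

lemma psum_closed: "(\<And>i. 1 \<le> i \<Longrightarrow> s i \<in> carrier M) \<Longrightarrow> psum s k \<in> carrier M"
  by (intro M.finsum_closed) auto

lemma psum_Suc:
  assumes "\<And>i. 1 \<le> i \<Longrightarrow> s i \<in> carrier M" "1 \<le> k"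
  shows "psum s (Suc k) = psum s k \<oplus>\<^bsub>M\<^esub> s k"
proof -
  have "{1..<Suc k} = insert k {1..<k}" using assms(2) by auto
  thus ?thesis using assms by (simp add: M.a_comm Pi_def)
qed

text \<open>
  Summation by parts: the pairs \<open>(i, j)\<close> with \<open>i, j < k\<close> are those with \<open>j < i\<close>, those with \<open>i < j\<close>
  and those with \<open>i = j\<close>.
\<close>

lemma psum_mult:
  assumes s: "\<And>i. 1 \<le> i \<Longrightarrow> s i \<in> carrier M" and t: "\<And>i. 1 \<le> i \<Longrightarrow> t i \<in> carrier M" and k: "1 \<le> k"
  shows "psum s k \<otimes>\<^bsub>M\<^esub> psum t k
    = psum (\<lambda>i. s i \<otimes>\<^bsub>M\<^esub> psum t i) k \<oplus>\<^bsub>M\<^esub> psum (\<lambda>i. t i \<otimes>\<^bsub>M\<^esub> psum s i) k \<oplus>\<^bsub>M\<^esub> psum (\<lambda>i. s i \<otimes>\<^bsub>M\<^esub> t i) k"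
  using k
proof (induction k rule: dec_induct)
  case base thus ?case by simp
next
  case (step k)
  note k = \<open>1 \<le> k\<close>
  note st = s[OF k] t[OF k] psum_closed[OF s] psum_closed[OF t]
  define a b c where "a = psum (\<lambda>i. s i \<otimes>\<^bsub>M\<^esub> psum t i) k" and "b = psum (\<lambda>i. t i \<otimes>\<^bsub>M\<^esub> psum s i) k"
    and "c = psum (\<lambda>i. s i \<otimes>\<^bsub>M\<^esub> t i) k"
  have abc: "a \<in> carrier M" "b \<in> carrier M" "c \<in> carrier M"
    unfolding a_def b_def c_def by (intro psum_closed m_closed s t; assumption)+
  have "psum s (Suc k) \<otimes>\<^bsub>M\<^esub> psum t (Suc k) = (psum s k \<oplus>\<^bsub>M\<^esub> s k) \<otimes>\<^bsub>M\<^esub> (psum t k \<oplus>\<^bsub>M\<^esub> t k)"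
    using s t k by (simp only: psum_Suc)
  also have "\<dots> = (psum s k \<otimes>\<^bsub>M\<^esub> psum t k \<oplus>\<^bsub>M\<^esub> s k \<otimes>\<^bsub>M\<^esub> psum t k)
      \<oplus>\<^bsub>M\<^esub> (t k \<otimes>\<^bsub>M\<^esub> psum s k \<oplus>\<^bsub>M\<^esub> s k \<otimes>\<^bsub>M\<^esub> t k)"
    using st by (simp add: l_distr r_distr m_comm)
  also have "\<dots> = (a \<oplus>\<^bsub>M\<^esub> s k \<otimes>\<^bsub>M\<^esub> psum t k) \<oplus>\<^bsub>M\<^esub> (b \<oplus>\<^bsub>M\<^esub> t k \<otimes>\<^bsub>M\<^esub> psum s k) \<oplus>\<^bsub>M\<^esub> (c \<oplus>\<^bsub>M\<^esub> s k \<otimes>\<^bsub>M\<^esub> t k)"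
    using st abc unfolding step.IH a_def[symmetric] b_def[symmetric] c_def[symmetric] by (simp add: M.a_ac)
  finally show ?case
    unfolding a_def b_def c_def using s t k by (simp only: psum_Suc psum_closed m_closed)
qed

text \<open>
  At each place the Baxter identity is \<open>psum_mult\<close> multiplied by the square of the weight.
\<close>

lemma partial_sum_operator_baxter:
  assumes lam: "lam \<in> carrier R"
  shows "baxter_algebra R lam (sequence_algebra M) (partial_sum_operator lam M)"
proof -
  let ?S = "sequence_algebra M" and ?P = "partial_sum_operator lam M"
  interpret S: algebra R ?S by (rule sequence_algebra_algebra)
  have mem: "s k \<in> carrier M" if "s \<in> carrier ?S" "1 \<le> k" for s k
    using that by (auto dest: PiE_mem)
  have Pk: "?P s k = lam \<odot>\<^bsub>M\<^esub> psum s k" if "1 \<le> k" for s k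
    using that by (simp add: partial_sum_operator_def)
  have P: "?P s \<in> carrier ?S" if "s \<in> carrier ?S" for s
  proof -
    have "lam \<odot>\<^bsub>M\<^esub> psum s k \<in> carrier M" for k
      by (intro smult_closed lam psum_closed mem[OF that])
    thus ?thesis by (simp add: partial_sum_operator_def)
  qed
  have eqI: "s = t" if "s \<in> carrier ?S" "t \<in> carrier ?S" "\<And>k. 1 \<le> k \<Longrightarrow> s k = t k" for s t
    using that by (intro PiE_ext[of s "{1..}" "\<lambda>_. carrier M" t]) auto
  have cong: "psum f k = psum g k"
    if "\<And>i. 1 \<le> i \<Longrightarrow> f i = g i" "\<And>i. 1 \<le> i \<Longrightarrow> g i \<in> carrier M" for f g and k :: nat
    using that by (intro M.finsum_cong') auto
  show ?thesis
  proof (intro baxter_algebra.intro baxter_algebra_axioms.intro S.algebra_axioms lam P)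
    fix s t assume s: "s \<in> carrier ?S" and t: "t \<in> carrier ?S"
    note st = mem[OF s] mem[OF t]
    show "?P (s \<oplus>\<^bsub>?S\<^esub> t) = ?P s \<oplus>\<^bsub>?S\<^esub> ?P t"
    proof (rule eqI)
      fix k :: nat assume k: "1 \<le> k"
      have "psum (s \<oplus>\<^bsub>?S\<^esub> t) k = psum (\<lambda>i. s i \<oplus>\<^bsub>M\<^esub> t i) k"
        by (rule cong) (simp_all add: st)
      also have "\<dots> = psum s k \<oplus>\<^bsub>M\<^esub> psum t k"
        by (rule M.finsum_addf) (auto intro: st)
      finally show "?P (s \<oplus>\<^bsub>?S\<^esub> t) k = (?P s \<oplus>\<^bsub>?S\<^esub> ?P t) k"
        using k lam psum_closed[of s, OF mem[OF s]] psum_closed[of t, OF mem[OF t]]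
        by (simp add: Pk smult_r_distr)
    qed (intro P S.M.a_closed s t)+
    show "?P s \<otimes>\<^bsub>?S\<^esub> ?P t = ?P (s \<otimes>\<^bsub>?S\<^esub> ?P t) \<oplus>\<^bsub>?S\<^esub> ?P (t \<otimes>\<^bsub>?S\<^esub> ?P s) \<oplus>\<^bsub>?S\<^esub> lam \<odot>\<^bsub>?S\<^esub> ?P (s \<otimes>\<^bsub>?S\<^esub> t)"
    proof (rule eqI)
      fix k :: nat assume k: "1 \<le> k"
      note cl = psum_closed[OF mem[OF s]] psum_closed[OF mem[OF t]]
      define a b c where "a = psum (\<lambda>i. s i \<otimes>\<^bsub>M\<^esub> psum t i) k" and "b = psum (\<lambda>i. t i \<otimes>\<^bsub>M\<^esub> psum s i) k"
        and "c = psum (\<lambda>i. s i \<otimes>\<^bsub>M\<^esub> t i) k"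
      have abc: "a \<in> carrier M" "b \<in> carrier M" "c \<in> carrier M"
        unfolding a_def b_def c_def by (intro psum_closed m_closed st; assumption)+
      have scale: "psum (\<lambda>i. lam \<odot>\<^bsub>M\<^esub> f i) k = lam \<odot>\<^bsub>M\<^esub> psum f k"
        if "\<And>i. 1 \<le> i \<Longrightarrow> f i \<in> carrier M" for f
        using that lam by (intro finsum_smult_ldistr[symmetric]) auto
      have "psum (s \<otimes>\<^bsub>?S\<^esub> ?P t) k = psum (\<lambda>i. lam \<odot>\<^bsub>M\<^esub> (s i \<otimes>\<^bsub>M\<^esub> psum t i)) k"
        by (rule cong) (simp_all add: st cl lam Pk smult_assoc2_right del: One_nat_def)
      hence 1: "psum (s \<otimes>\<^bsub>?S\<^esub> ?P t) k = lam \<odot>\<^bsub>M\<^esub> a"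
        using scale[of "\<lambda>i. s i \<otimes>\<^bsub>M\<^esub> psum t i"] st cl by (simp add: a_def)
      have "psum (t \<otimes>\<^bsub>?S\<^esub> ?P s) k = psum (\<lambda>i. lam \<odot>\<^bsub>M\<^esub> (t i \<otimes>\<^bsub>M\<^esub> psum s i)) k"
        by (rule cong) (simp_all add: st cl lam Pk smult_assoc2_right del: One_nat_def)
      hence 2: "psum (t \<otimes>\<^bsub>?S\<^esub> ?P s) k = lam \<odot>\<^bsub>M\<^esub> b"
        using scale[of "\<lambda>i. t i \<otimes>\<^bsub>M\<^esub> psum s i"] st cl by (simp add: b_def)
      have 3: "psum (s \<otimes>\<^bsub>?S\<^esub> t) k = c"
        unfolding c_def by (rule cong) (simp_all add: st)
      have "?P s k \<otimes>\<^bsub>M\<^esub> ?P t k = lam \<odot>\<^bsub>M\<^esub> (lam \<odot>\<^bsub>M\<^esub> (psum s k \<otimes>\<^bsub>M\<^esub> psum t k))"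
        using k lam cl by (simp add: Pk smult_assoc2 smult_assoc2_right del: One_nat_def)
      also have "psum s k \<otimes>\<^bsub>M\<^esub> psum t k = a \<oplus>\<^bsub>M\<^esub> b \<oplus>\<^bsub>M\<^esub> c"
        unfolding a_def b_def c_def by (rule psum_mult[OF mem[OF s] mem[OF t] k])
      also have "lam \<odot>\<^bsub>M\<^esub> (lam \<odot>\<^bsub>M\<^esub> (a \<oplus>\<^bsub>M\<^esub> b \<oplus>\<^bsub>M\<^esub> c))
          = lam \<odot>\<^bsub>M\<^esub> (lam \<odot>\<^bsub>M\<^esub> a) \<oplus>\<^bsub>M\<^esub> lam \<odot>\<^bsub>M\<^esub> (lam \<odot>\<^bsub>M\<^esub> b) \<oplus>\<^bsub>M\<^esub> lam \<odot>\<^bsub>M\<^esub> (lam \<odot>\<^bsub>M\<^esub> c)"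
        using lam abc by (simp add: smult_r_distr)
      also have "\<dots> = (?P (s \<otimes>\<^bsub>?S\<^esub> ?P t) \<oplus>\<^bsub>?S\<^esub> ?P (t \<otimes>\<^bsub>?S\<^esub> ?P s) \<oplus>\<^bsub>?S\<^esub> lam \<odot>\<^bsub>?S\<^esub> ?P (s \<otimes>\<^bsub>?S\<^esub> t)) k"
      proof -
        have "(x \<oplus>\<^bsub>?S\<^esub> y \<oplus>\<^bsub>?S\<^esub> lam \<odot>\<^bsub>?S\<^esub> z) k = x k \<oplus>\<^bsub>M\<^esub> y k \<oplus>\<^bsub>M\<^esub> lam \<odot>\<^bsub>M\<^esub> z k" for x y z
          using k by simp
        thus ?thesis by (simp only: Pk[OF k] 1 2 3)
      qed
      finally show "(?P s \<otimes>\<^bsub>?S\<^esub> ?P t) k = \<dots>" using k by simp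
    qed (intro P S.M.a_closed S.m_closed S.smult_closed s t lam)+
  next
    fix c s assume c: "c \<in> carrier R" and s: "s \<in> carrier ?S"
    show "?P (c \<odot>\<^bsub>?S\<^esub> s) = c \<odot>\<^bsub>?S\<^esub> ?P s"
    proof (rule eqI)
      fix k :: nat assume k: "1 \<le> k"
      have "psum (c \<odot>\<^bsub>?S\<^esub> s) k = psum (\<lambda>i. c \<odot>\<^bsub>M\<^esub> s i) k"
        by (rule cong) (simp_all add: mem[OF s] c)
      also have "\<dots> = c \<odot>\<^bsub>M\<^esub> psum s k"
        by (rule finsum_smult_ldistr[symmetric]) (auto intro: mem[OF s] c)
      finally show "?P (c \<odot>\<^bsub>?S\<^esub> s) k = (c \<odot>\<^bsub>?S\<^esub> ?P s) k"
        using k linear_smult[OF smult_linear[OF lam] c psum_closed[of s, OF mem[OF s]]] by (simp add: Pk)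
    qed (intro P S.smult_closed s c)+
  qed
qed

end


section \<open>The recursion for mixable shuffles\<close>

text \<open>
  A pair \<open>(j, w)\<close> stands for the word \<open>w\<close> of a mixable shuffle in which \<open>j\<close> pairs of letters were
  multiplied, so that its coefficient in the product is the \<open>j\<close>-th power of the weight.
\<close>

fun quasi_shuffles :: "('a, 'm) ring_scheme \<Rightarrow> 'a list \<Rightarrow> 'a list \<Rightarrow> (nat \<times> 'a list) list"
  where
    "quasi_shuffles A [] y = [(0, y)]"
  | "quasi_shuffles A (a # x) [] = [(0, a # x)]"
  | "quasi_shuffles A (a # x) (b # y) =
      map (\<lambda>(j, w). (j, a # w)) (quasi_shuffles A x (b # y))
      @ map (\<lambda>(j, w). (j, b # w)) (quasi_shuffles A (a # x) y)
      @ map (\<lambda>(j, w). (Suc j, (a \<otimes>\<^bsub>A\<^esub> b) # w)) (quasi_shuffles A x y)"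

text \<open>
  A shuffle is determined by the places that receive letters of the first word, marked \<open>True\<close>; the
  pairs that may be merged are then the places where \<open>True\<close> is followed by \<open>False\<close>.  In the
  following definitions \<open>k\<close> is the position of the first letter, as in \<open>merge_at\<close>.
\<close>

definition patterns :: "nat \<Rightarrow> nat \<Rightarrow> bool list set"
  where "patterns m n = {p. length p = m + n \<and> count_list p True = m}"

fun weave :: "bool list \<Rightarrow> 'a list \<Rightarrow> 'a list \<Rightarrow> 'a list"
  where
    "weave [] x y = []"
  | "weave (True # p) x y = hd x # weave p (tl x) y"
  | "weave (False # p) x y = hd y # weave p x (tl y)"

fun descents :: "nat \<Rightarrow> bool list \<Rightarrow> (nat \<times> nat) set"
  where
    "descents k (True # False # p) = insert (k, k + 1) (descents (k + 2) p)"
  | "descents k (_ # p) = descents (k + 1) p"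
  | "descents k [] = {}"

lemma descents_ge: "(i, j) \<in> descents k p \<Longrightarrow> k \<le> i"
  by (induction k p rule: descents.induct) auto

lemma finite_descents: "finite (descents k p)"
  by (induction k p rule: descents.induct) auto

lemma descents_Cons:
  "descents k (b # p) = (if b \<and> p \<noteq> [] \<and> \<not> hd p then {(k, k + 1)} else {}) \<union> descents (k + 1) p"
  by (cases b; cases p rule: list.exhaust; cases "hd p") auto

lemma descents_eq:
  "descents k p = {(k + i, k + i + 1) | i. i + 1 < length p \<and> p ! i \<and> \<not> p ! (i + 1)}"
proof (induction p arbitrary: k)
  case (Cons b p)
  have split: "(\<exists>i. P i) \<longleftrightarrow> P 0 \<or> (\<exists>i. P (Suc i))" for P :: "nat \<Rightarrow> bool"
    by (metis not0_implies_Suc)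
  have "{(k + i, k + i + 1) | i. i + 1 < length (b # p) \<and> (b # p) ! i \<and> \<not> (b # p) ! (i + 1)}
      = (if b \<and> p \<noteq> [] \<and> \<not> hd p then {(k, k + 1)} else {})
        \<union> {(k + 1 + i, k + 1 + i + 1) | i. i + 1 < length p \<and> p ! i \<and> \<not> p ! (i + 1)}"
    by (subst split) (auto simp: hd_conv_nth)
  thus ?case by (simp only: descents_Cons Cons.IH)
qed simp

fun mixings :: "nat \<Rightarrow> nat \<Rightarrow> nat \<Rightarrow> (bool list \<times> (nat \<times> nat) set) list"
  where
    "mixings k 0 n = [(replicate n False, {})]"
  | "mixings k (Suc m) 0 = [(replicate (Suc m) True, {})]"
  | "mixings k (Suc m) (Suc n) =
      map (\<lambda>(p, T). (True # p, T)) (mixings (k + 1) m (Suc n))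
      @ map (\<lambda>(p, T). (False # p, T)) (mixings (k + 1) (Suc m) n)
      @ map (\<lambda>(p, T). (True # False # p, insert (k, k + 1) T)) (mixings (k + 2) m n)"

lemma count_bool: "count_list p True + count_list p False = length p"
  by (induction p) auto

lemma patterns_0: "patterns 0 n = {replicate n False}"
  by (auto simp: patterns_def count_list_0_iff intro!: replicate_eqI)

lemma patterns_0': "patterns m 0 = {replicate m True}"
proof (intro equalityI subsetI)
  fix p assume "p \<in> patterns m 0"
  hence "count_list p False = 0" "length p = m" using count_bool[of p] by (auto simp: patterns_def)
  hence "y = True" if "y \<in> set p" for y using that by (cases y) (auto simp: count_list_0_iff)
  hence "p = replicate (length p) True" by (intro replicate_eqI) auto
  thus "p \<in> {replicate m True}" using \<open>length p = m\<close> by simp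
qed (use count_bool[of "replicate m True"] in \<open>simp add: patterns_def count_list_0_iff\<close>)

lemma patterns_Suc:
  "patterns (Suc m) (Suc n) = (#) True ` patterns m (Suc n) \<union> (#) False ` patterns (Suc m) n"
proof (intro equalityI subsetI)
  fix p assume p: "p \<in> patterns (Suc m) (Suc n)"
  then obtain b p' where "p = b # p'" by (cases p) (auto simp: patterns_def)
  thus "p \<in> (#) True ` patterns m (Suc n) \<union> (#) False ` patterns (Suc m) n"
    using p by (cases b) (auto simp: patterns_def)
qed (auto simp: patterns_def)

lemma descents_replicate [simp]: "descents k (replicate n b) = {}"
  by (auto simp: descents_eq)

text \<open>
  The third group of \<open>mixings\<close> consists of the pairs whose first two letters are merged: these are the
  pairs with \<open>(k, k + 1) \<in> T\<close>, since all later merges have positions above \<open>k\<close>.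
\<close>

lemma set_mixings: "set (mixings k m n) = {(p, T). p \<in> patterns m n \<and> T \<subseteq> descents k p}"
proof (induction k m n rule: mixings.induct)
  case (3 k m n)
  note IH = 3[unfolded Suc_eq_plus1[symmetric] add_2_eq_Suc']
  show ?case
  proof (intro equalityI subsetI; clarify)
    fix p T assume "(p, T) \<in> set (mixings k (Suc m) (Suc n))"
    thus "p \<in> patterns (Suc m) (Suc n) \<and> T \<subseteq> descents k p"
      by (auto simp: IH patterns_Suc descents_Cons patterns_def split: if_splits)
  next
    fix p T assume p: "p \<in> patterns (Suc m) (Suc n)" and T: "T \<subseteq> descents k p"
    show "(p, T) \<in> set (mixings k (Suc m) (Suc n))"
    proof (cases "(k, k + 1) \<in> T")
      case True
      hence "(k, k + 1) \<in> descents k p" using T by blast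
      then obtain p' where p': "p = True # False # p'"
        using descents_ge[of k "k + 1" "k + 1"] by (cases "(k, p)" rule: descents.cases) auto
      have "T - {(k, k + 1)} \<subseteq> descents (k + 2) p'" using T p' by auto
      moreover have "p' \<in> patterns m n" using p by (auto simp: p' patterns_def)
      ultimately have mem: "(p', T - {(k, k + 1)}) \<in> set (mixings (k + 2) m n)" by (simp add: IH)
      have "(True # False # p', insert (k, k + 1) (T - {(k, k + 1)})) \<in> set (mixings k (Suc m) (Suc n))"
        unfolding mixings.simps set_append set_map by (intro UnI2 image_eqI[OF _ mem]) simp
      thus ?thesis using True by (simp add: p' insert_absorb)
    next
      case False
      from p obtain b p' where p': "p = b # p'" by (cases p) (auto simp: patterns_def)
      have "T \<subseteq> descents (k + 1) p'" using T False by (auto simp: p' descents_Cons split: if_splits)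
      thus ?thesis using p IH(1,2) by (cases b) (force simp: p' patterns_Suc)+
    qed
  qed
qed (auto simp: patterns_0 patterns_0' simp del: replicate_Suc)

lemma distinct_mixings: "distinct (mixings k m n)"
proof (induction k m n rule: mixings.induct)
  case (3 k m n)
  have T: "(k, k + 1) \<notin> T" if "(p, T) \<in> set (mixings l m' n')" "l > k" for p T l m' n'
    using that descents_ge[of k "k + 1" l p] by (auto simp: set_mixings)
  have "inj_on (\<lambda>(p, T). (True # False # p, insert (k, k + 1) T)) (set (mixings (k + 2) m n))"
    by (rule inj_onI) (use T[of _ _ "k + 2"] in \<open>clarsimp, metis insert_ident lessI less_SucI\<close>)
  moreover have "inj_on (\<lambda>(p, T). (b # p, T)) S" for b and S :: "(bool list \<times> (nat \<times> nat) set) set"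
    by (auto simp: inj_on_def)
  ultimately show ?case using 3 by (auto simp: distinct_map dest: T[of _ _ "Suc k"])
qed simp_all

lemma merge_at_skip: "(k, k + 1) \<notin> T \<Longrightarrow> merge_at A T k (u # w) = u # merge_at A T (k + 1) w"
  by (cases w) auto

lemma merge_at_cong:
  "(\<And>i. k \<le> i \<Longrightarrow> (i, i + 1) \<in> T \<longleftrightarrow> (i, i + 1) \<in> T') \<Longrightarrow> merge_at A T k w = merge_at A T' k w"
  by (induction A T k w rule: merge_at.induct) auto

lemma merge_at_empty: "merge_at A {} k w = w"
  by (induction A "{} :: (nat \<times> nat) set" k w rule: merge_at.induct) auto

lemma weave_replicate: "weave (replicate (length y) False) x y = y" "weave (replicate (length x) True) x y = x"
proof -
  show "weave (replicate (length y) False) x y = y" by (induction y) auto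
  show "weave (replicate (length x) True) x y = x" by (induction x) auto
qed

text \<open>
  After the letters in positions \<open>k\<close> and \<open>k + 1\<close> have been merged, the product cannot be merged
  further to the right: position \<open>k + 1\<close> holds a letter of the second word and starts no admissible
  pair.  So the remaining word is treated independently of what precedes it.
\<close>

lemma map_mixings:
  "map (\<lambda>(p, T). (card T, merge_at A T k (weave p x y))) (mixings k (length x) (length y))
    = quasi_shuffles A x y"
proof (induction A x y arbitrary: k rule: quasi_shuffles.induct)
  case (1 A y)
  show ?case by (simp add: weave_replicate merge_at_empty)
next
  case (2 A a x)
  show ?case using weave_replicate(2)[of "a # x" "[]"] by (simp add: merge_at_empty)
next
  case (3 A a x b y)
  let ?f = "\<lambda>k x y (p, T). (card T, merge_at A T k (weave p x y))"
  have ge: "k \<le> i" if "(p, T) \<in> set (mixings k m n)" "(i, j) \<in> T" for k m n p T i j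
    using that descents_ge by (auto simp: set_mixings)
  have fin: "finite T" if "(p, T) \<in> set (mixings k m n)" for k m n p T
    using that finite_descents finite_subset by (auto simp: set_mixings)
  have skip: "merge_at A T k (u # w) = u # merge_at A T (k + 1) w" if "(p, T) \<in> set (mixings (k + 1) m n)" for p T u w m n
    using ge[OF that, of k "k + 1"] by (intro merge_at_skip) auto
  have 1: "map (?f k (a # x) (b # y)) (map (\<lambda>(p, T). (True # p, T)) (mixings (k + 1) (length x) (Suc (length y))))
    = map (\<lambda>(j, w). (j, a # w)) (quasi_shuffles A x (b # y))"
    unfolding 3(1)[of "k + 1", symmetric] by (auto simp: skip)
  have 2: "map (?f k (a # x) (b # y)) (map (\<lambda>(p, T). (False # p, T)) (mixings (k + 1) (Suc (length x)) (length y)))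
    = map (\<lambda>(j, w). (j, b # w)) (quasi_shuffles A (a # x) y)"
    unfolding 3(2)[of "k + 1", symmetric] by (auto simp: skip)
  have mix: "card (insert (k, k + 1) T) = Suc (card T)"
    "merge_at A (insert (k, k + 1) T) k (u # v # w) = (u \<otimes>\<^bsub>A\<^esub> v) # merge_at A T (k + 2) w"
    if "(p, T) \<in> set (mixings (k + 2) m n)" for p T m n u v w
  proof -
    note g = ge[OF that]
    show "card (insert (k, k + 1) T) = Suc (card T)"
      using g[of k "k + 1"] fin[OF that] by (subst card_insert_disjoint) auto
    have "merge_at A (insert (k, k + 1) T) k (u # v # w) = merge_at A (insert (k, k + 1) T) (k + 1) ((u \<otimes>\<^bsub>A\<^esub> v) # w)"
      by simp
    also have "\<dots> = (u \<otimes>\<^bsub>A\<^esub> v) # merge_at A (insert (k, k + 1) T) (k + 1 + 1) w"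
      using g[of "k + 1" "k + 2"] by (intro merge_at_skip) auto
    also have "merge_at A (insert (k, k + 1) T) (k + 1 + 1) w = merge_at A T (k + 1 + 1) w"
      by (rule merge_at_cong) auto
    finally show "merge_at A (insert (k, k + 1) T) k (u # v # w) = (u \<otimes>\<^bsub>A\<^esub> v) # merge_at A T (k + 2) w" by simp
  qed
  have 3: "map (?f k (a # x) (b # y)) (map (\<lambda>(p, T). (True # False # p, insert (k, k + 1) T)) (mixings (k + 2) (length x) (length y)))
    = map (\<lambda>(j, w). (Suc j, (a \<otimes>\<^bsub>A\<^esub> b) # w)) (quasi_shuffles A x y)"
    unfolding 3(3)[of "k + 2", symmetric]
    by (auto simp: mix[unfolded add_2_eq_Suc' Suc_eq_plus1[symmetric]] simp del: merge_at.simps)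
  show ?case
    unfolding quasi_shuffles.simps length_Cons mixings.simps map_append 1 2 3 ..
qed

definition pattern_of :: "nat \<Rightarrow> nat \<Rightarrow> (nat \<Rightarrow> nat) \<Rightarrow> bool list"
  where "pattern_of m n \<sigma> = map (\<lambda>k. \<sigma> k \<le> m) [1..<m + n + 1]"

lemma pattern_of_nth: "k < m + n \<Longrightarrow> pattern_of m n \<sigma> ! k \<longleftrightarrow> \<sigma> (Suc k) \<le> m"
proof -
  assume k: "k < m + n"
  hence "[1..<m + n + 1] ! k = Suc k" by (subst nth_upt) auto
  thus ?thesis using k by (simp add: pattern_of_def del: upt_Suc)
qed

lemma length_pattern_of [simp]: "length (pattern_of m n \<sigma>) = m + n"
  by (simp add: pattern_of_def del: upt_Suc)

lemma count_take_Suc: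
  "k < length p \<Longrightarrow> count_list (take (Suc k) p) b = count_list (take k p) b + (if p ! k = b then 1 else 0)"
  by (simp add: take_Suc_conv_app_nth)

lemma count_take_card:
  "k \<le> m + n \<Longrightarrow> count_list (take k (pattern_of m n \<sigma>)) b = card {i \<in> {1..k}. (\<sigma> i \<le> m) = b}"
proof (induction k)
  case (Suc k)
  have "{i \<in> {1..Suc k}. (\<sigma> i \<le> m) = b} = {i \<in> {1..k}. (\<sigma> i \<le> m) = b} \<union> (if (\<sigma> (Suc k) \<le> m) = b then {Suc k} else {})"
    by (auto simp: le_Suc_eq)
  thus ?case using Suc by (auto simp: count_take_Suc pattern_of_nth)
qed simp

text \<open>
  The inverse of a shuffle is increasing on each of the two blocks, so \<open>\<sigma> k\<close> is, up to the offset of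
  its block, the number of places up to \<open>k\<close> that are filled from the same block.  In particular the
  pattern determines the shuffle.
\<close>

lemma shuffle_value:
  assumes "\<sigma> \<in> shuffle_perms m n" "1 \<le> k" "k \<le> m + n"
  shows "\<sigma> k = (if \<sigma> k \<le> m then count_list (take k (pattern_of m n \<sigma>)) True
     else m + count_list (take k (pattern_of m n \<sigma>)) False)"
proof -
  define \<tau> where "\<tau> = inv_into UNIV \<sigma>"
  have perm: "\<sigma> permutes {1..m + n}" and mono: "strict_mono_on {1..m} \<tau>" "strict_mono_on {m + 1..m + n} \<tau>"
    using assms by (auto simp: shuffle_perms_def \<tau>_def)
  have inv: "\<sigma> (\<tau> i) = i" "\<tau> (\<sigma> i) = i" for i
    using permutes_inverses[OF perm] by (simp_all add: \<tau>_def)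
  have rng: "\<sigma> i \<in> {1..m + n} \<longleftrightarrow> i \<in> {1..m + n}" "\<tau> i \<in> {1..m + n} \<longleftrightarrow> i \<in> {1..m + n}" for i
    using permutes_in_image[OF perm] permutes_in_image[OF permutes_inv[OF perm]] by (auto simp: \<tau>_def)
  have k: "\<sigma> k \<in> {1..m + n}" using rng(1)[of k] assms by auto
  have count: "card {i \<in> {1..k}. \<sigma> i \<in> {l..u}} = \<sigma> k + 1 - l"
    if mono: "strict_mono_on {l..u} \<tau>" and lu: "{l..u} \<subseteq> {1..m + n}" "\<sigma> k \<in> {l..u}" for l u
  proof -
    have le: "\<tau> i \<le> \<tau> j \<longleftrightarrow> i \<le> j" if "i \<in> {l..u}" "j \<in> {l..u}" for i j
      using that strict_mono_on_leD[OF mono] inv(1) by (metis le_antisym nle_le)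
    have "{i \<in> {1..k}. \<sigma> i \<in> {l..u}} = \<tau> ` {l..\<sigma> k}"
    proof (intro equalityI subsetI)
      fix i assume i: "i \<in> {i \<in> {1..k}. \<sigma> i \<in> {l..u}}"
      hence "\<sigma> i \<le> \<sigma> k" using le[of "\<sigma> i" "\<sigma> k"] lu(2) by (simp add: inv)
      thus "i \<in> \<tau> ` {l..\<sigma> k}" using i by (intro image_eqI[of _ _ "\<sigma> i"]) (auto simp: inv)
    next
      fix i assume "i \<in> \<tau> ` {l..\<sigma> k}"
      then obtain j where j: "i = \<tau> j" "j \<in> {l..u}" "j \<le> \<sigma> k" using lu(2) by auto
      moreover have "\<tau> j \<le> k" using le[of j "\<sigma> k"] j lu(2) by (simp add: inv)
      moreover have "1 \<le> \<tau> j" using rng(2)[of j] j lu(1) by auto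
      ultimately show "i \<in> {i \<in> {1..k}. \<sigma> i \<in> {l..u}}" by (simp add: inv)
    qed
    moreover have "inj_on \<tau> {l..\<sigma> k}" using inv(1) by (metis inj_onI)
    ultimately show ?thesis by (simp add: card_image)
  qed
  have \<sigma>: "\<sigma> i \<in> {1..m + n}" if "i \<in> {1..k}" for i using rng(1)[of i] that assms by auto
  show ?thesis
  proof (cases "\<sigma> k \<le> m")
    case True
    have "{i \<in> {1..k}. (\<sigma> i \<le> m) = True} = {i \<in> {1..k}. \<sigma> i \<in> {1..m}}" using \<sigma> by fastforce
    thus ?thesis using True assms count[OF mono(1)] k by (simp add: count_take_card)
  next
    case False
    have "{i \<in> {1..k}. (\<sigma> i \<le> m) = False} = {i \<in> {1..k}. \<sigma> i \<in> {m + 1..m + n}}" using \<sigma> by fastforce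
    thus ?thesis using False assms count[OF mono(2)] k by (simp add: count_take_card)
  qed
qed

lemma count_take_mono: "i \<le> j \<Longrightarrow> count_list (take i p) b \<le> count_list (take j p) b"
  using count_list_append[of "take i p" "take (j - i) (drop i p)" b]
  by (simp flip: take_add)

text \<open>
  Conversely the rule of \<open>shuffle_value\<close> makes a shuffle of any pattern: it is the map \<open>g\<close> below.
\<close>

lemma pattern_of_bij: "bij_betw (pattern_of m n) (shuffle_perms m n) (patterns m n)"
proof (rule bij_betw_imageI)
  show "inj_on (pattern_of m n) (shuffle_perms m n)"
  proof (rule inj_onI, rule ext)
    fix \<sigma> \<rho> k assume s: "\<sigma> \<in> shuffle_perms m n" "\<rho> \<in> shuffle_perms m n" and e: "pattern_of m n \<sigma> = pattern_of m n \<rho>"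
    show "\<sigma> k = \<rho> k"
    proof (cases "k \<in> {1..m + n}")
      case True
      have "\<sigma> k \<le> m \<longleftrightarrow> \<rho> k \<le> m"
        using True pattern_of_nth[of "k - 1" m n \<sigma>] pattern_of_nth[of "k - 1" m n \<rho>] e by auto
      thus ?thesis using shuffle_value[OF s(1), of k] shuffle_value[OF s(2), of k] True e by auto
    next
      case False
      have "\<sigma> permutes {1..m + n}" "\<rho> permutes {1..m + n}" using s by (auto simp: shuffle_perms_def)
      thus ?thesis using False by (metis permutes_not_in)
    qed
  qed
  show "pattern_of m n ` shuffle_perms m n = patterns m n"
  proof (intro equalityI subsetI)
    fix p assume "p \<in> pattern_of m n ` shuffle_perms m n"
    then obtain \<sigma> where p: "p = pattern_of m n \<sigma>" and "\<sigma> permutes {1..m + n}" by (auto simp: shuffle_perms_def)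
    hence "\<sigma> ` {i \<in> {1..m + n}. (\<sigma> i \<le> m) = True} = {1..m}"
      using permutes_image[of \<sigma> "{1..m + n}"] by fastforce
    moreover have "inj_on \<sigma> S" for S using permutes_inj[OF \<open>\<sigma> permutes _\<close>] by (metis inj_on_subset subset_UNIV)
    ultimately have "card {i \<in> {1..m + n}. (\<sigma> i \<le> m) = True} = m"
      using card_image[of \<sigma> "{i \<in> {1..m + n}. (\<sigma> i \<le> m) = True}"] by simp
    thus "p \<in> patterns m n" using count_take_card[of "m + n" m n \<sigma> True] by (simp add: patterns_def p)
  next
    fix p assume "p \<in> patterns m n"
    hence len: "length p = m + n" and cT: "count_list p True = m" and cF: "count_list p False = n"
      using count_bool[of p] by (auto simp: patterns_def)
    define c where "c b k = count_list (take k p) b" for b k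
    have c_le: "c True k \<le> m" "c False k \<le> n" for k
      using count_take_mono[of k "max k (length p)" p] cT cF by (auto simp: c_def)
    have c_mono: "i \<le> j \<Longrightarrow> c b i \<le> c b j" for i j b by (simp add: c_def count_take_mono)
    have c_Suc: "c b (Suc k) = c b k + (if p ! k = b then 1 else 0)" if "k < m + n" for k b
      using that by (simp add: c_def count_take_Suc len)
    define g where "g k = (if k \<in> {1..m + n} then (if p ! (k - 1) then c True k else m + c False k) else k)" for k
    have g_le: "g k \<le> m \<longleftrightarrow> p ! (k - 1)" if "k \<in> {1..m + n}" for k
      using that c_le c_Suc[of "k - 1" False] by (auto simp: g_def)
    have g_less: "g i < g j" if "i \<in> {1..m + n}" "j \<in> {1..m + n}" "i < j" "p ! (i - 1) = p ! (j - 1)" for i j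
      using that c_mono[of i "j - 1"] c_Suc[of "j - 1"] by (auto simp: g_def less_Suc_eq_le)
    have "bij_betw g {1..m + n} {1..m + n}"
    proof (intro bij_betw_imageI)
      have inj: "inj_on g {1..m + n}"
      proof (rule inj_onI)
        fix i j assume ij: "i \<in> {1..m + n}" "j \<in> {1..m + n}" "g i = g j"
        thus "i = j" using g_le[of i] g_le[of j] g_less[of i j] g_less[of j i] by (cases i j rule: linorder_cases) auto
      qed
      moreover have "g ` {1..m + n} \<subseteq> {1..m + n}"
      proof (intro image_subsetI)
        fix k assume "k \<in> {1..m + n}"
        thus "g k \<in> {1..m + n}"
          using c_le[of k] c_Suc[of "k - 1" True] c_Suc[of "k - 1" False] by (auto simp: g_def)
      qed
      ultimately show "g ` {1..m + n} = {1..m + n}"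
        by (intro card_subset_eq) (simp_all add: card_image)
      show "inj_on g {1..m + n}" by (rule inj)
    qed
    hence perm: "g permutes {1..m + n}" by (rule bij_imp_permutes) (auto simp: g_def)
    define \<tau> where "\<tau> = inv_into UNIV g"
    have inv: "g (\<tau> i) = i" for i using permutes_inverses[OF perm] by (simp add: \<tau>_def)
    have rng: "\<tau> i \<in> {1..m + n} \<longleftrightarrow> i \<in> {1..m + n}" for i
      using permutes_in_image[OF permutes_inv[OF perm]] by (auto simp: \<tau>_def)
    have mono: "\<tau> i < \<tau> j" if "{i, j} \<subseteq> {1..m} \<or> {i, j} \<subseteq> {m + 1..m + n}" "i < j" for i j
    proof (rule ccontr)
      assume "\<not> \<tau> i < \<tau> j"
      hence "\<tau> j < \<tau> i \<or> \<tau> i = \<tau> j" by auto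
      moreover have "\<tau> i \<in> {1..m + n}" "\<tau> j \<in> {1..m + n}" using that rng[of i] rng[of j] by auto
      moreover have "p ! (\<tau> i - 1) = p ! (\<tau> j - 1)"
        using that g_le[of "\<tau> i"] g_le[of "\<tau> j"] calculation by (auto simp: inv)
      ultimately show False using g_less[of "\<tau> j" "\<tau> i"] inv[of i] inv[of j] \<open>i < j\<close> by auto
    qed
    have "g \<in> shuffle_perms m n"
      using perm mono by (auto simp: shuffle_perms_def strict_mono_on_def \<tau>_def)
    moreover have "pattern_of m n g = p"
      by (rule nth_equalityI) (use g_le in \<open>auto simp: len pattern_of_nth\<close>)
    ultimately show "p \<in> pattern_of m n ` shuffle_perms m n" by blast
  qed
qed

lemma admissible_descents: "admissible_pairs m n \<sigma> = descents 1 (pattern_of m n \<sigma>)"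
proof -
  have "admissible_pairs m n \<sigma> = {(1 + i, 1 + i + 1) | i. i + 1 < m + n \<and> \<sigma> (Suc i) \<le> m \<and> \<not> \<sigma> (Suc (Suc i)) \<le> m}"
  proof (intro equalityI subsetI; clarify)
    fix i j assume "(i, j) \<in> admissible_pairs m n \<sigma>"
    thus "\<exists>l. (i, j) = (1 + l, 1 + l + 1) \<and> l + 1 < m + n \<and> \<sigma> (Suc l) \<le> m \<and> \<not> \<sigma> (Suc (Suc l)) \<le> m"
      by (intro exI[of _ "i - 1"]) (auto simp: admissible_pairs_def)
  qed (auto simp: admissible_pairs_def)
  also have "\<dots> = descents 1 (pattern_of m n \<sigma>)"
    unfolding descents_eq by (rule Collect_cong) (auto simp: pattern_of_nth)
  finally show ?thesis .
qed

lemma weave_nth: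
  "i < length p \<Longrightarrow> count_list p True \<le> length x \<Longrightarrow> count_list p False \<le> length y \<Longrightarrow>
    weave p x y ! i = (if p ! i then x ! count_list (take i p) True else y ! count_list (take i p) False)"
proof (induction p x y arbitrary: i rule: weave.induct)
  case (2 p x y)
  thus ?case by (cases x; cases i) auto
next
  case (3 p x y)
  thus ?case by (cases y; cases i) auto
qed simp

lemma length_weave [simp]: "length (weave p x y) = length p"
  by (induction p x y rule: weave.induct) auto

lemma weave_pattern_of:
  assumes "\<sigma> \<in> shuffle_perms (length x) (length y)"
  shows "map (\<lambda>k. (x @ y) ! (\<sigma> k - 1)) [1..<length x + length y + 1] = weave (pattern_of (length x) (length y) \<sigma>) x y"
proof (rule nth_equalityI)
  let ?p = "pattern_of (length x) (length y) \<sigma>"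
  have "?p \<in> patterns (length x) (length y)" using pattern_of_bij assms by (auto simp: bij_betw_def)
  hence c: "count_list ?p True = length x" "count_list ?p False = length y"
    using count_bool[of ?p] by (auto simp: patterns_def)
  fix i assume "i < length (map (\<lambda>k. (x @ y) ! (\<sigma> k - 1)) [1..<length x + length y + 1])"
  hence i: "i < length x + length y" by (simp del: upt_Suc)
  hence "map (\<lambda>k. (x @ y) ! (\<sigma> k - 1)) [1..<length x + length y + 1] ! i = (x @ y) ! (\<sigma> (Suc i) - 1)"
    by (subst nth_map) (simp_all add: nth_upt del: upt_Suc)
  also have "\<dots> = weave ?p x y ! i"
    using i shuffle_value[OF assms, of "Suc i"]
    by (auto simp: weave_nth c pattern_of_nth count_take_Suc nth_append split: if_splits)
  finally show "map (\<lambda>k. (x @ y) ! (\<sigma> k - 1)) [1..<length x + length y + 1] ! i = weave ?p x y ! i" .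
qed (simp del: upt_Suc)

text \<open>
  Since the list is distinct, the sum over the set of mixable shuffles equals a sum over the list
  \<open>quasi_shuffles\<close>, to which the recursion applies.
\<close>

lemma mixable_shuffles_quasi:
  "\<exists>L. distinct L \<and> set L = mixable_shuffles (length x) (length y)
     \<and> map (\<lambda>(\<sigma>, T). (card T, mixed_word A x y \<sigma> T)) L = quasi_shuffles A x y"
proof -
  let ?m = "length x" and ?n = "length y"
  let ?q = "\<lambda>p. inv_into (shuffle_perms ?m ?n) (pattern_of ?m ?n) p"
  let ?L = "map (\<lambda>(p, T). (?q p, T)) (mixings 1 ?m ?n)"
  note bij = pattern_of_bij[of ?m ?n]
  have q: "?q p \<in> shuffle_perms ?m ?n" "pattern_of ?m ?n (?q p) = p" if "p \<in> patterns ?m ?n" for p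
    using that bij by (auto simp: bij_betw_def inv_into_into f_inv_into_f)
  have word: "mixed_word A x y (?q p) T = merge_at A T 1 (weave p x y)" if "p \<in> patterns ?m ?n" for p T
    using weave_pattern_of[OF q(1)[OF that]] by (simp only: mixed_word_def q(2)[OF that])
  have q': "?q (pattern_of ?m ?n \<sigma>) = \<sigma>" if "\<sigma> \<in> shuffle_perms ?m ?n" for \<sigma>
    using that bij by (simp add: bij_betw_def)
  have inj: "inj_on (\<lambda>(p, T). (?q p, T)) (set (mixings 1 ?m ?n))"
    by (rule inj_onI) (use q in \<open>clarsimp simp: set_mixings, metis\<close>)
  have "distinct ?L" using inj by (simp add: distinct_map distinct_mixings)
  moreover have "set ?L = mixable_shuffles ?m ?n"
  proof (intro equalityI subsetI; clarify)
    fix \<sigma> T assume "(\<sigma>, T) \<in> set ?L"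
    thus "(\<sigma>, T) \<in> mixable_shuffles ?m ?n"
      by (auto simp: set_mixings mixable_shuffles_def admissible_descents q)
  next
    fix \<sigma> T assume "(\<sigma>, T) \<in> mixable_shuffles ?m ?n"
    hence s: "\<sigma> \<in> shuffle_perms ?m ?n" and T: "T \<subseteq> descents 1 (pattern_of ?m ?n \<sigma>)"
      by (auto simp: mixable_shuffles_def admissible_descents)
    have "(pattern_of ?m ?n \<sigma>, T) \<in> set (mixings 1 ?m ?n)"
      using s T bij by (auto simp: set_mixings bij_betw_def)
    thus "(\<sigma>, T) \<in> set ?L" using q'[OF s] by force
  qed
  moreover have "map (\<lambda>(\<sigma>, T). (card T, mixed_word A x y \<sigma> T)) ?L = quasi_shuffles A x y"
    unfolding map_mixings[of A 1 x y, symmetric] map_map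
    by (rule map_cong[OF refl]) (auto simp: set_mixings word)
  ultimately show ?thesis by blast
qed


section \<open>Transfer along injective linear maps\<close>

text \<open>
  Equations between elements of the source of an injective linear map can be checked after applying
  the map; the next lemmas do this for linearity, multilinearity, the laws of an algebra and those of
  a Baxter algebra.
\<close>

lemma linear_reflect:
  assumes f: "f \<in> linear_maps C M N" and inj: "inj_on f (carrier M)"
    and "module C L" "module C M"
    and cl: "\<And>x. x \<in> carrier L \<Longrightarrow> g x \<in> carrier M"
    and fg: "(\<lambda>x. f (g x)) \<in> linear_maps C L N"
  shows "g \<in> linear_maps C L M"
proof -
  interpret L: module C L by fact
  interpret M: module C M by fact
  show ?thesis
  proof (rule linear_mapsI[OF cl])
    fix x y assume xy: "x \<in> carrier L" "y \<in> carrier L"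
    show "g (x \<oplus>\<^bsub>L\<^esub> y) = g x \<oplus>\<^bsub>M\<^esub> g y"
      by (rule inj_onD[OF inj])
        (use xy in \<open>simp_all add: cl linear_add[OF f] linear_add[OF fg]\<close>)
  next
    fix c x assume cx: "c \<in> carrier C" "x \<in> carrier L"
    show "g (c \<odot>\<^bsub>L\<^esub> x) = c \<odot>\<^bsub>M\<^esub> g x"
      by (rule inj_onD[OF inj])
        (use cx in \<open>simp_all add: cl linear_smult[OF f] linear_smult[OF fg]\<close>)
  qed
qed

lemma multilinear_reflect:
  assumes f: "f \<in> linear_maps C M N" and inj: "inj_on f (carrier M)"
    and "module C A" "module C M"
    and cl: "\<And>us. us \<in> tuples A n \<Longrightarrow> g us \<in> carrier M"
    and fg: "multilinear C A n N (\<lambda>us. f (g us))"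
  shows "multilinear C A n M g"
proof (rule multilinearI[OF cl])
  fix p q assume pq: "length p + length q + 1 = n" "set p \<subseteq> carrier A" "set q \<subseteq> carrier A"
  show "(\<lambda>a. g (p @ a # q)) \<in> linear_maps C A M"
    by (rule linear_reflect[OF f inj assms(3,4) _ multilinear_slot[OF fg pq]], rule cl)
       (use pq in \<open>auto simp: tuples_def\<close>)
qed

lemma algebra_by_injection:
  assumes "module C M" "algebra C N"
    and f: "f \<in> linear_maps C M N" and inj: "inj_on f (carrier M)"
    and cl: "\<And>x y. x \<in> carrier M \<Longrightarrow> y \<in> carrier M \<Longrightarrow> x \<otimes>\<^bsub>M\<^esub> y \<in> carrier M"
    and one: "\<one>\<^bsub>M\<^esub> \<in> carrier M" "f \<one>\<^bsub>M\<^esub> = \<one>\<^bsub>N\<^esub>"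
    and mult: "\<And>x y. x \<in> carrier M \<Longrightarrow> y \<in> carrier M \<Longrightarrow> f (x \<otimes>\<^bsub>M\<^esub> y) = f x \<otimes>\<^bsub>N\<^esub> f y"
  shows "algebra C M"
proof -
  interpret M: module C M by fact
  interpret N: algebra C N by fact
  note fc = linear_closed[OF f] and hom = linear_add[OF f] linear_smult[OF f]
  have "comm_monoid M"
  proof (rule comm_monoidI)
    fix x y z assume "x \<in> carrier M" "y \<in> carrier M" "z \<in> carrier M"
    thus "x \<otimes>\<^bsub>M\<^esub> y \<otimes>\<^bsub>M\<^esub> z = x \<otimes>\<^bsub>M\<^esub> (y \<otimes>\<^bsub>M\<^esub> z)"
      by (intro inj_onD[OF inj]) (simp_all add: mult cl fc N.m_assoc)
  next
    fix x y assume "x \<in> carrier M" "y \<in> carrier M"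
    thus "x \<otimes>\<^bsub>M\<^esub> y = y \<otimes>\<^bsub>M\<^esub> x"
      by (intro inj_onD[OF inj]) (simp_all add: mult cl fc N.m_comm)
  next
    fix x assume "x \<in> carrier M"
    thus "\<one>\<^bsub>M\<^esub> \<otimes>\<^bsub>M\<^esub> x = x"
      by (intro inj_onD[OF inj]) (simp_all add: mult cl fc one)
  qed (fact cl one)+
  hence "cring M"
  proof (rule cringI[OF M.M.abelian_group_axioms])
    fix x y z assume "x \<in> carrier M" "y \<in> carrier M" "z \<in> carrier M"
    thus "(x \<oplus>\<^bsub>M\<^esub> y) \<otimes>\<^bsub>M\<^esub> z = x \<otimes>\<^bsub>M\<^esub> z \<oplus>\<^bsub>M\<^esub> y \<otimes>\<^bsub>M\<^esub> z"
      by (intro inj_onD[OF inj]) (simp_all add: mult hom cl fc N.l_distr)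
  qed
  thus ?thesis
  proof (rule algebraI[OF M.R.is_cring])
    fix a x y assume "a \<in> carrier C" "x \<in> carrier M" "y \<in> carrier M"
    thus "a \<odot>\<^bsub>M\<^esub> x \<otimes>\<^bsub>M\<^esub> y = a \<odot>\<^bsub>M\<^esub> (x \<otimes>\<^bsub>M\<^esub> y)"
      by (intro inj_onD[OF inj]) (simp_all add: mult hom cl fc N.smult_assoc2)
  qed (simp_all add: M.smult_l_distr M.smult_r_distr M.smult_assoc1)
qed

lemma baxter_algebra_by_injection:
  assumes "algebra C M" "baxter_algebra C lam N Q"
    and f: "f \<in> linear_maps C M N" and inj: "inj_on f (carrier M)"
    and mult: "\<And>x y. x \<in> carrier M \<Longrightarrow> y \<in> carrier M \<Longrightarrow> f (x \<otimes>\<^bsub>M\<^esub> y) = f x \<otimes>\<^bsub>N\<^esub> f y"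
    and P: "\<And>x. x \<in> carrier M \<Longrightarrow> P x \<in> carrier M" "\<And>x. x \<in> carrier M \<Longrightarrow> f (P x) = Q (f x)"
  shows "baxter_algebra C lam M P"
proof -
  interpret M: algebra C M by fact
  interpret N: baxter_algebra C lam N Q by fact
  note fc = linear_closed[OF f] and hom = linear_add[OF f] linear_smult[OF f]
  show ?thesis
  proof (intro baxter_algebra.intro baxter_algebra_axioms.intro M.algebra_axioms N.weight_closed P(1))
    fix x y assume xy: "x \<in> carrier M" "y \<in> carrier M"
    show "P (x \<oplus>\<^bsub>M\<^esub> y) = P x \<oplus>\<^bsub>M\<^esub> P y"
      using xy by (intro inj_onD[OF inj]) (simp_all add: P hom fc N.P_add)
    show "P x \<otimes>\<^bsub>M\<^esub> P y = P (x \<otimes>\<^bsub>M\<^esub> P y) \<oplus>\<^bsub>M\<^esub> P (y \<otimes>\<^bsub>M\<^esub> P x) \<oplus>\<^bsub>M\<^esub> lam \<odot>\<^bsub>M\<^esub> P (x \<otimes>\<^bsub>M\<^esub> y)"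
      using xy N.baxter_identity[OF fc[OF xy(1)] fc[OF xy(2)]]
      by (intro inj_onD[OF inj]) (simp_all add: P hom mult fc N.weight_closed)
  next
    fix c x assume "c \<in> carrier C" "x \<in> carrier M"
    thus "P (c \<odot>\<^bsub>M\<^esub> x) = c \<odot>\<^bsub>M\<^esub> P x"
      by (intro inj_onD[OF inj]) (simp_all add: P hom fc N.P_smult)
  qed
qed


section \<open>The module of the shuffle algebra\<close>

lemma direct_sum_simps [simp]:
  "zero (direct_sum M) = (\<lambda>k. \<zero>\<^bsub>M k\<^esub>)"
  "add (direct_sum M) = (\<lambda>X Y k. X k \<oplus>\<^bsub>M k\<^esub> Y k)"
  "smult (direct_sum M) = (\<lambda>c X k. c \<odot>\<^bsub>M k\<^esub> X k)"
  by (simp_all add: direct_sum_def)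

lemma direct_sum_carrier:
  "X \<in> carrier (direct_sum M) \<longleftrightarrow> (\<forall>k. X k \<in> carrier (M k)) \<and> finite {k. X k \<noteq> \<zero>\<^bsub>M k\<^esub>}"
  by (simp add: direct_sum_def)

lemma direct_sum_module:
  assumes "\<And>k. module C (M k)" shows "module C (direct_sum M)"
proof -
  interpret M: module C "M k" for k by (rule assms)
  have fin: "finite {k. Z k \<noteq> \<zero>\<^bsub>M k\<^esub>}"
    if "finite {k. X k \<noteq> \<zero>\<^bsub>M k\<^esub>}" "finite {k. Y k \<noteq> \<zero>\<^bsub>M k\<^esub>}"
      "\<And>k. X k = \<zero>\<^bsub>M k\<^esub> \<Longrightarrow> Y k = \<zero>\<^bsub>M k\<^esub> \<Longrightarrow> Z k = \<zero>\<^bsub>M k\<^esub>" for X Y Z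
    by (rule finite_subset[of _ "{k. X k \<noteq> \<zero>\<^bsub>M k\<^esub>} \<union> {k. Y k \<noteq> \<zero>\<^bsub>M k\<^esub>}"]) (use that in auto)
  show ?thesis
  proof (rule moduleI)
    show "abelian_group (direct_sum M)"
    proof (rule abelian_groupI)
      fix X assume X: "X \<in> carrier (direct_sum M)"
      let ?Y = "\<lambda>k. \<ominus>\<^bsub>M k\<^esub> X k"
      have "?Y \<in> carrier (direct_sum M)"
        using X fin[of X X ?Y] by (auto simp: direct_sum_carrier)
      moreover have "?Y \<oplus>\<^bsub>direct_sum M\<^esub> X = \<zero>\<^bsub>direct_sum M\<^esub>"
        using X by (auto simp: direct_sum_carrier M.M.l_neg)
      ultimately show "\<exists>Y\<in>carrier (direct_sum M). Y \<oplus>\<^bsub>direct_sum M\<^esub> X = \<zero>\<^bsub>direct_sum M\<^esub>" by blast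
    next
      fix X Y assume "X \<in> carrier (direct_sum M)" "Y \<in> carrier (direct_sum M)"
      thus "X \<oplus>\<^bsub>direct_sum M\<^esub> Y \<in> carrier (direct_sum M)"
        using fin[of X Y "X \<oplus>\<^bsub>direct_sum M\<^esub> Y"] by (auto simp: direct_sum_carrier)
    qed (auto simp: direct_sum_carrier M.M.a_ac)
    fix c X assume "c \<in> carrier C" "X \<in> carrier (direct_sum M)"
    thus "c \<odot>\<^bsub>direct_sum M\<^esub> X \<in> carrier (direct_sum M)"
      using fin[of X X "c \<odot>\<^bsub>direct_sum M\<^esub> X"] by (auto simp: direct_sum_carrier)
  qed (auto simp: direct_sum_carrier M.smult_l_distr M.smult_r_distr M.smult_assoc1 M.R.is_cring)
qed

context tensor_setting
begin

abbreviation "H \<equiv> sh_module C A"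

lemma H_simps:
  "zero H = (\<lambda>k. \<zero>\<^bsub>T (k + 1)\<^esub>)"
  "add H = (\<lambda>X Y k. X k \<oplus>\<^bsub>T (k + 1)\<^esub> Y k)"
  "smult H = (\<lambda>c X k. c \<odot>\<^bsub>T (k + 1)\<^esub> X k)"
  by (simp_all only: sh_module_def direct_sum_simps)

lemma H_carrier:
  "X \<in> carrier H \<longleftrightarrow> (\<forall>k. X k \<in> carrier (T (k + 1))) \<and> finite {k. X k \<noteq> \<zero>\<^bsub>T (k + 1)\<^esub>}"
  by (simp only: sh_module_def direct_sum_carrier)

lemma H_module: "module C H"
  unfolding sh_module_def by (rule direct_sum_module[OF tensor_power_module])

sublocale H: module C H by (rule H_module)

definition sh_single :: "nat \<Rightarrow> ('a, 'c) tensor \<Rightarrow> ('a, 'c) shuffle_elem"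
  where "sh_single k Y = (\<lambda>j. if j = k then Y else \<zero>\<^bsub>T (j + 1)\<^esub>)"

lemma sh_single_linear: "sh_single k \<in> linear_maps C (T (k + 1)) H"
proof (rule linear_mapsI)
  fix Y assume "Y \<in> carrier (T (k + 1))"
  moreover have "finite {j. sh_single k Y j \<noteq> \<zero>\<^bsub>T (j + 1)\<^esub>}"
    by (rule finite_subset[of _ "{k}"]) (auto simp: sh_single_def)
  ultimately show "sh_single k Y \<in> carrier H"
    unfolding H_carrier by (auto simp: sh_single_def simp del: tensor_power_simps)
qed (auto simp: sh_single_def H_simps fun_eq_iff simp del: tensor_power_simps)

lemma sh_pure_single: "length us = k + 1 \<Longrightarrow> sh_pure C A us = sh_single k (pure us)"
  by (auto simp: sh_pure_def sh_single_def fun_eq_iff)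

lemma sh_pure_multilinear: "multilinear C A (k + 1) H (sh_pure C A)"
proof (rule multilinearI)
  note lin = multilinear_comp[OF pure_multilinear sh_single_linear]
  fix us assume us: "us \<in> tuples A (k + 1)"
  hence "sh_pure C A us = sh_single k (pure us)" by (intro sh_pure_single) (simp add: tuples_def)
  thus "sh_pure C A us \<in> carrier H" using multilinear_closed[OF lin us] by simp
next
  note lin = multilinear_comp[OF pure_multilinear sh_single_linear]
  fix p q assume pq: "length p + length q + 1 = k + 1" "set p \<subseteq> carrier A" "set q \<subseteq> carrier A"
  show "(\<lambda>a. sh_pure C A (p @ a # q)) \<in> linear_maps C A H"
    using multilinear_slot[OF lin pq] pq(1) by (simp add: sh_pure_single)
qed

abbreviation "words \<equiv> {us. us \<noteq> [] \<and> set us \<subseteq> carrier A}"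

lemma words_tuple: "us \<in> words \<Longrightarrow> us \<in> tuples A (length us - 1 + 1)"
  by (cases us) (auto simp: tuples_def)

lemma tuple_words: "us \<in> tuples A (k + 1) \<Longrightarrow> us \<in> words"
  by (auto simp: tuples_def)

lemma sh_pure_closed: "us \<in> words \<Longrightarrow> sh_pure C A us \<in> carrier H"
  by (rule multilinear_closed[OF sh_pure_multilinear words_tuple])

text \<open>
  An element of the direct sum is the sum of its finitely many homogeneous parts, and each of these
  is built from pure tensors by \<open>tensor_induct\<close>.
\<close>

lemma sh_induct [consumes 1, case_names pure add smult]:
  assumes "X \<in> carrier H"
    and pure: "\<And>us. us \<in> words \<Longrightarrow> P (sh_pure C A us)"
    and add: "\<And>X Y. X \<in> carrier H \<Longrightarrow> Y \<in> carrier H \<Longrightarrow> P X \<Longrightarrow> P Y \<Longrightarrow> P (X \<oplus>\<^bsub>H\<^esub> Y)"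
    and smult: "\<And>c X. c \<in> carrier C \<Longrightarrow> X \<in> carrier H \<Longrightarrow> P X \<Longrightarrow> P (c \<odot>\<^bsub>H\<^esub> X)"
  shows "P X"
proof -
  have ex: "[\<one>\<^bsub>A\<^esub>] \<in> words" by simp
  have "P (\<zero>\<^bsub>C\<^esub> \<odot>\<^bsub>H\<^esub> sh_pure C A [\<one>\<^bsub>A\<^esub>])"
    by (intro smult pure sh_pure_closed ex C.zero_closed)
  hence zero: "P \<zero>\<^bsub>H\<^esub>" by (simp only: H.smult_l_null sh_pure_closed[OF ex])
  have single: "P (sh_single k Y)" if "Y \<in> carrier (T (k + 1))" for k Y
    using that
  proof (induction rule: tensor_induct)
    case (pure us)
    thus ?case using assms(2)[OF tuple_words[OF pure]] sh_pure_single[of us k] by (simp add: tuples_def)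
  next
    case (add X Y)
    thus ?case by (simp only: linear_add[OF sh_single_linear] linear_closed[OF sh_single_linear] assms(3))
  next
    case (smult c X)
    thus ?case by (simp only: linear_smult[OF sh_single_linear] linear_closed[OF sh_single_linear] assms(4))
  qed
  have "P X" if "finite K" "X \<in> carrier H" "{k. X k \<noteq> \<zero>\<^bsub>T (k + 1)\<^esub>} \<subseteq> K" for K X
    using that
  proof (induction K arbitrary: X rule: finite_induct)
    case empty
    hence "X = \<zero>\<^bsub>H\<^esub>" unfolding H_simps by (intro ext) blast
    thus ?case using zero by simp
  next
    case (insert k K X)
    let ?X = "X(k := \<zero>\<^bsub>T (k + 1)\<^esub>)"
    have Xk: "X j \<in> carrier (T (j + 1))" for j using insert.prems(1) unfolding H_carrier by blast
    have fin: "finite {j. ?X j \<noteq> \<zero>\<^bsub>T (j + 1)\<^esub>}"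
      by (rule finite_subset[OF _ insert.hyps(1)]) (use insert.prems(2) in \<open>auto split: if_splits\<close>)
    hence X': "?X \<in> carrier H"
      unfolding H_carrier using Xk T.M.zero_closed by (auto simp del: tensor_power_simps)
    have "P ?X"
      by (rule insert.IH[OF X']) (use insert.prems(2) in \<open>auto split: if_splits\<close>)
    moreover have "X = ?X \<oplus>\<^bsub>H\<^esub> sh_single k (X k)"
      using Xk by (auto simp: H_simps sh_single_def fun_eq_iff simp del: tensor_power_simps)
    ultimately show ?case
      using add[OF X' linear_closed[OF sh_single_linear Xk] _ single[OF Xk]] by metis
  qed
  from this[of "{k. X k \<noteq> \<zero>\<^bsub>T (k + 1)\<^esub>}" X] show ?thesis
    using assms(1) unfolding H_carrier by blast
qed

lemma linear_eq_on_sh_pure: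
  assumes "f \<in> linear_maps C H M" "g \<in> linear_maps C H M"
    and "\<And>us. us \<in> words \<Longrightarrow> f (sh_pure C A us) = g (sh_pure C A us)"
    and "X \<in> carrier H"
  shows "f X = g X"
  using assms(4)
  by (induction rule: sh_induct)
     (simp_all only: assms(3) linear_add[OF assms(1)] linear_add[OF assms(2)]
        linear_smult[OF assms(1)] linear_smult[OF assms(2)])

context
  fixes M :: "('c, 'r, 'n) module_scheme" and h
  assumes M: "module C M" and h: "\<And>k. multilinear C A (k + 1) M h"
begin

interpretation M: module C M by (rule M)

lemma sh_lift_linear: "sh_lift C A M h \<in> linear_maps C H M"
proof (rule linear_mapsI)
  note lin = tensor_lift_linear[OF M h]
  have zero: "tensor_lift C M h \<zero>\<^bsub>T (k + 1)\<^esub> = \<zero>\<^bsub>M\<^esub>" for k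
    by (rule linear_zero[OF lin T.module M])
  fix X assume X: "X \<in> carrier H"
  hence Xk: "X k \<in> carrier (T (k + 1))" and fX: "finite {k. X k \<noteq> \<zero>\<^bsub>T (k + 1)\<^esub>}" for k
    unfolding H_carrier by blast+
  note cX = linear_closed[OF lin Xk]
  show "sh_lift C A M h X \<in> carrier M"
    unfolding sh_lift_def by (rule M.finsum_closed) (use cX in blast)
  show "sh_lift C A M h (c \<odot>\<^bsub>H\<^esub> X) = c \<odot>\<^bsub>M\<^esub> sh_lift C A M h X" if c: "c \<in> carrier C" for c
    unfolding sh_lift_def H_simps
    by (rule M.support_sum_smult[where g = "\<lambda>k. tensor_lift C M h" and X = X and z = "\<lambda>k. \<zero>\<^bsub>T (k + 1)\<^esub>", OF fX c])
       (simp_all only: T.smult_r_null c zero cX linear_smult[OF lin c Xk])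
  fix Y assume Y: "Y \<in> carrier H"
  hence Yk: "Y k \<in> carrier (T (k + 1))" and fY: "finite {k. Y k \<noteq> \<zero>\<^bsub>T (k + 1)\<^esub>}" for k
    unfolding H_carrier by blast+
  show "sh_lift C A M h (X \<oplus>\<^bsub>H\<^esub> Y) = sh_lift C A M h X \<oplus>\<^bsub>M\<^esub> sh_lift C A M h Y"
    unfolding sh_lift_def H_simps
    by (rule M.M.support_sum_add[where g = "\<lambda>k. tensor_lift C M h" and X = X and Y = Y and z = "\<lambda>k. \<zero>\<^bsub>T (k + 1)\<^esub>", OF fX fY])
       (simp_all only: T.M.l_zero T.M.zero_closed zero cX linear_closed[OF lin Yk] linear_add[OF lin Xk Yk])
qed

lemma sh_lift_pure:
  assumes us: "us \<in> words"
  shows "sh_lift C A M h (sh_pure C A us) = h us"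
proof -
  define n where "n = length us - 1"
  have t: "us \<in> tuples A (n + 1)" unfolding n_def by (rule words_tuple[OF us])
  hence e: "sh_pure C A us = sh_single n (pure us)" by (intro sh_pure_single) (simp add: tuples_def)
  note lin = tensor_lift_linear[OF M h]
  have zero: "tensor_lift C M h \<zero>\<^bsub>T (k + 1)\<^esub> = \<zero>\<^bsub>M\<^esub>" for k
    by (rule linear_zero[OF lin T.module M])
  have hu: "tensor_lift C M h (pure us) = h us" by (rule tensor_lift_pure[OF M h t])
  have hc: "h us \<in> carrier M" by (rule multilinear_closed[OF h t])
  have "sh_lift C A M h (sh_pure C A us) = (\<Oplus>\<^bsub>M\<^esub>k\<in>{n}. tensor_lift C M h (sh_single n (pure us) k))"
    unfolding sh_lift_def e
    by (rule M.M.support_sum_superset[where g = "\<lambda>k. tensor_lift C M h" and X = "sh_single n (pure us)" and z = "\<lambda>k. \<zero>\<^bsub>T (k + 1)\<^esub>"])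
      (auto simp: sh_single_def hu hc zero[folded Suc_eq_plus1] simp del: tensor_power_simps split: if_splits)
  also have "\<dots> = h us" by (subst M.finsum_insert) (auto simp: sh_single_def hu hc)
  finally show ?thesis .
qed

end

definition sh_mult :: "'c \<Rightarrow> ('a, 'c) shuffle_elem \<Rightarrow> ('a, 'c) shuffle_elem \<Rightarrow> ('a, 'c) shuffle_elem"
  where "sh_mult lam X Y = sh_lift C A H (\<lambda>us. sh_lift C A H (sh_mult_pure C lam A us) Y) X"

lemma Sh_simps:
  "carrier (Sh C lam A) = carrier H" "zero (Sh C lam A) = zero H" "add (Sh C lam A) = add H"
  "smult (Sh C lam A) = smult H" "mult (Sh C lam A) = sh_mult lam" "one (Sh C lam A) = sh_pure C A [\<one>\<^bsub>A\<^esub>]"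
  by (simp_all add: Sh_def sh_mult_def fun_eq_iff)

lemma Sh_module: "module C (Sh C lam A)"
  by (rule module_by_surjection[where p = "\<lambda>x. x", OF H_module]) (simp_all add: Sh_simps)

lemma linear_Sh: "linear_maps C (Sh C lam A) M = linear_maps C H M" "linear_maps C M (Sh C lam A) = linear_maps C M H"
  by (simp_all add: linear_maps_def Sh_simps)

lemma sh_P_multilinear: "multilinear C A (k + 1) H (\<lambda>us. sh_pure C A (\<one>\<^bsub>A\<^esub> # us))"
proof (rule multilinearI)
  fix p q assume pq: "length p + length q + 1 = k + 1" "set p \<subseteq> carrier A" "set q \<subseteq> carrier A"
  have "(\<lambda>a. sh_pure C A ((\<one>\<^bsub>A\<^esub> # p) @ a # q)) \<in> linear_maps C A H"
    using pq by (intro multilinear_slot[OF sh_pure_multilinear[of "k + 1"]]) auto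
  thus "(\<lambda>a. sh_pure C A (\<one>\<^bsub>A\<^esub> # p @ a # q)) \<in> linear_maps C A H" by simp
qed (auto intro!: sh_pure_closed simp: tuples_def)

lemma sh_P_linear: "sh_P C A \<in> linear_maps C H H"
  unfolding sh_P_def by (rule sh_lift_linear[OF H_module sh_P_multilinear])

lemma sh_P_pure: "us \<in> words \<Longrightarrow> sh_P C A (sh_pure C A us) = sh_pure C A (\<one>\<^bsub>A\<^esub> # us)"
  unfolding sh_P_def by (rule sh_lift_pure[OF H_module sh_P_multilinear])

end


section \<open>Words in a Baxter algebra\<close>

definition list_sum :: "('r, 'm) ring_scheme \<Rightarrow> 'r list \<Rightarrow> 'r"
  where "list_sum R xs = foldr (add R) xs \<zero>\<^bsub>R\<^esub>"

lemma (in abelian_monoid) list_sum_closed: "set xs \<subseteq> carrier G \<Longrightarrow> list_sum G xs \<in> carrier G"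
  by (induction xs) (auto simp: list_sum_def)

lemma (in abelian_monoid) list_sum_append:
  "set xs \<subseteq> carrier G \<Longrightarrow> set ys \<subseteq> carrier G \<Longrightarrow> list_sum G (xs @ ys) = list_sum G xs \<oplus> list_sum G ys"
proof (induction xs)
  case Nil thus ?case using list_sum_closed[of ys] by (simp add: list_sum_def)
next
  case (Cons x xs)
  thus ?case using list_sum_closed[of ys] list_sum_closed[of xs] by (simp add: list_sum_def a_assoc)
qed

lemma (in abelian_monoid) finsum_distinct_list:
  "distinct L \<Longrightarrow> f ` set L \<subseteq> carrier G \<Longrightarrow> (\<Oplus>p\<in>set L. f p) = list_sum G (map f L)"
proof (induction L)
  case (Cons p L)
  hence "(\<Oplus>p\<in>set (p # L). f p) = f p \<oplus> (\<Oplus>p\<in>set L. f p)"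
    unfolding list.set by (intro finsum_insert) auto
  thus ?case using Cons by (simp add: list_sum_def)
qed (simp add: list_sum_def)

lemma linear_list_sum:
  assumes "f \<in> linear_maps C M N" "module C M" "module C N" "set xs \<subseteq> carrier M"
  shows "f (list_sum M xs) = list_sum N (map f xs)"
proof -
  interpret M: module C M by fact
  show ?thesis using assms(4)
  proof (induction xs)
    case Nil show ?case by (simp add: list_sum_def linear_zero[OF assms(1-3)])
  next
    case (Cons x xs)
    thus ?case using M.M.list_sum_closed[of xs] linear_add[OF assms(1), of x "list_sum M xs"]
      by (simp add: list_sum_def)
  qed
qed

definition weighted_sum ::
  "('c, 'k) ring_scheme \<Rightarrow> 'c \<Rightarrow> ('c, 'r, 'n) module_scheme \<Rightarrow> ('a list \<Rightarrow> 'r) \<Rightarrow> (nat \<times> 'a list) list \<Rightarrow> 'r"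
  where "weighted_sum C lam M f Q = list_sum M (map (\<lambda>(j, w). lam [^]\<^bsub>C\<^esub> j \<odot>\<^bsub>M\<^esub> f w) Q)"

lemma (in module) weighted_terms_closed:
  assumes "lam \<in> carrier R" "\<And>j w. (j, w) \<in> set Q \<Longrightarrow> f w \<in> carrier M"
  shows "set (map (\<lambda>(j, w). lam [^]\<^bsub>R\<^esub> (j :: nat) \<odot>\<^bsub>M\<^esub> f w) Q) \<subseteq> carrier M"
  using assms by auto

lemma (in module) weighted_sum_closed:
  assumes "lam \<in> carrier R" "\<And>j w. (j, w) \<in> set Q \<Longrightarrow> f w \<in> carrier M"
  shows "weighted_sum R lam M f Q \<in> carrier M"
  unfolding weighted_sum_def using weighted_terms_closed[OF assms] by (rule M.list_sum_closed)

lemma (in module) weighted_sum_append: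
  assumes "lam \<in> carrier R" "\<And>j w. (j, w) \<in> set Q \<Longrightarrow> f w \<in> carrier M" "\<And>j w. (j, w) \<in> set Q' \<Longrightarrow> f w \<in> carrier M"
  shows "weighted_sum R lam M f (Q @ Q') = weighted_sum R lam M f Q \<oplus>\<^bsub>M\<^esub> weighted_sum R lam M f Q'"
  unfolding weighted_sum_def map_append
  using weighted_terms_closed[OF assms(1,2)] weighted_terms_closed[OF assms(1,3)] by (rule M.list_sum_append)

lemma weighted_sum_linear:
  assumes "f \<in> linear_maps C M N" "module C M" "module C N" "lam \<in> carrier C"
    and "\<And>j w. (j, w) \<in> set Q \<Longrightarrow> g w \<in> carrier M"
  shows "f (weighted_sum C lam M g Q) = weighted_sum C lam N (\<lambda>w. f (g w)) Q"
proof -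
  interpret M: module C M by fact
  have "f (weighted_sum C lam M g Q) = list_sum N (map f (map (\<lambda>(j, w). lam [^]\<^bsub>C\<^esub> j \<odot>\<^bsub>M\<^esub> g w) Q))"
    unfolding weighted_sum_def
    by (rule linear_list_sum[OF assms(1-3)], rule M.weighted_terms_closed[OF assms(4)], rule assms(5))
  also have "map f (map (\<lambda>(j, w). lam [^]\<^bsub>C\<^esub> j \<odot>\<^bsub>M\<^esub> g w) Q) = map (\<lambda>(j, w). lam [^]\<^bsub>C\<^esub> j \<odot>\<^bsub>N\<^esub> f (g w)) Q"
    unfolding map_map by (rule map_cong[OF refl]) (use assms(4,5) in \<open>auto simp: linear_smult[OF assms(1)]\<close>)
  finally show ?thesis by (simp only: weighted_sum_def)
qed

lemma weighted_sum_Cons: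
  "weighted_sum C lam M f (map (\<lambda>(j, w). (j, a # w)) Q) = weighted_sum C lam M (\<lambda>w. f (a # w)) Q"
  unfolding weighted_sum_def map_map by (rule arg_cong[where f = "list_sum M"], rule map_cong) auto

lemma (in module) weighted_sum_Suc:
  assumes "lam \<in> carrier R" "\<And>j w. (j, w) \<in> set Q \<Longrightarrow> f (a # w) \<in> carrier M"
  shows "weighted_sum R lam M f (map (\<lambda>(j, w). (Suc j, a # w)) Q) = weighted_sum R lam M (\<lambda>w. lam \<odot>\<^bsub>M\<^esub> f (a # w)) Q"
  unfolding weighted_sum_def map_map
  by (rule arg_cong[where f = "list_sum M"], rule map_cong) (use assms in \<open>auto simp: smult_assoc1\<close>)

lemma quasi_shuffles_carrier:
  assumes "cring A" "set x \<subseteq> carrier A" "set y \<subseteq> carrier A" "(j, w) \<in> set (quasi_shuffles A x y)"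
  shows "set w \<subseteq> carrier A"
  using assms
proof (induction A x y arbitrary: j w rule: quasi_shuffles.induct)
    case (3 A a x b y)
    interpret A: cring A by (rule 3(4))
    from 3(7) consider i v where "w = a # v" "(i, v) \<in> set (quasi_shuffles A x (b # y))"
      | i v where "w = b # v" "(i, v) \<in> set (quasi_shuffles A (a # x) y)"
      | i v where "w = (a \<otimes>\<^bsub>A\<^esub> b) # v" "(i, v) \<in> set (quasi_shuffles A x y)"
      by auto
    thus ?case
    proof cases
      case 1 thus ?thesis using "3.IH"(1)[of i v] "3.prems" by simp
    next
      case 2 thus ?thesis using "3.IH"(2)[of i v] "3.prems" by simp
    next
      case 3 thus ?thesis using "3.IH"(3)[of i v] "3.prems" by simp
    qed
qed auto

text \<open>
  A Baxter algebra \<open>R\<close> together with an algebra homomorphism \<open>t\<close> from \<open>A\<close>: the data to which the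
  universal property of the shuffle algebra applies.
\<close>

locale baxter_target = tensor_setting C A
  for C :: "('c, 'k) ring_scheme" and A :: "('c, 'a, 'm) module_scheme" +
  fixes lam :: 'c and R :: "('c, 'r, 'n) module_scheme" and P :: "'r \<Rightarrow> 'r" and t :: "'a \<Rightarrow> 'r"
  assumes baxter: "baxter_algebra C lam R P"
    and t_linear: "t \<in> linear_maps C A R"
    and t_mult: "a \<in> carrier A \<Longrightarrow> b \<in> carrier A \<Longrightarrow> t (a \<otimes>\<^bsub>A\<^esub> b) = t a \<otimes>\<^bsub>R\<^esub> t b"
    and t_one: "t \<one>\<^bsub>A\<^esub> = \<one>\<^bsub>R\<^esub>"
begin

sublocale R: baxter_algebra C lam R P by (rule baxter)

lemma R_module: "module C R"
  by (rule algebra.module[OF R.algebra_axioms])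

lemma lam_closed: "lam \<in> carrier C" by (rule R.weight_closed)

lemma P_linear: "P \<in> linear_maps C R R"
  by (rule linear_mapsI) (simp_all add: R.P_closed R.P_add R.P_smult)

lemma t_closed: "a \<in> carrier A \<Longrightarrow> t a \<in> carrier R"
  by (rule linear_closed[OF t_linear])

text \<open>
  A word \<open>x\<^sub>0 x\<^sub>1 \<dots> x\<^sub>n\<close> takes the value \<open>t(x\<^sub>0) P(t(x\<^sub>1) P(\<dots> P(t(x\<^sub>n))))\<close>, which is
  \<open>val [x\<^sub>0, \<dots>, x\<^sub>n]\<close>.  The first letter plays a special role in the shuffle product, so the factor
  that the remaining letters contribute has its own name, \<open>tval [x\<^sub>1, \<dots>, x\<^sub>n]\<close>; for the empty tail
  it is \<open>1\<close>.
\<close>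

primrec tval :: "'a list \<Rightarrow> 'r"
  where "tval [] = \<one>\<^bsub>R\<^esub>" | "tval (a # x) = P (t a \<otimes>\<^bsub>R\<^esub> tval x)"

definition val :: "'a list \<Rightarrow> 'r"
  where "val us = t (hd us) \<otimes>\<^bsub>R\<^esub> tval (tl us)"

lemma val_Cons: "val (a # x) = t a \<otimes>\<^bsub>R\<^esub> tval x"
  by (simp add: val_def)

lemma tval_Cons_val: "tval (a # x) = P (val (a # x))"
  by (simp add: val_def)

lemma tval_closed: "set x \<subseteq> carrier A \<Longrightarrow> tval x \<in> carrier R"
  by (induction x) (simp_all add: R.P_closed t_closed)

lemma val_closed: "us \<in> words \<Longrightarrow> val us \<in> carrier R"
  by (cases us) (simp_all add: val_Cons tval_closed t_closed)

lemma tval_slot: "set p \<subseteq> carrier A \<Longrightarrow> set q \<subseteq> carrier A \<Longrightarrow> (\<lambda>a. tval (p @ a # q)) \<in> linear_maps C A R"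
proof (induction p)
  case Nil
  from linear_comp[OF linear_comp[OF t_linear R.mult_right_linear[OF tval_closed]] P_linear] Nil
  show ?case by simp
next
  case (Cons b p)
  from linear_comp[OF linear_comp[OF Cons.IH R.mult_left_linear[OF t_closed]] P_linear, of b] Cons.prems
  show ?case by simp
qed

lemma val_multilinear: "multilinear C A (k + 1) R val"
proof (rule multilinearI)
  fix p q assume pq: "length p + length q + 1 = k + 1" "set p \<subseteq> carrier A" "set q \<subseteq> carrier A"
  show "(\<lambda>a. val (p @ a # q)) \<in> linear_maps C A R"
  proof (cases p)
    case Nil
    thus ?thesis using linear_comp[OF t_linear R.mult_right_linear[OF tval_closed[OF pq(3)]]] by (simp add: val_Cons)
  next
    case (Cons b p')
    thus ?thesis
      using linear_comp[OF tval_slot[of p' q] R.mult_left_linear[OF t_closed, of b]] pq by (simp add: val_Cons)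
  qed
qed (rule val_closed[OF tuple_words])

abbreviation "wsum \<equiv> weighted_sum C lam R"

text \<open>
  Both factors lie in the image of \<open>P\<close>, so the Baxter identity splits their product into three terms.
  By induction these are the three groups of words in the recursion of \<open>quasi_shuffles\<close>.
\<close>

lemma tval_mult:
  "set x \<subseteq> carrier A \<Longrightarrow> set y \<subseteq> carrier A \<Longrightarrow> tval x \<otimes>\<^bsub>R\<^esub> tval y = wsum tval (quasi_shuffles A x y)"
proof (induction x arbitrary: y)
  case Nil
  thus ?case by (simp add: weighted_sum_def list_sum_def tval_closed)
next
  case (Cons a x)
  note outer = Cons
  from Cons.prems(2) show ?case
  proof (induction y)
    case Nil
    thus ?case using outer(2) tval_closed[of "a # x"]
      by (simp add: weighted_sum_def list_sum_def del: tval.simps(2))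
  next
    case (Cons b y)
    have ab: "a \<in> carrier A" "b \<in> carrier A" "a \<otimes>\<^bsub>A\<^esub> b \<in> carrier A" and x: "set x \<subseteq> carrier A" and y: "set y \<subseteq> carrier A"
      using outer(2) Cons.prems by auto
    have xs: "set (a # x) \<subseteq> carrier A" "set (b # y) \<subseteq> carrier A" using x y ab by auto
    note cl = tval_closed[OF x] tval_closed[OF y] t_closed[OF ab(1)] t_closed[OF ab(2)] R.P_closed R.m_closed
    note q1 = quasi_shuffles_carrier[OF A.M_cring x xs(2)] and q2 = quasi_shuffles_carrier[OF A.M_cring xs(1) y]
      and q3 = quasi_shuffles_carrier[OF A.M_cring x y]
    have lin: "(\<lambda>X. P (t c \<otimes>\<^bsub>R\<^esub> X)) \<in> linear_maps C R R" if "c \<in> carrier A" for c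
      by (rule linear_comp[OF R.mult_left_linear[OF t_closed[OF that]] P_linear])
    have Cons_closed: "tval (c # w) \<in> carrier R" if "c \<in> carrier A" "set w \<subseteq> carrier A" for c w
      by (rule tval_closed) (use that in simp)
    define u v where "u = t a \<otimes>\<^bsub>R\<^esub> tval x" and "v = t b \<otimes>\<^bsub>R\<^esub> tval y"
    have uv: "u \<in> carrier R" "v \<in> carrier R" using cl by (auto simp: u_def v_def)
    have "u \<otimes>\<^bsub>R\<^esub> P v = t a \<otimes>\<^bsub>R\<^esub> (tval x \<otimes>\<^bsub>R\<^esub> tval (b # y))"
      using cl uv by (simp add: u_def v_def R.m_assoc)
    also have "\<dots> = t a \<otimes>\<^bsub>R\<^esub> wsum tval (quasi_shuffles A x (b # y))"
      by (simp only: outer(1)[OF x xs(2)])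
    finally have 1: "P (u \<otimes>\<^bsub>R\<^esub> P v) = wsum tval (map (\<lambda>(j, w). (j, a # w)) (quasi_shuffles A x (b # y)))"
      using weighted_sum_linear[OF lin[OF ab(1)] R_module R_module lam_closed tval_closed[OF q1]]
      by (simp add: weighted_sum_Cons)
    have "v \<otimes>\<^bsub>R\<^esub> P u = t b \<otimes>\<^bsub>R\<^esub> (tval (a # x) \<otimes>\<^bsub>R\<^esub> tval y)"
      using cl uv by (simp add: u_def v_def R.m_ac)
    also have "\<dots> = t b \<otimes>\<^bsub>R\<^esub> wsum tval (quasi_shuffles A (a # x) y)"
      by (simp only: Cons.IH[OF y])
    finally have 2: "P (v \<otimes>\<^bsub>R\<^esub> P u) = wsum tval (map (\<lambda>(j, w). (j, b # w)) (quasi_shuffles A (a # x) y))"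
      using weighted_sum_linear[OF lin[OF ab(2)] R_module R_module lam_closed tval_closed[OF q2]]
      by (simp add: weighted_sum_Cons)
    have "u \<otimes>\<^bsub>R\<^esub> v = t (a \<otimes>\<^bsub>A\<^esub> b) \<otimes>\<^bsub>R\<^esub> (tval x \<otimes>\<^bsub>R\<^esub> tval y)"
      using cl uv ab by (simp add: u_def v_def t_mult R.m_ac)
    also have "\<dots> = t (a \<otimes>\<^bsub>A\<^esub> b) \<otimes>\<^bsub>R\<^esub> wsum tval (quasi_shuffles A x y)" by (simp only: outer(1)[OF x y])
    finally have 3: "lam \<odot>\<^bsub>R\<^esub> P (u \<otimes>\<^bsub>R\<^esub> v) = wsum tval (map (\<lambda>(j, w). (Suc j, (a \<otimes>\<^bsub>A\<^esub> b) # w)) (quasi_shuffles A x y))"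
      using weighted_sum_linear[OF linear_comp[OF lin[OF ab(3)] R.smult_linear[OF lam_closed]]
          R_module R_module lam_closed tval_closed[OF q3]]
        R.weighted_sum_Suc[where f = tval, OF lam_closed Cons_closed[OF ab(3) q3]]
      by simp
    have "tval (a # x) \<otimes>\<^bsub>R\<^esub> tval (b # y) = P u \<otimes>\<^bsub>R\<^esub> P v" by (simp add: u_def v_def)
    also have "\<dots> = P (u \<otimes>\<^bsub>R\<^esub> P v) \<oplus>\<^bsub>R\<^esub> P (v \<otimes>\<^bsub>R\<^esub> P u) \<oplus>\<^bsub>R\<^esub> lam \<odot>\<^bsub>R\<^esub> P (u \<otimes>\<^bsub>R\<^esub> v)"
      by (rule R.baxter_identity[OF uv])
    also have "\<dots> = P (u \<otimes>\<^bsub>R\<^esub> P v) \<oplus>\<^bsub>R\<^esub> (P (v \<otimes>\<^bsub>R\<^esub> P u) \<oplus>\<^bsub>R\<^esub> lam \<odot>\<^bsub>R\<^esub> P (u \<otimes>\<^bsub>R\<^esub> v))"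
      using uv cl lam_closed by (intro R.M.a_assoc) auto
    also have "\<dots> = wsum tval (quasi_shuffles A (a # x) (b # y))"
      unfolding 1 2 3 quasi_shuffles.simps
      by (subst R.weighted_sum_append[OF lam_closed]; (subst R.weighted_sum_append[OF lam_closed])?)
         (auto intro!: Cons_closed ab simp del: tval.simps dest: q1 q2 q3)
    finally show ?case .
  qed
qed

lemma val_mult:
  assumes "a \<in> carrier A" "b \<in> carrier A" "set x \<subseteq> carrier A" "set y \<subseteq> carrier A"
  shows "val (a # x) \<otimes>\<^bsub>R\<^esub> val (b # y) = wsum (\<lambda>w. val ((a \<otimes>\<^bsub>A\<^esub> b) # w)) (quasi_shuffles A x y)"
proof -
  have "val (a # x) \<otimes>\<^bsub>R\<^esub> val (b # y) = t (a \<otimes>\<^bsub>A\<^esub> b) \<otimes>\<^bsub>R\<^esub> (tval x \<otimes>\<^bsub>R\<^esub> tval y)"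
    using assms by (simp add: val_Cons t_mult t_closed tval_closed R.m_ac)
  also have "\<dots> = t (a \<otimes>\<^bsub>A\<^esub> b) \<otimes>\<^bsub>R\<^esub> wsum tval (quasi_shuffles A x y)"
    using assms by (simp add: tval_mult)
  also have "\<dots> = wsum (\<lambda>w. val ((a \<otimes>\<^bsub>A\<^esub> b) # w)) (quasi_shuffles A x y)"
    unfolding val_Cons
    by (rule weighted_sum_linear[OF R.mult_left_linear[OF t_closed[OF A.m_closed[OF assms(1,2)]]] R_module R_module
          lam_closed tval_closed[OF quasi_shuffles_carrier[OF A.M_cring assms(3,4)]]])
  finally show ?thesis .
qed

definition Phi :: "('a, 'c) shuffle_elem \<Rightarrow> 'r"
  where "Phi = sh_lift C A R val"

lemma Phi_linear: "Phi \<in> linear_maps C H R"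
  unfolding Phi_def by (rule sh_lift_linear[OF R_module val_multilinear])

lemma Phi_pure: "us \<in> words \<Longrightarrow> Phi (sh_pure C A us) = val us"
  unfolding Phi_def by (rule sh_lift_pure[OF R_module val_multilinear])

lemma Phi_P:
  assumes "X \<in> carrier H" shows "Phi (sh_P C A X) = P (Phi X)"
proof (rule linear_eq_on_sh_pure[OF linear_comp[OF sh_P_linear Phi_linear] linear_comp[OF Phi_linear P_linear] _ assms])
  fix us assume us: "us \<in> words"
  then obtain a x where ax: "us = a # x" by (cases us) auto
  have "\<one>\<^bsub>A\<^esub> # us \<in> words" using us by simp
  moreover have "val (\<one>\<^bsub>A\<^esub> # us) = P (val us)"
    using us tval_closed[of us] by (simp add: val_Cons t_one ax)
  ultimately show "Phi (sh_P C A (sh_pure C A us)) = P (Phi (sh_pure C A us))"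
    using us by (simp only: sh_P_pure Phi_pure)
qed

text \<open>
  The shuffle product is defined separately for an empty tail; the recursion yields a single word with
  coefficient \<open>1\<close> there, so one formula covers all cases.
\<close>

lemma sh_mult_pure_weighted_sum:
  assumes "a \<in> carrier A" "b \<in> carrier A" and xy: "set x \<subseteq> carrier A" "set y \<subseteq> carrier A"
  shows "sh_mult_pure C lam A (a # x) (b # y)
    = weighted_sum C lam H (\<lambda>w. sh_pure C A ((a \<otimes>\<^bsub>A\<^esub> b) # w)) (quasi_shuffles A x y)"
proof -
  have cl: "sh_pure C A ((a \<otimes>\<^bsub>A\<^esub> b) # w) \<in> carrier H" if "set w \<subseteq> carrier A" for w
    by (rule sh_pure_closed) (use assms that in simp)
  consider "x = []" | "x \<noteq> []" "y = []" | "x \<noteq> []" "y \<noteq> []" by blast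
  thus ?thesis
  proof cases
    case 1
    thus ?thesis using cl[OF xy(2)] by (simp add: sh_mult_pure_def weighted_sum_def list_sum_def)
  next
    case 2
    thus ?thesis using cl[OF xy(1)] by (cases x) (simp_all add: sh_mult_pure_def weighted_sum_def list_sum_def)
  next
    case 3
    obtain L where L: "distinct L" "set L = mixable_shuffles (length x) (length y)"
      "map (\<lambda>(\<sigma>, T). (card T, mixed_word A x y \<sigma> T)) L = quasi_shuffles A x y"
      using mixable_shuffles_quasi[of x y A] by blast
    let ?g = "\<lambda>(j, w). lam [^]\<^bsub>C\<^esub> (j :: nat) \<odot>\<^bsub>H\<^esub> sh_pure C A ((a \<otimes>\<^bsub>A\<^esub> b) # w)"
    let ?f = "\<lambda>p. lam [^]\<^bsub>C\<^esub> card (snd p) \<odot>\<^bsub>H\<^esub> sh_pure C A ((a \<otimes>\<^bsub>A\<^esub> b) # mixed_word A x y (fst p) (snd p))"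
    have eq: "map ?f L = map ?g (quasi_shuffles A x y)"
      unfolding L(3)[symmetric] map_map by (rule map_cong[OF refl]) auto
    have terms: "set (map ?g (quasi_shuffles A x y)) \<subseteq> carrier H"
      by (rule H.weighted_terms_closed[OF lam_closed], rule cl, rule quasi_shuffles_carrier[OF A.M_cring xy])
    have "sh_mult_pure C lam A (a # x) (b # y) = (\<Oplus>\<^bsub>H\<^esub>p\<in>set L. ?f p)"
      using 3 by (simp add: sh_mult_pure_def L(2))
    also have "\<dots> = list_sum H (map ?f L)"
      by (rule H.M.finsum_distinct_list[OF L(1)]) (use terms in \<open>simp only: eq[symmetric] set_map\<close>)
    finally show ?thesis by (simp only: eq weighted_sum_def)
  qed
qed

lemma sh_mult_pure_closed:
  assumes "us \<in> words" "vs \<in> words" shows "sh_mult_pure C lam A us vs \<in> carrier H"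
  and Phi_sh_mult_pure: "Phi (sh_mult_pure C lam A us vs) = val us \<otimes>\<^bsub>R\<^esub> val vs"
proof -
  obtain a x b y where uv: "us = a # x" "vs = b # y" using assms by (cases us; cases vs) auto
  have ab: "a \<in> carrier A" "b \<in> carrier A" and xy: "set x \<subseteq> carrier A" "set y \<subseteq> carrier A" using assms uv by auto
  have w: "(a \<otimes>\<^bsub>A\<^esub> b) # w \<in> words" if "(j, w) \<in> set (quasi_shuffles A x y)" for j w
    using quasi_shuffles_carrier[OF A.M_cring xy that] ab by auto
  note e = sh_mult_pure_weighted_sum[OF ab xy]
  show "sh_mult_pure C lam A us vs \<in> carrier H"
    unfolding uv e by (rule H.weighted_sum_closed[OF lam_closed sh_pure_closed[OF w]])
  have "Phi (sh_mult_pure C lam A us vs) = wsum (\<lambda>w. Phi (sh_pure C A ((a \<otimes>\<^bsub>A\<^esub> b) # w))) (quasi_shuffles A x y)"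
    unfolding uv e by (rule weighted_sum_linear[OF Phi_linear H_module R_module lam_closed sh_pure_closed[OF w]])
  also have "\<dots> = wsum (\<lambda>w. val ((a \<otimes>\<^bsub>A\<^esub> b) # w)) (quasi_shuffles A x y)"
    unfolding weighted_sum_def by (rule arg_cong[where f = "list_sum R"], rule map_cong) (auto dest!: w simp: Phi_pure)
  also have "\<dots> = val us \<otimes>\<^bsub>R\<^esub> val vs" using val_mult[OF ab xy] by (simp add: uv)
  finally show "Phi (sh_mult_pure C lam A us vs) = val us \<otimes>\<^bsub>R\<^esub> val vs" .
qed

context
  assumes inj: "inj_on Phi (carrier H)"
begin

text \<open>
  The formula for the shuffle product is not visibly linear in the letters that are merged or moved.
  Its image under the injective map \<open>Phi\<close>, however, is a product of two multilinear expressions.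
\<close>

lemma sh_mult_pure_multilinear:
  assumes "us \<in> words" shows "multilinear C A (k + 1) H (sh_mult_pure C lam A us)"
proof (rule multilinear_reflect[OF Phi_linear inj A_module H_module])
  have "multilinear C A (k + 1) R (\<lambda>vs. val us \<otimes>\<^bsub>R\<^esub> val vs)"
    by (rule multilinear_comp[OF val_multilinear R.mult_left_linear[OF val_closed[OF assms]]])
  moreover have "Phi (sh_mult_pure C lam A us vs) = val us \<otimes>\<^bsub>R\<^esub> val vs" if "vs \<in> tuples A (k + 1)" for vs
    by (rule Phi_sh_mult_pure[OF assms tuple_words[OF that]])
  ultimately show "multilinear C A (k + 1) R (\<lambda>vs. Phi (sh_mult_pure C lam A us vs))"
    by (rule multilinear_cong[OF _ A_module])
qed (rule sh_mult_pure_closed[OF assms tuple_words])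

lemma sh_mult_left:
  assumes us: "us \<in> words" and Y: "Y \<in> carrier H"
  shows "sh_lift C A H (sh_mult_pure C lam A us) Y \<in> carrier H"
    and "Phi (sh_lift C A H (sh_mult_pure C lam A us) Y) = val us \<otimes>\<^bsub>R\<^esub> Phi Y"
proof -
  note lin = sh_lift_linear[OF H_module sh_mult_pure_multilinear[OF us]]
  show "sh_lift C A H (sh_mult_pure C lam A us) Y \<in> carrier H" by (rule linear_closed[OF lin Y])
  show "Phi (sh_lift C A H (sh_mult_pure C lam A us) Y) = val us \<otimes>\<^bsub>R\<^esub> Phi Y"
    by (rule linear_eq_on_sh_pure[OF linear_comp[OF lin Phi_linear]
          linear_comp[OF Phi_linear R.mult_left_linear[OF val_closed[OF us]]] _ Y])
       (simp only: sh_lift_pure[OF H_module sh_mult_pure_multilinear[OF us]] Phi_sh_mult_pure us Phi_pure)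
qed

lemma sh_mult_left_multilinear:
  assumes Y: "Y \<in> carrier H"
  shows "multilinear C A (k + 1) H (\<lambda>us. sh_lift C A H (sh_mult_pure C lam A us) Y)"
proof (rule multilinear_reflect[OF Phi_linear inj A_module H_module])
  have "multilinear C A (k + 1) R (\<lambda>us. val us \<otimes>\<^bsub>R\<^esub> Phi Y)"
    by (rule multilinear_comp[OF val_multilinear R.mult_right_linear[OF linear_closed[OF Phi_linear Y]]])
  moreover have "Phi (sh_lift C A H (sh_mult_pure C lam A us) Y) = val us \<otimes>\<^bsub>R\<^esub> Phi Y" if "us \<in> tuples A (k + 1)" for us
    by (rule sh_mult_left(2)[OF tuple_words[OF that] Y])
  ultimately show "multilinear C A (k + 1) R (\<lambda>us. Phi (sh_lift C A H (sh_mult_pure C lam A us) Y))"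
    by (rule multilinear_cong[OF _ A_module])
qed (rule sh_mult_left(1)[OF tuple_words Y])

lemma sh_mult_closed: "X \<in> carrier H \<Longrightarrow> Y \<in> carrier H \<Longrightarrow> sh_mult lam X Y \<in> carrier H"
  unfolding sh_mult_def by (rule linear_closed[OF sh_lift_linear[OF H_module sh_mult_left_multilinear]])

lemma Phi_mult:
  assumes X: "X \<in> carrier H" and Y: "Y \<in> carrier H"
  shows "Phi (sh_mult lam X Y) = Phi X \<otimes>\<^bsub>R\<^esub> Phi Y"
  unfolding sh_mult_def
  by (rule linear_eq_on_sh_pure[OF linear_comp[OF sh_lift_linear[OF H_module sh_mult_left_multilinear[OF Y]] Phi_linear]
        linear_comp[OF Phi_linear R.mult_right_linear[OF linear_closed[OF Phi_linear Y]]] _ X])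
     (simp only: sh_lift_pure[OF H_module sh_mult_left_multilinear[OF Y]] sh_mult_left(2) Y Phi_pure)

lemma Phi_one: "Phi (sh_pure C A [\<one>\<^bsub>A\<^esub>]) = \<one>\<^bsub>R\<^esub>"
  by (subst Phi_pure) (simp_all add: val_Cons t_one)

lemma Phi_incl: "a \<in> carrier A \<Longrightarrow> Phi (sh_incl C A a) = t a"
  unfolding sh_incl_def by (subst Phi_pure) (simp_all add: val_Cons t_closed)

text \<open>
  All laws are inherited from \<open>R\<close> through the injective map \<open>Phi\<close>.
\<close>

lemma Sh_baxter: "baxter_algebra C lam (Sh C lam A) (sh_P C A)"
proof -
  have alg: "algebra C (Sh C lam A)"
  proof (rule algebra_by_injection[OF Sh_module R.algebra_axioms, of Phi], unfold linear_Sh Sh_simps)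
    show "sh_pure C A [\<one>\<^bsub>A\<^esub>] \<in> carrier H" by (rule sh_pure_closed) simp
  qed (fact Phi_linear inj sh_mult_closed Phi_one Phi_mult)+
  show ?thesis
    by (rule baxter_algebra_by_injection[OF alg baxter, of Phi], unfold linear_Sh Sh_simps)
       (fact Phi_linear inj Phi_mult linear_closed[OF sh_P_linear] Phi_P)+
qed

lemma sh_pure_Cons:
  assumes "a \<in> carrier A" "us \<in> words"
  shows "sh_pure C A (a # us) = sh_mult lam (sh_incl C A a) (sh_P C A (sh_pure C A us))"
proof (rule inj_onD[OF inj])
  have 1: "a # us \<in> words" "[a] \<in> words" "\<one>\<^bsub>A\<^esub> # us \<in> words" using assms by auto
  have tval: "tval us \<in> carrier R" by (rule tval_closed) (use assms in simp)
  show "sh_pure C A (a # us) \<in> carrier H" by (rule sh_pure_closed[OF 1(1)])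
  show "sh_mult lam (sh_incl C A a) (sh_P C A (sh_pure C A us)) \<in> carrier H"
    unfolding sh_incl_def
    by (intro sh_mult_closed sh_pure_closed 1 linear_closed[OF sh_P_linear] assms)
  have "Phi (sh_mult lam (sh_incl C A a) (sh_P C A (sh_pure C A us))) = val [a] \<otimes>\<^bsub>R\<^esub> val (\<one>\<^bsub>A\<^esub> # us)"
    unfolding sh_incl_def
    by (simp only: Phi_mult sh_pure_closed 1 linear_closed[OF sh_P_linear] assms sh_P_pure Phi_pure)
  also have "\<dots> = val (a # us)" using tval t_closed[OF assms(1)] by (simp add: val_Cons t_one)
  finally show "Phi (sh_pure C A (a # us)) = Phi (sh_mult lam (sh_incl C A a) (sh_P C A (sh_pure C A us)))"
    by (simp only: Phi_pure[OF 1(1)])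
qed

end

end


section \<open>The standard Baxter algebra\<close>

context tensor_setting
begin

sublocale D: direct_system C "tensor_power C A" "tensor_one C A"
proof (rule direct_system.intro)
  fix n
  show "algebra C (T n)" by (rule tensor_power_algebra)
  show "tensor_one C A n \<in> linear_maps C (T n) (T (Suc n))"
    using tensor_one_linear by simp
  show "tensor_one C A n \<one>\<^bsub>T n\<^esub> = \<one>\<^bsub>T (Suc n)\<^esub>" using tensor_one_one by simp
  fix X Y assume "X \<in> carrier (T n)" "Y \<in> carrier (T n)"
  thus "tensor_one C A n (X \<otimes>\<^bsub>T n\<^esub> Y) = tensor_one C A n X \<otimes>\<^bsub>T (Suc n)\<^esub> tensor_one C A n Y"
    using tensor_one_mult[of X n Y] by simp
qed

lemma cls_eq_zero:
  assumes "1 \<le> n" "X \<in> carrier (T n)" "D.cls n X = \<zero>\<^bsub>D.L\<^esub>" shows "X = \<zero>\<^bsub>T n\<^esub>"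
  using inj_onD[OF D.cls_inj[OF tensor_one_inj assms(1)], of X "\<zero>\<^bsub>T n\<^esub>"] assms D.cls_zero[OF assms(1)]
    T.M.zero_closed[of n] by simp

abbreviation "S \<equiv> big_algebra C A"

lemma big_algebra_alt: "S = sequence_algebra D.L"
  by (simp add: big_algebra_def Abar_def)

lemma last_slot_tuple: "1 \<le> k \<Longrightarrow> a \<in> carrier A \<Longrightarrow> replicate (k - 1) \<one>\<^bsub>A\<^esub> @ [a] \<in> tuples A k"
  by (auto simp: tuples_def)

lemma t_seq_at: "1 \<le> k \<Longrightarrow> t_seq C A a k = D.cls k (pure (replicate (k - 1) \<one>\<^bsub>A\<^esub> @ [a]))"
  by (simp add: t_seq_def)

lemma t_seq_at_linear: "1 \<le> k \<Longrightarrow> (\<lambda>a. t_seq C A a k) \<in> linear_maps C A D.L"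
proof -
  assume k: "1 \<le> k"
  have "(\<lambda>a. pure (replicate (k - 1) \<one>\<^bsub>A\<^esub> @ a # [])) \<in> linear_maps C A (T k)"
    using k by (intro multilinear_slot[OF pure_multilinear]) auto
  from linear_comp[OF this D.cls_linear[OF k]] show ?thesis by (simp only: t_seq_at[OF k])
qed

lemma sequence_eqI:
  assumes "s \<in> carrier S" "s' \<in> carrier S" "\<And>k. 1 \<le> k \<Longrightarrow> s k = s' k" shows "s = s'"
  using assms by (intro PiE_ext[of s "{1..}" "\<lambda>_. carrier D.L" s']) (auto simp: big_algebra_alt)

sublocale L: algebra C D.L by (rule D.direct_limit_algebra)
sublocale S: algebra C S unfolding big_algebra_alt by (rule L.sequence_algebra_algebra)

lemma t_seq_linear: "t_seq C A \<in> linear_maps C A S"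
proof (rule linear_mapsI)
  note lin = t_seq_at_linear
  have cl: "t_seq C A a \<in> carrier S" if "a \<in> carrier A" for a
    using linear_closed[OF lin that] by (auto simp: big_algebra_alt t_seq_def)
  fix a assume a: "a \<in> carrier A"
  show "t_seq C A a \<in> carrier S" by (rule cl[OF a])
  show "t_seq C A (c \<odot>\<^bsub>A\<^esub> a) = c \<odot>\<^bsub>S\<^esub> t_seq C A a" if c: "c \<in> carrier C" for c
    by (rule sequence_eqI)
      (use a c in \<open>simp_all add: cl S.smult_closed linear_smult[OF lin], simp add: big_algebra_alt\<close>)
  fix b assume b: "b \<in> carrier A"
  show "t_seq C A (a \<oplus>\<^bsub>A\<^esub> b) = t_seq C A a \<oplus>\<^bsub>S\<^esub> t_seq C A b"
    by (rule sequence_eqI)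
      (use a b in \<open>simp_all add: cl S.M.a_closed linear_add[OF lin], simp add: big_algebra_alt\<close>)
qed

lemma t_seq_mult:
  assumes "a \<in> carrier A" "b \<in> carrier A"
  shows "t_seq C A (a \<otimes>\<^bsub>A\<^esub> b) = t_seq C A a \<otimes>\<^bsub>S\<^esub> t_seq C A b"
proof (rule sequence_eqI)
  note cl = linear_closed[OF t_seq_linear]
  show "t_seq C A (a \<otimes>\<^bsub>A\<^esub> b) \<in> carrier S" "t_seq C A a \<otimes>\<^bsub>S\<^esub> t_seq C A b \<in> carrier S"
    using assms by (simp_all add: cl)
  fix k :: nat assume k: "1 \<le> k"
  let ?u = "\<lambda>a. replicate (k - 1) \<one>\<^bsub>A\<^esub> @ [a]"
  have "map2 (mult A) (?u a) (?u b) = map2 (mult A) (replicate (k - 1) \<one>\<^bsub>A\<^esub>) (replicate (k - 1) \<one>\<^bsub>A\<^esub>) @ [a \<otimes>\<^bsub>A\<^esub> b]"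
    by simp
  hence "map2 (mult A) (?u a) (?u b) = ?u (a \<otimes>\<^bsub>A\<^esub> b)"
    by (simp only: map2_mult_one[OF ones_tuple])
  hence "t_seq C A (a \<otimes>\<^bsub>A\<^esub> b) k = t_seq C A a k \<otimes>\<^bsub>D.L\<^esub> t_seq C A b k"
    using k assms by (simp only: t_seq_at D.cls_mult pure_closed last_slot_tuple tensor_mult_pure)
  thus "t_seq C A (a \<otimes>\<^bsub>A\<^esub> b) k = (t_seq C A a \<otimes>\<^bsub>S\<^esub> t_seq C A b) k"
    using k by (simp add: big_algebra_alt)
qed

lemma t_seq_one: "t_seq C A \<one>\<^bsub>A\<^esub> = \<one>\<^bsub>S\<^esub>"
proof (rule sequence_eqI)
  fix k :: nat assume k: "1 \<le> k"
  have "replicate (k - 1) \<one>\<^bsub>A\<^esub> @ [\<one>\<^bsub>A\<^esub>] = replicate k \<one>\<^bsub>A\<^esub>"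
    using k by (simp add: replicate_append_same flip: replicate_Suc)
  hence "t_seq C A \<one>\<^bsub>A\<^esub> k = \<one>\<^bsub>D.L\<^esub>" using k D.cls_one[OF k] by (simp only: t_seq_at tensor_one_def')
  thus "t_seq C A \<one>\<^bsub>A\<^esub> k = \<one>\<^bsub>S\<^esub> k" using k by (simp add: big_algebra_alt)
qed (simp_all add: linear_closed[OF t_seq_linear])

lemma S_at:
  "1 \<le> k \<Longrightarrow> (s \<otimes>\<^bsub>S\<^esub> s') k = s k \<otimes>\<^bsub>D.L\<^esub> s' k"
  "1 \<le> k \<Longrightarrow> \<one>\<^bsub>S\<^esub> k = \<one>\<^bsub>D.L\<^esub>" "1 \<le> k \<Longrightarrow> \<zero>\<^bsub>S\<^esub> k = \<zero>\<^bsub>D.L\<^esub>"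
  by (simp_all add: big_algebra_alt)

lemma std_P_at: "1 \<le> k \<Longrightarrow> std_P C lam A s k = lam \<odot>\<^bsub>D.L\<^esub> (\<Oplus>\<^bsub>D.L\<^esub>i\<in>{1..<k}. s i)"
  by (simp add: std_P_def partial_sum_operator_def Abar_def)

lemma component_linear: "1 \<le> k \<Longrightarrow> (\<lambda>s. s k) \<in> linear_maps C S D.L"
  by (rule linear_mapsI) (auto simp: big_algebra_alt dest: PiE_mem)

end

section \<open>The isomorphism\<close>

locale regular_weight = tensor_setting C A
  for C :: "('c, 'k) ring_scheme" and A :: "('c, 'a, 'm) module_scheme" +
  fixes lam :: 'c
  assumes weight_closed: "lam \<in> carrier C"
    and weight_regular: "x \<in> carrier (Abar C A) \<Longrightarrow> lam \<odot>\<^bsub>Abar C A\<^esub> x = \<zero>\<^bsub>Abar C A\<^esub> \<Longrightarrow> x = \<zero>\<^bsub>Abar C A\<^esub>"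
begin

sublocale baxter_target C A lam S "std_P C lam A" "t_seq C A"
proof (intro baxter_target.intro baxter_target_axioms.intro tensor_setting_axioms)
  show "baxter_algebra C lam S (std_P C lam A)"
    using L.partial_sum_operator_baxter[OF weight_closed]
    by (simp add: big_algebra_alt std_P_def Abar_def)
qed (fact t_seq_linear t_seq_mult t_seq_one)+

text \<open>
  Component \<open>n + 1\<close> carries the factor \<open>\<lambda>\<^sup>n\<close>, so powers of the weight have to be cancelled.
\<close>

lemma power_regular: "x \<in> carrier D.L \<Longrightarrow> lam [^]\<^bsub>C\<^esub> (n :: nat) \<odot>\<^bsub>D.L\<^esub> x = \<zero>\<^bsub>D.L\<^esub> \<Longrightarrow> x = \<zero>\<^bsub>D.L\<^esub>"
proof (induction n arbitrary: x)
  case 0 thus ?case by simp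
next
  case (Suc n)
  hence "lam [^]\<^bsub>C\<^esub> n \<odot>\<^bsub>D.L\<^esub> (lam \<odot>\<^bsub>D.L\<^esub> x) = \<zero>\<^bsub>D.L\<^esub>"
    using weight_closed by (simp add: L.smult_assoc1)
  hence "lam \<odot>\<^bsub>D.L\<^esub> x = \<zero>\<^bsub>D.L\<^esub>"
    by (rule Suc.IH[OF L.smult_closed[OF weight_closed Suc.prems(1)]])
  thus ?case using weight_regular[of x, unfolded Abar_def] Suc.prems(1) by simp
qed

lemma val_at: "1 \<le> k \<Longrightarrow> val (a # x) k = t_seq C A a k \<otimes>\<^bsub>D.L\<^esub> tval x k"
  by (simp only: val_Cons S_at)

lemma tval_at:
  "1 \<le> k \<Longrightarrow> x \<noteq> [] \<Longrightarrow> tval x k = lam \<odot>\<^bsub>D.L\<^esub> (\<Oplus>\<^bsub>D.L\<^esub>i\<in>{1..<k}. val x i)"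
  by (cases x) (simp_all only: tval_Cons_val std_P_at list.simps simp_thms)

lemma val_closed_at: "us \<in> words \<Longrightarrow> 1 \<le> k \<Longrightarrow> val us k \<in> carrier D.L"
  by (rule linear_closed[OF component_linear val_closed])

text \<open>
  Component \<open>n\<close> of \<open>t(a) P(val x)\<close> involves the components of \<open>val x\<close> below \<open>n\<close> only.  If \<open>x\<close> has
  \<open>m\<close> letters, these vanish below \<open>m\<close>, so component \<open>m + 1\<close> is the first that can be nonzero, and
  only the lowest component of \<open>val x\<close> enters there.  The letter \<open>a\<close> is put behind the reversal of
  \<open>x\<close>.
\<close>

lemma val_lowest:
  assumes "us \<in> tuples A n" "1 \<le> n"
  shows "(\<forall>k. 1 \<le> k \<longrightarrow> k < n \<longrightarrow> val us k = \<zero>\<^bsub>D.L\<^esub>)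
    \<and> val us n = lam [^]\<^bsub>C\<^esub> (n - 1) \<odot>\<^bsub>D.L\<^esub> D.cls n (pure (rev us))"
  using assms
proof (induction us arbitrary: n)
  case Nil thus ?case by (simp add: tuples_def)
next
  case (Cons a x)
  have a: "a \<in> carrier A" and x: "x \<in> tuples A (n - 1)" "set x \<subseteq> carrier A" using Cons.prems by (auto simp: tuples_def)
  show ?case
  proof (cases "x = []")
    case True
    hence n: "n = 1" using Cons.prems by (simp add: tuples_def)
    have "val [a] 1 = D.cls 1 (pure [a])"
      using val_at[of 1 a "[]"] linear_closed[OF t_seq_at_linear[of 1] a] t_seq_at[of 1 a]
      by (simp add: S_at)
    moreover have "D.cls 1 (pure [a]) \<in> carrier D.L"
      using a by (intro D.cls_closed pure_closed) (auto simp: tuples_def)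
    ultimately show ?thesis by (simp add: True n)
  next
    case False
    define m where "m = n - 1"
    have "n = Suc (length x)" using Cons.prems by (simp add: tuples_def)
    hence m: "1 \<le> m" "n = Suc m" "x \<in> tuples A m" and xw: "x \<in> words"
      using x False by (auto simp: m_def tuples_def Suc_le_eq)
    have IH: "val x k = \<zero>\<^bsub>D.L\<^esub>" if "1 \<le> k" "k < m" for k
      using Cons.IH[OF m(3,1)] that by blast
    have IH': "val x m = lam [^]\<^bsub>C\<^esub> (m - 1) \<odot>\<^bsub>D.L\<^esub> D.cls m (pure (rev x))"
      using Cons.IH[OF m(3,1)] by blast
    have zero: "(\<Oplus>\<^bsub>D.L\<^esub>i\<in>{1..<k}. val x i) = \<zero>\<^bsub>D.L\<^esub>" if "k \<le> m" for k
      by (rule L.M.add.finprod_one_eqI) (use IH that in auto)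
    have "val (a # x) k = \<zero>\<^bsub>D.L\<^esub>" if "1 \<le> k" "k < n" for k
      using that zero[of k] False m weight_closed linear_closed[OF t_seq_at_linear[OF that(1)] a]
      by (simp add: val_at tval_at)
    moreover have "val (a # x) n = lam [^]\<^bsub>C\<^esub> (n - 1) \<odot>\<^bsub>D.L\<^esub> D.cls n (pure (rev (a # x)))"
    proof -
      have rx: "rev x \<in> tuples A m" using m(3) by (simp add: tuples_def)
      note rx1 = append_one_tuple[OF rx]
      have u: "replicate m \<one>\<^bsub>A\<^esub> @ [a] \<in> tuples A n" using last_slot_tuple[of n a] a m by simp
      have "(\<Oplus>\<^bsub>D.L\<^esub>i\<in>{1..<n}. val x i) = val x m"
        using L.psum_Suc[of "val x" m] val_closed_at[OF xw] zero[of m] m by simp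
      hence "tval x n = lam \<odot>\<^bsub>D.L\<^esub> (lam [^]\<^bsub>C\<^esub> (m - 1) \<odot>\<^bsub>D.L\<^esub> D.cls m (pure (rev x)))"
        using tval_at[of n x] m False IH' by simp
      also have "\<dots> = lam [^]\<^bsub>C\<^esub> m \<odot>\<^bsub>D.L\<^esub> D.cls m (pure (rev x))"
      proof -
        have "lam [^]\<^bsub>C\<^esub> m = lam \<otimes>\<^bsub>C\<^esub> lam [^]\<^bsub>C\<^esub> (m - 1)"
          using m(1) weight_closed C.nat_pow_Suc2[of lam "m - 1"] by simp
        thus ?thesis using weight_closed D.cls_closed[OF m(1) pure_closed[OF rx]]
          by (simp add: L.smult_assoc1)
      qed
      also have "D.cls m (pure (rev x)) = D.cls n (pure (rev x @ [\<one>\<^bsub>A\<^esub>]))"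
        using D.cls_tr[OF m(1) _ pure_closed[OF rx], of n] D.tr_Suc[of m m] m
        by (simp add: tensor_one_pure[OF rx])
      finally have g: "tval x n = lam [^]\<^bsub>C\<^esub> m \<odot>\<^bsub>D.L\<^esub> D.cls n (pure (rev x @ [\<one>\<^bsub>A\<^esub>]))" .
      have rx1': "rev x @ [\<one>\<^bsub>A\<^esub>] \<in> tuples A n" using rx1 m by simp
      have "map2 (mult A) (replicate m \<one>\<^bsub>A\<^esub> @ [a]) (rev x @ [\<one>\<^bsub>A\<^esub>])
          = map2 (mult A) (replicate m \<one>\<^bsub>A\<^esub>) (rev x) @ [a \<otimes>\<^bsub>A\<^esub> \<one>\<^bsub>A\<^esub>]"
        using rx by (simp add: tuples_def)
      also have "\<dots> = rev (a # x)" using map2_mult_one[OF rx] a by simp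
      finally have w: "map2 (mult A) (replicate m \<one>\<^bsub>A\<^esub> @ [a]) (rev x @ [\<one>\<^bsub>A\<^esub>]) = rev (a # x)" .
      have n1: "1 \<le> n" using m by simp
      have "val (a # x) n = D.cls n (pure (replicate m \<one>\<^bsub>A\<^esub> @ [a])) \<otimes>\<^bsub>D.L\<^esub>
          (lam [^]\<^bsub>C\<^esub> m \<odot>\<^bsub>D.L\<^esub> D.cls n (pure (rev x @ [\<one>\<^bsub>A\<^esub>])))"
        using val_at[OF n1] t_seq_at[OF n1] g m by simp
      also have "\<dots> = lam [^]\<^bsub>C\<^esub> m \<odot>\<^bsub>D.L\<^esub> (D.cls n (pure (replicate m \<one>\<^bsub>A\<^esub> @ [a])) \<otimes>\<^bsub>D.L\<^esub> D.cls n (pure (rev x @ [\<one>\<^bsub>A\<^esub>])))"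
        by (intro L.smult_assoc2_right D.cls_closed pure_closed n1 u rx1' C.nat_pow_closed weight_closed)
      also have "D.cls n (pure (replicate m \<one>\<^bsub>A\<^esub> @ [a])) \<otimes>\<^bsub>D.L\<^esub> D.cls n (pure (rev x @ [\<one>\<^bsub>A\<^esub>])) = D.cls n (pure (rev (a # x)))"
        by (simp only: D.cls_mult n1 pure_closed u rx1' tensor_mult_pure w)
      finally show ?thesis using m by simp
    qed
    ultimately show ?thesis by blast
  qed
qed

text \<open>
  Parts of degree above \<open>n\<close> do not reach component \<open>n + 1\<close>, and there are no parts below degree
  \<open>n\<close>.
\<close>

lemma Phi_lowest:
  assumes X: "X \<in> carrier H" and low: "\<And>k. k < n \<Longrightarrow> X k = \<zero>\<^bsub>T (k + 1)\<^esub>" and nz: "X n \<noteq> \<zero>\<^bsub>T (n + 1)\<^esub>"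
  shows "Phi X (n + 1) = lam [^]\<^bsub>C\<^esub> n \<odot>\<^bsub>D.L\<^esub> D.cls (n + 1) (tensor_rev (n + 1) (X n))"
proof -
  let ?K = "{k. X k \<noteq> \<zero>\<^bsub>T (k + 1)\<^esub>}"
  have n1: "1 \<le> n + 1" by simp
  have Xk: "X k \<in> carrier (T (k + 1))" and fin: "finite ?K" for k using X unfolding H_carrier by blast+
  note lin = tensor_lift_linear[OF R_module val_multilinear]
  note ev = component_linear[OF n1]
  note lin_ev = linear_comp[OF lin ev]
  have "Phi X (n + 1) = (\<Oplus>\<^bsub>D.L\<^esub>k\<in>?K. tensor_lift C S val (X k) (n + 1))"
    unfolding Phi_def sh_lift_def
    by (rule linear_finsum[OF ev R_module L.module fin]) (use linear_closed[OF lin Xk] in blast)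
  also have "\<dots> = (\<Oplus>\<^bsub>D.L\<^esub>k\<in>{n}. tensor_lift C S val (X k) (n + 1))"
  proof (rule L.M.add.finprod_mono_neutral_cong_right[OF fin])
      fix k assume "k \<in> ?K - {n}"
      hence k: "n < k" using low by (metis (mono_tags, lifting) DiffE insertCI linorder_neqE_nat mem_Collect_eq)
      have zlin: "(\<lambda>_. \<zero>\<^bsub>D.L\<^esub>) \<in> linear_maps C (T (k + 1)) D.L"
        by (rule linear_mapsI) simp_all
      show "tensor_lift C S val (X k) (n + 1) = \<zero>\<^bsub>D.L\<^esub>"
        by (rule linear_eq_on_pure[OF lin_ev zlin _ Xk], subst tensor_lift_pure[OF R_module val_multilinear])
           (use val_lowest[of _ "k + 1"] k in auto)
  qed (use nz linear_closed[OF lin_ev Xk] in auto)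
  also have "\<dots> = tensor_lift C S val (X n) (n + 1)"
    using linear_closed[OF lin_ev Xk] by (subst L.M.finsum_insert) auto
  also have "\<dots> = lam [^]\<^bsub>C\<^esub> n \<odot>\<^bsub>D.L\<^esub> D.cls (n + 1) (tensor_rev (n + 1) (X n))"
  proof (rule linear_eq_on_pure[OF lin_ev linear_comp[OF linear_comp[OF tensor_rev_linear D.cls_linear[OF n1]] L.smult_linear] _ Xk])
    show "lam [^]\<^bsub>C\<^esub> n \<in> carrier C" using weight_closed by simp
    fix us assume us: "us \<in> tuples A (n + 1)"
    show "tensor_lift C S val (pure us) (n + 1) = lam [^]\<^bsub>C\<^esub> n \<odot>\<^bsub>D.L\<^esub> D.cls (n + 1) (tensor_rev (n + 1) (pure us))"
      using val_lowest[OF us n1] us by (simp only: tensor_lift_pure[OF R_module val_multilinear] tensor_rev_pure) simp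
  qed
  finally show ?thesis .
qed

lemma Phi_inj: "inj_on Phi (carrier H)"
proof (rule linear_inj_onI[OF Phi_linear H_module R_module], rule ccontr)
  fix X assume X: "X \<in> carrier H" and z: "Phi X = \<zero>\<^bsub>S\<^esub>" and "X \<noteq> \<zero>\<^bsub>H\<^esub>"
  hence ex: "\<exists>n. X n \<noteq> \<zero>\<^bsub>T (n + 1)\<^esub>" by (auto simp: H_simps fun_eq_iff simp del: tensor_power_simps)
  define n where "n = (LEAST n. X n \<noteq> \<zero>\<^bsub>T (n + 1)\<^esub>)"
  have nz: "X n \<noteq> \<zero>\<^bsub>T (n + 1)\<^esub>" unfolding n_def by (rule LeastI_ex[OF ex])
  have low: "X k = \<zero>\<^bsub>T (k + 1)\<^esub>" if "k < n" for k using not_less_Least that unfolding n_def by blast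
  have Xn: "X n \<in> carrier (T (n + 1))" using X unfolding H_carrier by blast
  note rev = linear_closed[OF tensor_rev_linear Xn]
  have n1: "1 \<le> n + 1" by simp
  have "lam [^]\<^bsub>C\<^esub> n \<odot>\<^bsub>D.L\<^esub> D.cls (n + 1) (tensor_rev (n + 1) (X n)) = \<zero>\<^bsub>D.L\<^esub>"
    using Phi_lowest[OF X low nz] z by (simp add: S_at)
  hence "D.cls (n + 1) (tensor_rev (n + 1) (X n)) = \<zero>\<^bsub>D.L\<^esub>"
    by (rule power_regular[OF D.cls_closed[OF n1 rev]])
  hence "tensor_rev (n + 1) (X n) = \<zero>\<^bsub>T (n + 1)\<^esub>" by (rule cls_eq_zero[OF n1 rev])
  hence "tensor_rev (n + 1) \<zero>\<^bsub>T (n + 1)\<^esub> = X n" using tensor_rev_rev[OF Xn] by simp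
  hence "X n = \<zero>\<^bsub>T (n + 1)\<^esub>" using linear_zero[OF tensor_rev_linear T.module T.module, of "n + 1"] by simp
  thus False using nz by simp
qed

lemma Phi_image_subalgebra: "baxter_subalgebra C S (std_P C lam A) (Phi ` carrier H)"
  unfolding baxter_subalgebra_def
proof (intro conjI ballI)
  note cl = linear_closed[OF Phi_linear] and add = linear_add[OF Phi_linear, symmetric]
    and smult = linear_smult[OF Phi_linear, symmetric]
    and minus = linear_minus[OF Phi_linear H_module R_module, symmetric]
  have one: "\<one>\<^bsub>S\<^esub> \<in> Phi ` carrier H"
    using Phi_one[OF Phi_inj] sh_pure_closed[of "[\<one>\<^bsub>A\<^esub>]"] by (intro image_eqI[of _ _ "sh_pure C A [\<one>\<^bsub>A\<^esub>]"]) auto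
  have zero: "\<zero>\<^bsub>S\<^esub> \<in> Phi ` carrier H"
    using linear_zero[OF Phi_linear H_module R_module] by (intro image_eqI[of _ _ "\<zero>\<^bsub>H\<^esub>"]) auto
  show "subring (Phi ` carrier H) S"
    by (rule S.subringI)
      (use one in \<open>auto simp: cl add minus Phi_mult[OF Phi_inj, symmetric] sh_mult_closed[OF Phi_inj]\<close>)
  show "submodule (Phi ` carrier H) C S"
    by (rule S.submoduleI) (use zero in \<open>auto simp: cl add smult minus\<close>)
  show "std_P C lam A x \<in> Phi ` carrier H" if "x \<in> Phi ` carrier H" for x
    using that by (auto simp: Phi_P[symmetric] linear_closed[OF sh_P_linear])
qed

text \<open>
  A pure tensor is mapped to an expression in the elements \<open>t(a)\<close>, products and \<open>P\<close>.
\<close>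

lemma Phi_image_least:
  assumes K: "baxter_subalgebra C S (std_P C lam A) K" and t: "t_seq C A ` carrier A \<subseteq> K" and X: "X \<in> carrier H"
  shows "Phi X \<in> K"
proof -
  have ring: "subring K S" and sm: "submodule K C S" and P: "\<And>x. x \<in> K \<Longrightarrow> std_P C lam A x \<in> K"
    using K by (auto simp: baxter_subalgebra_def)
  have G: "tval x \<in> K" if "set x \<subseteq> carrier A" for x
    using that
    by (induction x) (use t in \<open>auto intro!: P subringE(6)[OF ring] simp: subringE(3)[OF ring]\<close>)
  show ?thesis using X
  proof (induction rule: sh_induct)
    case (pure us)
    thus ?case using t G[of "tl us"]
      by (cases us) (auto simp: Phi_pure val_Cons intro!: subringE(6)[OF ring])
  next
    case (add X Y) thus ?case by (simp add: linear_add[OF Phi_linear] subringE(7)[OF ring])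
  next
    case (smult c X) thus ?case by (simp add: linear_smult[OF Phi_linear] S.submoduleE(4)[OF sm])
  qed
qed

lemma std_baxter_eq: "std_baxter C lam A = S\<lparr>carrier := Phi ` carrier H\<rparr>"
proof -
  have "t_seq C A ` carrier A \<subseteq> Phi ` carrier H"
  proof
    fix s assume "s \<in> t_seq C A ` carrier A"
    then obtain a where a: "a \<in> carrier A" "s = t_seq C A a" by blast
    have "sh_incl C A a \<in> carrier H" unfolding sh_incl_def by (rule sh_pure_closed) (use a in simp)
    thus "s \<in> Phi ` carrier H" using Phi_incl[OF Phi_inj a(1)] a(2) by (intro image_eqI) auto
  qed
  hence "\<Inter>{K. baxter_subalgebra C S (std_P C lam A) K \<and> t_seq C A ` carrier A \<subseteq> K} = Phi ` carrier H"
    using Phi_image_subalgebra Phi_image_least by blast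
  thus ?thesis by (simp add: std_baxter_def baxter_generated_def)
qed

lemma std_baxter_simps:
  "carrier (std_baxter C lam A) = Phi ` carrier H" "zero (std_baxter C lam A) = zero S" "add (std_baxter C lam A) = add S"
  "smult (std_baxter C lam A) = smult S" "mult (std_baxter C lam A) = mult S" "one (std_baxter C lam A) = one S"
  by (simp_all add: std_baxter_eq)

text \<open>
  The inclusion into the algebra of all sequences is an injective map, so the laws are inherited once
  more.
\<close>

lemma std_baxter_baxter: "baxter_algebra C lam (std_baxter C lam A) (std_P C lam A)"
proof -
  have ring: "subring (Phi ` carrier H) S" and sm: "submodule (Phi ` carrier H) C S"
    and P: "\<And>x. x \<in> Phi ` carrier H \<Longrightarrow> std_P C lam A x \<in> Phi ` carrier H"
    using Phi_image_subalgebra by (auto simp: baxter_subalgebra_def)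
  have lin: "(\<lambda>x. x) \<in> linear_maps C (std_baxter C lam A) S"
    by (rule linear_mapsI) (auto simp: std_baxter_simps intro: linear_closed[OF Phi_linear])
  have mod: "module C (std_baxter C lam A)"
    unfolding std_baxter_eq by (rule submodule.submodule_is_module[OF sm R_module])
  have alg: "algebra C (std_baxter C lam A)"
    by (rule algebra_by_injection[OF mod S.algebra_axioms lin])
      (simp_all add: std_baxter_simps subringE(3,6)[OF ring])
  show ?thesis
    by (rule baxter_algebra_by_injection[OF alg baxter lin])
      (simp_all add: std_baxter_simps P)
qed

lemma Phi_baxter_iso:
  "Phi \<in> baxter_iso C (Sh C lam A) (sh_P C A) (std_baxter C lam A) (std_P C lam A)"
proof -
  have "Phi \<in> ring_hom (Sh C lam A) (std_baxter C lam A)"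
    by (rule ring_hom_memI)
      (simp_all add: Sh_simps std_baxter_simps Phi_mult[OF Phi_inj] linear_add[OF Phi_linear] Phi_one[OF Phi_inj])
  moreover have "bij_betw Phi (carrier (Sh C lam A)) (carrier (std_baxter C lam A))"
    using Phi_inj by (simp add: bij_betw_def Sh_simps std_baxter_simps)
  ultimately show ?thesis
    unfolding baxter_iso_def baxter_hom_def algebra_hom_def mem_Collect_eq
    by (intro conjI ballI) (simp_all only: Sh_simps std_baxter_simps linear_smult[OF Phi_linear] Phi_P)
qed

text \<open>
  A Baxter homomorphism is determined on pure tensors by induction on their length, since
  \<open>a \<otimes> u = a \<diamond> P(u)\<close>.
\<close>

lemma Phi_unique:
  assumes Psi: "\<Psi> \<in> baxter_hom C (Sh C lam A) (sh_P C A) (std_baxter C lam A) (std_P C lam A)"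
    and incl: "\<And>a. a \<in> carrier A \<Longrightarrow> \<Psi> (sh_incl C A a) = t_seq C A a"
    and X: "X \<in> carrier H"
  shows "\<Psi> X = Phi X"
proof -
  have hom: "\<Psi> \<in> ring_hom (Sh C lam A) (std_baxter C lam A)"
    and sm: "\<And>c x. c \<in> carrier C \<Longrightarrow> x \<in> carrier H \<Longrightarrow> \<Psi> (c \<odot>\<^bsub>H\<^esub> x) = c \<odot>\<^bsub>S\<^esub> \<Psi> x"
    and P: "\<And>x. x \<in> carrier H \<Longrightarrow> \<Psi> (sh_P C A x) = std_P C lam A (\<Psi> x)"
    using Psi by (simp_all add: baxter_hom_def algebra_hom_def Sh_simps std_baxter_simps)
  have lin: "\<Psi> \<in> linear_maps C H S"
  proof (rule linear_mapsI)
    fix x assume x: "x \<in> carrier H"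
    have "\<Psi> x \<in> Phi ` carrier H" using ring_hom_closed[OF hom, of x] x by (simp add: Sh_simps std_baxter_simps)
    thus "\<Psi> x \<in> carrier S" by (elim imageE) (simp only: linear_closed[OF Phi_linear])
    show "\<Psi> (x \<oplus>\<^bsub>H\<^esub> y) = \<Psi> x \<oplus>\<^bsub>S\<^esub> \<Psi> y" if "y \<in> carrier H" for y
      using ring_hom_add[OF hom, of x y] x that by (simp add: Sh_simps std_baxter_simps)
  qed (rule sm)
  have mult: "\<Psi> (sh_mult lam x y) = \<Psi> x \<otimes>\<^bsub>S\<^esub> \<Psi> y" if "x \<in> carrier H" "y \<in> carrier H" for x y
    using ring_hom_mult[OF hom, of x y] that by (simp add: Sh_simps std_baxter_simps)
  have pure: "\<Psi> (sh_pure C A us) = Phi (sh_pure C A us)" if "us \<in> words" for us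
    using that
  proof (induction us)
    case (Cons a us)
    have a: "a \<in> carrier A" using Cons.prems by simp
    have i: "sh_incl C A a \<in> carrier H" unfolding sh_incl_def by (rule sh_pure_closed) (use a in simp)
    have ei: "\<Psi> (sh_incl C A a) = Phi (sh_incl C A a)" using incl[OF a] Phi_incl[OF Phi_inj a] by simp
    show ?case
    proof (cases "us = []")
      case True thus ?thesis using ei by (simp add: sh_incl_def)
    next
      case False
      hence us: "us \<in> words" using Cons.prems by simp
      note p = sh_pure_closed[OF us]
      show ?thesis
        by (simp only: sh_pure_Cons[OF Phi_inj a us] mult Phi_mult[OF Phi_inj] i linear_closed[OF sh_P_linear p]
          P[OF p] Phi_P[OF p] ei Cons.IH[OF us])
    qed
  qed simp
  show ?thesis by (rule linear_eq_on_sh_pure[OF lin Phi_linear pure X])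
qed

end

theorem theorem4p6:
  fixes C :: "('c, 'k) ring_scheme" and A :: "('c, 'a, 'm) module_scheme" and lam :: 'c
  assumes "cring C"
    and "algebra C A"
    and "lam \<in> carrier C"
    and "\<forall>x\<in>carrier (Abar C A). lam \<odot>\<^bsub>Abar C A\<^esub> x = \<zero>\<^bsub>Abar C A\<^esub> \<longrightarrow> x = \<zero>\<^bsub>Abar C A\<^esub>"
  shows "baxter_algebra C lam (Sh C lam A) (sh_P C A)
    \<and> baxter_algebra C lam (std_baxter C lam A) (std_P C lam A)
    \<and> (\<exists>\<Phi> \<in> baxter_hom C (Sh C lam A) (sh_P C A) (std_baxter C lam A) (std_P C lam A).
          (\<forall>a\<in>carrier A. \<Phi> (sh_incl C A a) = t_seq C A a)
        \<and> (\<forall>\<Psi> \<in> baxter_hom C (Sh C lam A) (sh_P C A) (std_baxter C lam A) (std_P C lam A).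
             (\<forall>a\<in>carrier A. \<Psi> (sh_incl C A a) = t_seq C A a)
               \<longrightarrow> (\<forall>x\<in>carrier (Sh C lam A). \<Psi> x = \<Phi> x))
        \<and> \<Phi> \<in> baxter_iso C (Sh C lam A) (sh_P C A) (std_baxter C lam A) (std_P C lam A))"
proof -
  interpret regular_weight C A lam
    by (intro regular_weight.intro regular_weight_axioms.intro tensor_setting.intro assms(2,3))
      (use assms(4) in blast)
  have hom: "Phi \<in> baxter_hom C (Sh C lam A) (sh_P C A) (std_baxter C lam A) (std_P C lam A)"
    using Phi_baxter_iso by (simp add: baxter_iso_def)
  show ?thesis
    by (intro conjI Sh_baxter[OF Phi_inj] std_baxter_baxter bexI[OF _ hom] ballI impI Phi_baxter_iso Phi_incl[OF Phi_inj] Phi_unique)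
       (auto simp: Sh_simps)
qed

end
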